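(* Let $2\le n\le4$ and let $\alpha_1,\dots,\alpha_n$ be rational numbers. For a field $\Bbbk$ and distinct $\Bbbk$-rational points $P_1,\dots,P_n\in\mathbb{P}^1_{\Bbbk}$ let $D=\sum_i\alpha_iP_i$, let $g_1,\dots,g_N$ be the stable generators of $S_D$ constructed and ordered as described in the context, and let $I$ be the kernel of $\Bbbk[x_1,\dots,x_N]\to S_D$, $x_i\mapsto g_i$. Then $I$ has a Gröbner basis (with respect to the order $\prec$ described in the context) with stable leading terms: the set of initial monomials of the Gröbner basis depends only on $n$, on $(\alpha_1,\dots,\alpha_n)$ and on the (stable) choices made in constructing the generators, and not on the field $\Bbbk$ or the points $P_1,\dots,P_n$.
   Context: Canonical ring. For $D=\sum_i\alpha_iP_i$ put $\lfloor dD\rfloor=\sum_i\lfloor d\alpha_i\rfloor P_i$. The canonical ring is $S_D=\bigoplus_{d\ge0}S_d$, $S_d=u^dH^0(\mathbb{P}^1,O(\lfloor dD\rfloor))\subseteq\Bbbk(t)u^d$, where $H^0(\mathbb{P}^1,O(E))$ is the space of rational functions $f$ with $f=0$ or $\operatorname{div}(f)+E\ge0$, and $u$ is a dummy variable. Let $t_i$ be a fixed nonzero section of $O(1)$ vanishing only at $P_i$; monomials $\prod t_i^{c_i}$ with $\sum c_i=0$ are rational functions. The generators. For each degree $e\ge1$ let $r=\deg\lfloor eD\rfloor=\sum_i\lfloor e\alpha_i\rfloor$. If $r<0$ there are no generators in degree $e$. Otherwise multiplication by $u^e\prod_it_i^{-\lfloor e\alpha_i\rfloor}$ identifies $V=H^0(O(r))$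 with $S_e$. For each $c$ with $1\le c\le\lfloor e/2\rfloor$ and $S_c\ne0\ne S_{e-c}$, let $A_c=\{i:\lfloor c\alpha_i\rfloor+\lfloor(e-c)\alpha_i\rfloor=\lfloor e\alpha_i\rfloor-1\}$, and let $\mathcal{F}$ be the family of these subsets of $\{1,\dots,n\}$. (Then $\sum_cS_cS_{e-c}$ corresponds to $\sum_{A\in\mathcal{F}}V_A$, where $V_A\subseteq V$ is the space of sections vanishing at $P_i$ for all $i\in A$.) Repeatedly modify $\mathcal{F}$ by deleting any $A$ with $|A|>r$ and by replacing two distinct members $A,B$ with $|A\cup B|\le r+1$ by $A\cap B$, until neither operation applies; this does not change $\sum_{A\in\mathcal{F}}V_A$, and the resulting family has at most two members. The generators in degree $e$ are the elements $u^e\prod_it_i^{-\lfloor e\alpha_i\rfloor}\cdot m$, with $m$ running over the following monomials of degree $r$ in $t_1,\dots,t_n$ with nonnegative exponents: (i) if $\mathcal{F}=\emptyset$: choose $j\ne k$ and take $m=t_j^r,\ t_j^{r-1}t_k,\ \dots,\ t_k^r$, in this order; (ii) if $\mathcal{F}=\{A\}$: if $A=\emptyset$ there are none; otherwise choose $j\in A$ and take monomials $m$ in which $t_j$ has exponents $r,r-1,\dots,r-|A|+2,0$, in this order (one monomial for each exponent); (iii) if $\mathcal{F}=\{A,B\}$: one of the two sets has size $r$; name it $B$, choose $j\in A\setminus B$ and take monomials $m$ in which $t_j$ has exponents $r,r-1,\dots,r-|A|+2$, in this order (one for each exponent). All choices (of the reduction, of $j,k$ and of the monomials) are made depending only on $n$,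 $(\alpha_i)$ and $e$, not on $\Bbbk$ or the points. The generators $g_1,\dots,g_N$ are listed by increasing degree, and within each degree in the order indicated (thus by strictly decreasing order of vanishing at the chosen point $P_j$). They form a minimal generating set of $S_D$. Order and Gröbner basis. Grade $\Bbbk[x_1,\dots,x_N]$ by $\deg x_i=\deg g_i$. Monomials are ordered by $\prec$ as words in a dictionary: write each monomial as a word $x_{k_1}x_{k_2}\cdots x_{k_s}$ with $k_1\le k_2\le\cdots\le k_s$ and compare words lexicographically with alphabet $x_1,x_2,\dots$ in this order (a proper prefix precedes the longer word), e.g. $x_1\prec x_1^4\prec x_1^2x_3\prec x_1x_2^2\prec x_2$. The initial term $\operatorname{in}_\prec f$ of $f\neq0$ is its largest (last) term. A Gröbner basis of $I$ is a generating set whose initial terms form a minimal basis of the ideal $\operatorname{in}_\prec I$ spanned by initial terms of elements of $I$. *)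

theory Defs
  imports
    "HOL-Computational_Algebra.Computational_Algebra"
    "HOL-Library.Poly_Mapping"
begin

section \<open>Divisors and rational functions on the projective line\<close>

text \<open>
  The function field of the projective line over \<open>'k\<close> is \<open>'k poly fract\<close>.  The closed points are
  the monic irreducible polynomials together with the point at infinity; the \<open>'k\<close>-rational ones
  are \<open>Place [:-a, 1:]\<close> and \<open>Infinity\<close>.
\<close>

datatype 'p place = Place 'p | Infinity

type_synonym 'k closed_point = "'k poly place"

definition closed_points :: "('k::field) closed_point set" where
  "closed_points = insert Infinity (Place ` {p. irreducible p \<and> lead_coeff p = 1})"

definition rational_points :: "('k::field) closed_point set" where
  "rational_points = insert Infinity (range (\<lambda>a. Place [:-a, 1:]))"

fun ord_poly :: "('k::field) closed_point \<Rightarrow> 'k poly \<Rightarrow> int" where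
  "ord_poly (Place p) a = int (Max {k. p ^ k dvd a})"
| "ord_poly Infinity a = - int (degree a)"

text \<open>
  \<open>ord_poly\<close> is meant for nonzero polynomials only, and \<open>ord_at\<close> for nonzero rational functions; the
  value of the latter does not depend on the representing fraction (\<open>ord_at_Fract\<close> below).
\<close>

definition ord_at :: "('k::field) closed_point \<Rightarrow> 'k poly fract \<Rightarrow> int" where
  "ord_at x f = (THE z. \<exists>a b. a \<noteq> 0 \<and> b \<noteq> 0 \<and> f = Fract a b \<and> z = ord_poly x a - ord_poly x b)"

definition H0 :: "(('k::field) closed_point \<Rightarrow> int) \<Rightarrow> 'k poly fract set" where
  "H0 E = {f. f = 0 \<or> (\<forall>x\<in>closed_points. ord_at x f + E x \<ge> 0)}"

text \<open>The divisor \<open>\<lfloor>d D\<rfloor>\<close> for \<open>D = \<Sum>i=1..n. \<alpha> i \<cdot> P i\<close>, and its degree.\<close>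

definition floor_div ::
  "nat \<Rightarrow> (nat \<Rightarrow> rat) \<Rightarrow> (nat \<Rightarrow> ('k::field) closed_point) \<Rightarrow> nat \<Rightarrow> 'k closed_point \<Rightarrow> int" where
  "floor_div n \<alpha> P d x = (\<Sum>i | i \<in> {1..n} \<and> P i = x. \<lfloor>of_nat d * \<alpha> i\<rfloor>)"

definition floor_deg :: "nat \<Rightarrow> (nat \<Rightarrow> rat) \<Rightarrow> nat \<Rightarrow> int" where
  "floor_deg n \<alpha> d = (\<Sum>i=1..n. \<lfloor>of_nat d * \<alpha> i\<rfloor>)"


section \<open>The canonical ring\<close>

text \<open>The dummy variable \<open>u\<close> is the polynomial variable over the function field.\<close>

definition canonical_piece ::
  "nat \<Rightarrow> (nat \<Rightarrow> rat) \<Rightarrow> (nat \<Rightarrow> ('k::field) closed_point) \<Rightarrow> nat \<Rightarrow> 'k poly fract poly set" where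
  "canonical_piece n \<alpha> P d = (\<lambda>f. monom f d) ` H0 (floor_div n \<alpha> P d)"

definition canonical_ring ::
  "nat \<Rightarrow> (nat \<Rightarrow> rat) \<Rightarrow> (nat \<Rightarrow> ('k::field) closed_point) \<Rightarrow> 'k poly fract poly set" where
  "canonical_ring n \<alpha> P = {F. \<forall>d. monom (coeff F d) d \<in> canonical_piece n \<alpha> P d}"

text \<open>
  A section \<open>a X + b Y\<close> of \<open>O(1)\<close> is written as the polynomial \<open>[:b, a:]\<close> in \<open>t = X/Y\<close>.  At infinity
  its order of vanishing as a section of \<open>O(1)\<close> is \<open>1\<close> more than its order as a rational function.
  A monomial in sections whose exponents add up to \<open>0\<close> does not depend on this dehomogenization.
\<close>

definition section_ord :: "('k::field) closed_point \<Rightarrow> 'k poly \<Rightarrow> int" where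
  "section_ord x s = ord_poly x s + (if x = Infinity then 1 else 0)"

definition vanishes_only_at :: "'k::field poly \<Rightarrow> 'k closed_point \<Rightarrow> bool" where
  "vanishes_only_at s x \<longleftrightarrow>
     s \<noteq> 0 \<and> degree s \<le> 1 \<and> (\<forall>y\<in>closed_points. section_ord y s > 0 \<longleftrightarrow> y = x)"


section \<open>The stable generators\<close>

definition drop_set :: "nat \<Rightarrow> (nat \<Rightarrow> rat) \<Rightarrow> nat \<Rightarrow> nat \<Rightarrow> nat set" where
  "drop_set n \<alpha> e c =
     {i\<in>{1..n}. \<lfloor>of_nat c * \<alpha> i\<rfloor> + \<lfloor>of_nat (e - c) * \<alpha> i\<rfloor> = \<lfloor>of_nat e * \<alpha> i\<rfloor> - 1}"

definition drop_family ::
  "nat \<Rightarrow> (nat \<Rightarrow> rat) \<Rightarrow> (nat \<Rightarrow> ('k::field) closed_point) \<Rightarrow> nat \<Rightarrow> nat set set" where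
  "drop_family n \<alpha> P e =
     {drop_set n \<alpha> e c | c. 1 \<le> c \<and> c \<le> e div 2 \<and>
        canonical_piece n \<alpha> P c \<noteq> {0} \<and> canonical_piece n \<alpha> P (e - c) \<noteq> {0}}"

inductive reduce_step :: "nat \<Rightarrow> nat set set \<Rightarrow> nat set set \<Rightarrow> bool" for r where
  delete: "A \<in> F \<Longrightarrow> card A > r \<Longrightarrow> reduce_step r F (F - {A})"
| merge: "A \<in> F \<Longrightarrow> B \<in> F \<Longrightarrow> A \<noteq> B \<Longrightarrow> card (A \<union> B) \<le> r + 1 \<Longrightarrow>
    reduce_step r F (insert (A \<inter> B) (F - {A, B}))"

definition reduces_to :: "nat \<Rightarrow> nat set set \<Rightarrow> nat set set \<Rightarrow> bool" where
  "reduces_to r F F' \<longleftrightarrow> (reduce_step r)\<^sup>*\<^sup>* F F' \<and> (\<nexists>F''. reduce_step r F' F'')"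

text \<open>
  A monomial in the sections \<open>t 1, \<dots>, t n\<close> is given by its exponents at \<open>{1..n}\<close>; the values of the
  exponent function elsewhere are irrelevant.
\<close>

definition has_exponents :: "nat \<Rightarrow> nat \<Rightarrow> nat \<Rightarrow> nat list \<Rightarrow> (nat \<Rightarrow> nat) list \<Rightarrow> bool" where
  "has_exponents n r j es ms \<longleftrightarrow> (\<forall>m\<in>set ms. (\<Sum>i=1..n. m i) = r) \<and> map (\<lambda>m. m j) ms = es"

inductive stable_monomials :: "nat \<Rightarrow> nat \<Rightarrow> nat set set \<Rightarrow> (nat \<Rightarrow> nat) list \<Rightarrow> bool" for n r where
  none: "j \<in> {1..n} \<Longrightarrow> k \<in> {1..n} \<Longrightarrow> j \<noteq> k \<Longrightarrow>
    stable_monomials n r {} (map (\<lambda>i. (\<lambda>_. 0)(j := r - i, k := i)) [0..<r + 1])"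
| one_empty: "stable_monomials n r {{}} []"
| one: "j \<in> A \<Longrightarrow> has_exponents n r j (rev [r + 2 - card A..<r + 1] @ [0]) ms \<Longrightarrow>
    stable_monomials n r {A} ms"
| two: "A \<noteq> B \<Longrightarrow> card B = r \<Longrightarrow> j \<in> A - B \<Longrightarrow>
    has_exponents n r j (rev [r + 2 - card A..<r + 1]) ms \<Longrightarrow> stable_monomials n r {A, B} ms"

definition stable_choice ::
  "nat \<Rightarrow> (nat \<Rightarrow> rat) \<Rightarrow> (nat \<Rightarrow> ('k::field) closed_point) \<Rightarrow> nat \<Rightarrow> (nat \<Rightarrow> nat) list \<Rightarrow> bool" where
  "stable_choice n \<alpha> P e ms \<longleftrightarrow>
     (if floor_deg n \<alpha> e < 0 then ms = []
      else \<exists>F. reduces_to (nat (floor_deg n \<alpha> e)) (drop_family n \<alpha> P e) F \<and>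
               stable_monomials n (nat (floor_deg n \<alpha> e)) F ms)"

definition generator ::
  "nat \<Rightarrow> (nat \<Rightarrow> rat) \<Rightarrow> (nat \<Rightarrow> 'k::field poly) \<Rightarrow> nat \<Rightarrow> (nat \<Rightarrow> nat) \<Rightarrow> 'k poly fract poly" where
  "generator n \<alpha> t e m =
     monom (\<Prod>i=1..n. to_fract (t i) powi (int (m i) - \<lfloor>of_nat e * \<alpha> i\<rfloor>)) e"

definition generator_degrees :: "(nat \<Rightarrow> (nat \<Rightarrow> nat) list) \<Rightarrow> nat set" where
  "generator_degrees ms = {e. e \<ge> 1 \<and> ms e \<noteq> []}"

text \<open>The set of degrees is finite for every stable choice (\<open>finite_generator_degrees\<close> below).\<close>

definition generators ::
  "nat \<Rightarrow> (nat \<Rightarrow> rat) \<Rightarrow> (nat \<Rightarrow> 'k::field poly) \<Rightarrow> (nat \<Rightarrow> (nat \<Rightarrow> nat) list)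
     \<Rightarrow> 'k poly fract poly list" where
  "generators n \<alpha> t ms =
     concat (map (\<lambda>e. map (generator n \<alpha> t e) (ms e)) (sorted_list_of_set (generator_degrees ms)))"


section \<open>Polynomial ring, dictionary order, initial ideals\<close>

text \<open>Variables are numbered from \<open>0\<close>.\<close>

type_synonym 'k mpoly = "(nat \<Rightarrow>\<^sub>0 nat) \<Rightarrow>\<^sub>0 'k"

definition mpolys :: "nat \<Rightarrow> ('k::field) mpoly set" where
  "mpolys N = {p. \<forall>m\<in>Poly_Mapping.keys p. Poly_Mapping.keys m \<subseteq> {..<N}}"

definition evaluate :: "'k::field poly fract poly list \<Rightarrow> 'k mpoly \<Rightarrow> 'k poly fract poly" where
  "evaluate gs p =
     (\<Sum>m\<in>Poly_Mapping.keys p. [:to_fract [:Poly_Mapping.lookup p m:]:] *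
        (\<Prod>i\<in>Poly_Mapping.keys m. (gs ! i) ^ Poly_Mapping.lookup m i))"

text \<open>
  The images lie in the canonical ring (\<open>generators_in_canonical_ring\<close> below), so the kernel can be
  taken in the polynomial ring over the function field.
\<close>

definition relation_ideal :: "'k::field poly fract poly list \<Rightarrow> 'k mpoly set" where
  "relation_ideal gs = {p \<in> mpolys (length gs). evaluate gs p = 0}"

definition word_of :: "(nat \<Rightarrow>\<^sub>0 nat) \<Rightarrow> nat list" where
  "word_of m = concat (map (\<lambda>i. replicate (Poly_Mapping.lookup m i) i)
                         (sorted_list_of_set (Poly_Mapping.keys m)))"

definition dict_less :: "(nat \<Rightarrow>\<^sub>0 nat) \<Rightarrow> (nat \<Rightarrow>\<^sub>0 nat) \<Rightarrow> bool" (infix \<open>\<prec>\<close> 50) where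
  "m \<prec> m' \<longleftrightarrow> (word_of m, word_of m') \<in> lexord {(i, j). i < j}"

definition initial_monomial :: "('k::field) mpoly \<Rightarrow> (nat \<Rightarrow>\<^sub>0 nat)" where
  "initial_monomial f = (THE m. m \<in> Poly_Mapping.keys f \<and> (\<forall>m'\<in>Poly_Mapping.keys f. m' \<noteq> m \<longrightarrow> m' \<prec> m))"

definition initial_term :: "('k::field) mpoly \<Rightarrow> 'k mpoly" where
  "initial_term f =
     Poly_Mapping.single (initial_monomial f) (Poly_Mapping.lookup f (initial_monomial f))"

definition ideal_generated :: "'r::comm_ring_1 set \<Rightarrow> 'r set \<Rightarrow> 'r set" where
  "ideal_generated R B = {\<Sum>b\<in>C. q b * b | C q. finite C \<and> C \<subseteq> B \<and> q ` C \<subseteq> R}"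

definition initial_ideal :: "nat \<Rightarrow> ('k::field) mpoly set \<Rightarrow> 'k mpoly set" where
  "initial_ideal N I = ideal_generated (mpolys N) (initial_term ` (I - {0}))"

text \<open>
  Minimality refers to the family of initial terms indexed by \<open>G\<close>, so distinct elements of \<open>G\<close> have
  distinct initial monomials.  The dictionary order is not a well-order, hence generation of \<open>I\<close> is
  required separately.
\<close>

definition groebner_basis :: "nat \<Rightarrow> ('k::field) mpoly set \<Rightarrow> 'k mpoly set \<Rightarrow> bool" where
  "groebner_basis N I G \<longleftrightarrow>
     G \<subseteq> I - {0} \<and> ideal_generated (mpolys N) G = I \<and>
     ideal_generated (mpolys N) (initial_term ` G) = initial_ideal N I \<and>
     (\<forall>G'. G' \<subset> G \<longrightarrow> ideal_generated (mpolys N) (initial_term ` G') \<noteq> initial_ideal N I)"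


section \<open>The definitions above are well-behaved\<close>

text \<open>
  The order of vanishing is well-defined, a homogeneous piece of the canonical ring is nonzero iff
  its divisor has nonnegative degree (so that the admissible choices depend neither on the field nor
  on the points), only finitely many degrees contain generators, and the generators lie in the
  canonical ring.
\<close>

lemma irreducible_degree_pos:
  fixes p :: "'k::field poly"
  assumes "irreducible p"
  shows "degree p > 0"
  using assms by (metis irreducible_not_unit gr0I is_unit_iff_degree not_irreducible_zero)

lemma irreducible_dvd_multD:
  fixes p :: "'k::field poly"
  assumes p: "irreducible p" and dvd: "p dvd a * b"
  shows "p dvd a \<or> p dvd b"
proof (rule ccontr)
  assume nd: "\<not> (p dvd a \<or> p dvd b)"
  define J where "J = {x * p + y * a | x y. True}"
  have p0: "p \<noteq> 0" using p by auto
  have "p = 1 * p + 0 * a" by simp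
  then have pJ: "p \<in> J" unfolding J_def by blast
  have "a = 0 * p + 1 * a" by simp
  then have aJ: "a \<in> J" unfolding J_def by blast
  obtain d where d: "d \<in> J" "d \<noteq> 0" and min: "\<And>z. z \<in> J \<Longrightarrow> z \<noteq> 0 \<Longrightarrow> degree d \<le> degree z"
    using ex_has_least_nat[of "\<lambda>z. z \<in> J \<and> z \<noteq> 0" p degree] pJ p0 by blast
  obtain x y where xy: "d = x * p + y * a" using d(1) unfolding J_def by blast
  have dvdJ: "d dvd z" if z: "z \<in> J" for z
  proof -
    obtain x' y' where z': "z = x' * p + y' * a" using z unfolding J_def by blast
    have "z mod d = z - (z div d) * d" by (simp add: minus_div_mult_eq_mod)
    also have "\<dots> = (x' - z div d * x) * p + (y' - z div d * y) * a"
      unfolding z' xy by (simp add: algebra_simps)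
    finally have inJ: "z mod d \<in> J" unfolding J_def by blast
    have "z mod d = 0"
      using min[OF inJ] degree_mod_less[OF d(2), of z] by (metis linorder_not_less)
    then show ?thesis by auto
  qed
  obtain q where q: "p = d * q" using dvdJ[OF pJ] by (auto elim: dvdE)
  from irreducibleD[OF p q] show False
  proof
    assume "is_unit q"
    then have "p dvd d" using q by (simp add: mult_unit_dvd_iff)
    then show False using dvdJ[OF aJ] nd dvd_trans by blast
  next
    assume "is_unit d"
    then obtain u where u: "1 = d * u" by (auto elim: dvdE)
    have "b = b * d * u" by (metis u mult.assoc mult.right_neutral)
    also have "b * d = b * x * p + y * (a * b)" unfolding xy by (simp add: algebra_simps)
    finally have "p dvd b" using dvd by (metis dvd_add dvd_mult dvd_mult2 dvd_triv_right)
    then show False using nd by blast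
  qed
qed

lemma mult_finite:
  fixes p a :: "'k::field poly"
  assumes "degree p > 0" "a \<noteq> 0" 
  shows "{k. p ^ k dvd a} \<subseteq> {..degree a}"
proof
  fix k assume "k \<in> {k. p ^ k dvd a}"
  then have "degree (p ^ k) \<le> degree a" using assms by (auto intro: dvd_imp_degree_le)
  moreover have "degree (p ^ k) = k * degree p" using assms by (subst degree_power_eq) auto
  ultimately show "k \<in> {..degree a}" using assms(1)
    by (metis atMost_iff le_trans mult.right_neutral mult_le_mono2 less_eq_Suc_le One_nat_def)
qed

lemma mult_eqI:
  fixes p a :: "'k::field poly"
  assumes p: "degree p > 0" and a: "a = p ^ k * c" and c: "\<not> p dvd c"
  shows "Max {k. p ^ k dvd a} = k"
proof (rule Max_eqI)
  have c0: "c \<noteq> 0" using c by auto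
  have p0: "p \<noteq> 0" using p by auto
  show "finite {k. p ^ k dvd a}"
    using mult_finite[OF p, of a] c0 p0 a by (auto intro: finite_subset)
  show "k \<in> {k. p ^ k dvd a}" by (simp add: a)
  show "l \<le> k" if "l \<in> {k. p ^ k dvd a}" for l
  proof (rule ccontr)
    assume "\<not> l \<le> k"
    then have "p ^ Suc k dvd a" using that le_imp_power_dvd[of "Suc k" l p]
      by (metis dvd_trans mem_Collect_eq not_less_eq_eq)
    then have "p ^ k * p dvd p ^ k * c" by (simp add: a mult.commute)
    then have "p dvd c" using p0 by (subst (asm) dvd_mult_cancel_left) auto
    then show False using c by simp
  qed
qed

lemma mult_decomp:
  fixes p a :: "'k::field poly"
  assumes p: "degree p > 0" and a: "a \<noteq> 0"
  obtains c where "a = p ^ Max {k. p ^ k dvd a} * c" "\<not> p dvd c"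
proof -
  let ?S = "{k. p ^ k dvd a}"
  have fin: "finite ?S" using mult_finite[OF assms] by (auto intro: finite_subset)
  have "0 \<in> ?S" by simp
  then have "Max ?S \<in> ?S" using fin by (intro Max_in) blast+
  then obtain c where c: "a = p ^ Max ?S * c" by (auto elim: dvdE)
  have "\<not> p dvd c"
  proof
    assume "p dvd c"
    then obtain c' where "c = p * c'" by (auto elim: dvdE)
    then have "a = p ^ Suc (Max ?S) * c'" using c by (simp add: mult_ac)
    then have "Suc (Max ?S) \<in> ?S" by (metis dvd_triv_left mem_Collect_eq)
    then show False using Max_ge[OF fin] by (metis not_less_eq_eq order_refl)
  qed
  then show ?thesis using c that by blast
qed

lemma closed_pointsE:
  assumes "x \<in> (closed_points :: ('k::field) closed_point set)"
  obtains "x = Infinity" | p where "x = Place p" "irreducible p" "lead_coeff p = 1" "degree p > 0"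
  using assms irreducible_degree_pos unfolding closed_points_def by auto

lemma ord_poly_mult:
  fixes a b :: "'k::field poly"
  assumes x: "x \<in> closed_points" and a: "a \<noteq> 0" and b: "b \<noteq> 0"
  shows "ord_poly x (a * b) = ord_poly x a + ord_poly x b"
  using x
proof (cases rule: closed_pointsE)
  case 1
  then show ?thesis using a b by (simp add: degree_mult_eq)
next
  case (2 p)
  obtain c where c: "a = p ^ Max {k. p ^ k dvd a} * c" "\<not> p dvd c" using mult_decomp 2 a by metis
  obtain d where d: "b = p ^ Max {k. p ^ k dvd b} * d" "\<not> p dvd d" using mult_decomp 2 b by metis
  define k l where "k = Max {k. p ^ k dvd a}" and "l = Max {k. p ^ k dvd b}"
  have "a * b = p ^ (k + l) * (c * d)"
    using c d unfolding k_def[symmetric] l_def[symmetric] by (simp add: power_add mult_ac)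
  moreover have "\<not> p dvd c * d" using c d 2 irreducible_dvd_multD by blast
  ultimately have "Max {k. p ^ k dvd a * b} = k + l" using 2 mult_eqI by blast
  then show ?thesis using 2 by (simp add: k_def l_def)
qed

lemma ord_at_Fract:
  fixes a b :: "'k::field poly"
  assumes x: "x \<in> closed_points" and a: "a \<noteq> 0" and b: "b \<noteq> 0"
  shows "ord_at x (Fract a b) = ord_poly x a - ord_poly x b"
  unfolding ord_at_def
proof (rule the_equality)
  show "\<exists>a' b'. a' \<noteq> 0 \<and> b' \<noteq> 0 \<and> Fract a b = Fract a' b' \<and>
     ord_poly x a - ord_poly x b = ord_poly x a' - ord_poly x b'" using a b by blast
next
  fix z assume "\<exists>a' b'. a' \<noteq> 0 \<and> b' \<noteq> 0 \<and> Fract a b = Fract a' b' \<and>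
     z = ord_poly x a' - ord_poly x b'"
  then obtain a' b' where *: "a' \<noteq> 0" "b' \<noteq> 0" "Fract a b = Fract a' b'"
     "z = ord_poly x a' - ord_poly x b'" by blast
  have "a * b' = a' * b" using * b by (simp add: eq_fract)
  then have "ord_poly x a + ord_poly x b' = ord_poly x a' + ord_poly x b"
    using ord_poly_mult[OF x] a b * by metis
  then show "z = ord_poly x a - ord_poly x b" using * by linarith
qed

lemma ord_at_mult:
  fixes f g :: "'k::field poly fract"
  assumes x: "x \<in> closed_points" and f: "f \<noteq> 0" and g: "g \<noteq> 0"
  shows "ord_at x (f * g) = ord_at x f + ord_at x g"
proof -
  obtain a b where ab: "f = Fract a b" "b \<noteq> 0" using Fract_cases by blast
  obtain c d where cd: "g = Fract c d" "d \<noteq> 0" using Fract_cases by blast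
  have ac: "a \<noteq> 0" "c \<noteq> 0" using f g ab cd by (auto simp: fract_collapse)
  then show ?thesis using ab cd by (simp add: ord_at_Fract[OF x] ord_poly_mult[OF x])
qed

lemma ord_poly_1: "x \<in> (closed_points :: ('k::field) closed_point set) \<Longrightarrow> ord_poly x 1 = 0"
  using ord_poly_mult[of x 1 1] by simp

lemma ord_at_1: "x \<in> (closed_points :: ('k::field) closed_point set) \<Longrightarrow> ord_at x 1 = 0"
  using ord_at_mult[of x 1 1] by simp

lemma ord_at_to_fract:
  fixes a :: "'k::field poly"
  assumes "x \<in> closed_points" "a \<noteq> 0"
  shows "ord_at x (to_fract a) = ord_poly x a"
  using assms by (simp add: to_fract_def ord_at_Fract ord_poly_1)

lemma ord_at_power_int:
  fixes f :: "'k::field poly fract"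
  assumes x: "x \<in> closed_points" and f: "f \<noteq> 0"
  shows "ord_at x (f powi z) = z * ord_at x f"
proof -
  have pow: "ord_at x (f ^ k) = int k * ord_at x f" for k
    by (induction k) (use f in \<open>auto simp: ord_at_1[OF x] ord_at_mult[OF x] algebra_simps\<close>)
  have inv: "ord_at x (inverse g) = - ord_at x g" if "g \<noteq> 0" for g :: "'k poly fract"
    using ord_at_mult[OF x that, of "inverse g"] that by (simp add: ord_at_1[OF x])
  show ?thesis
    by (cases z rule: int_cases2)
       (use f in \<open>simp_all add: pow inv power_int_minus\<close>)
qed

lemma ord_at_prod:
  fixes f :: "'i \<Rightarrow> 'k::field poly fract"
  assumes x: "x \<in> closed_points" and "finite A" and "\<And>i. i \<in> A \<Longrightarrow> f i \<noteq> 0"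
  shows "ord_at x (prod f A) = (\<Sum>i\<in>A. ord_at x (f i))"
  using assms(2,3) by (induction) (auto simp: ord_at_1[OF x] ord_at_mult[OF x])

lemma section_ord_eq:
  fixes s :: "'k::field poly"
  assumes s: "vanishes_only_at s x" and y: "y \<in> closed_points"
  shows "section_ord y s = (if y = x then 1 else 0)"
proof -
  have s': "s \<noteq> 0" "degree s \<le> 1" "section_ord y s > 0 \<longleftrightarrow> y = x"
    using s y by (auto simp: vanishes_only_at_def)
  have "0 \<le> section_ord y s \<and> section_ord y s \<le> 1"
    using y
  proof (cases rule: closed_pointsE)
    case 1
    then show ?thesis using s' by (auto simp: section_ord_def)
  next
    case (2 p)
    let ?S = "{k. p ^ k dvd s}"
    have sub: "?S \<subseteq> {..degree s}" using mult_finite 2 s' by metis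
    have "0 \<in> ?S" by simp
    then have "Max ?S \<in> ?S" using finite_subset[OF sub] by (intro Max_in) blast+
    then have "Max ?S \<le> 1" using sub s' by auto
    then show ?thesis using 2 by (auto simp: section_ord_def)
  qed
  then show ?thesis using s' by auto
qed

lemma ord_at_sections:
  fixes t :: "nat \<Rightarrow> 'k::field poly"
  assumes t: "\<And>i. i \<in> {1..n} \<Longrightarrow> vanishes_only_at (t i) (P i)" and y: "y \<in> closed_points"
  shows "ord_at y (\<Prod>i=1..n. to_fract (t i) powi c i)
    = (\<Sum>i | i \<in> {1..n} \<and> P i = y. c i) - (if y = Infinity then \<Sum>i=1..n. c i else 0)"
proof -
  have t0: "t i \<noteq> 0" if "i \<in> {1..n}" for i using t[OF that] by (simp add: vanishes_only_at_def)
  have "ord_at y (\<Prod>i=1..n. to_fract (t i) powi c i) = (\<Sum>i=1..n. c i * ord_poly y (t i))"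
    using t0 by (subst ord_at_prod[OF y])
      (auto intro!: sum.cong simp: ord_at_power_int[OF y] ord_at_to_fract[OF y])
  also have "\<dots> = (\<Sum>i=1..n. (if P i = y then c i else 0) - (if y = Infinity then c i else 0))"
  proof (rule sum.cong)
    fix i assume i: "i \<in> {1..n}"
    have "ord_poly y (t i) = (if y = P i then 1 else 0) - (if y = Infinity then 1 else 0)"
      using section_ord_eq[OF t[OF i] y] unfolding section_ord_def by auto
    then show "c i * ord_poly y (t i) = (if P i = y then c i else 0) - (if y = Infinity then c i else 0)"
      by (auto simp: algebra_simps)
  qed simp
  also have "\<dots> = (\<Sum>i | i \<in> {1..n} \<and> P i = y. c i) - (if y = Infinity then \<Sum>i=1..n. c i else 0)"
    using sum.inter_filter[of "{1..n}" c "\<lambda>i. P i = y"] by (simp add: sum_subtractf)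
  finally show ?thesis .
qed

lemma vanishes_only_at_exists:
  assumes "x \<in> (rational_points :: ('k::field) closed_point set)"
  shows "\<exists>s. vanishes_only_at s x"
proof -
  consider "x = Infinity" | a where "x = Place [:-a, 1:]"
    using assms unfolding rational_points_def by auto
  then show ?thesis
  proof cases
    case 1
    have "section_ord y 1 > 0 \<longleftrightarrow> y = Infinity" if "y \<in> closed_points" for y :: "'k closed_point"
      using that by (auto simp: section_ord_def ord_poly_1)
    then have "vanishes_only_at 1 x" unfolding vanishes_only_at_def 1 by simp
    then show ?thesis ..
  next
    case (2 a)
    let ?s = "[:-a, 1:]"
    have "section_ord y ?s > 0 \<longleftrightarrow> y = x" if "y \<in> closed_points" for y
      using that
    proof (cases rule: closed_pointsE)
      case 1
      then show ?thesis using 2 by (simp add: section_ord_def)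
    next
      case (2 p)
      obtain c where c: "?s = p ^ Max {k. p ^ k dvd ?s} * c" "\<not> p dvd c"
        using mult_decomp[OF 2(4), of ?s] by auto
      show ?thesis
      proof (cases "p dvd ?s")
        case True
        then obtain q where q: "?s = p * q" by (auto elim: dvdE)
        then have "q \<noteq> 0" "p \<noteq> 0" by auto
        then have "degree p + degree q = 1" using q degree_mult_eq[of p q] by (metis degree_pCons_eq degree_1 one_pCons One_nat_def zero_neq_one)
        then have "degree q = 0" using 2 by simp
        then obtain b where "q = [:b:]" by (auto elim: degree_eq_zeroE)
        moreover have "lead_coeff ?s = lead_coeff p * lead_coeff q" using q lead_coeff_mult by metis
        ultimately have "q = 1" using 2 by (simp add: one_pCons)
        then have "p = ?s" using q by simp
        moreover have "Max {k. p ^ k dvd ?s} \<noteq> 0"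
          using c True by (metis mult_1 power_0)
        ultimately show ?thesis using 2 \<open>x = Place [:-a, 1:]\<close> by (simp add: section_ord_def)
      next
        case False
        then have "Max {k. p ^ k dvd ?s} = 0"
          by (intro mult_eqI[of p ?s 0 ?s]) (use 2 in auto)
        moreover have "p \<noteq> ?s" using False by auto
        ultimately show ?thesis using 2 \<open>x = Place [:-a, 1:]\<close> by (simp add: section_ord_def)
      qed
    qed
    then have "vanishes_only_at ?s x" unfolding vanishes_only_at_def by auto
    then show ?thesis ..
  qed
qed

lemma section_monomial_in_H0:
  fixes t :: "nat \<Rightarrow> 'k::field poly"
  assumes t: "\<And>i. i \<in> {1..n} \<Longrightarrow> vanishes_only_at (t i) (P i)"
    and m: "int (\<Sum>i=1..n. m i) = floor_deg n \<alpha> e"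
  shows "(\<Prod>i=1..n. to_fract (t i) powi (int (m i) - \<lfloor>of_nat e * \<alpha> i\<rfloor>)) \<in> H0 (floor_div n \<alpha> P e)"
proof -
  have "ord_at y (\<Prod>i=1..n. to_fract (t i) powi (int (m i) - \<lfloor>of_nat e * \<alpha> i\<rfloor>)) + floor_div n \<alpha> P e y \<ge> 0"
    if y: "y \<in> closed_points" for y
  proof -
    have "(\<Sum>i=1..n. int (m i) - \<lfloor>of_nat e * \<alpha> i\<rfloor>) = 0"
      using m by (simp add: sum_subtractf floor_deg_def)
    then have "ord_at y (\<Prod>i=1..n. to_fract (t i) powi (int (m i) - \<lfloor>of_nat e * \<alpha> i\<rfloor>))
       = (\<Sum>i | i \<in> {1..n} \<and> P i = y. int (m i) - \<lfloor>of_nat e * \<alpha> i\<rfloor>)"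
      by (subst ord_at_sections[OF t y]) auto
    then show ?thesis by (simp add: sum_subtractf floor_div_def sum_nonneg)
  qed
  then show ?thesis unfolding H0_def by blast
qed

lemma irreducible_factor_exists:
  fixes b :: "'k::field poly"
  assumes "degree b > 0"
  obtains p where "irreducible p" "lead_coeff p = 1" "p dvd b"
proof -
  obtain p where p: "p dvd b" "degree p > 0"
     and min: "\<And>q. q dvd b \<Longrightarrow> degree q > 0 \<Longrightarrow> degree p \<le> degree q"
    using ex_has_least_nat[of "\<lambda>q. q dvd b \<and> degree q > 0" b degree] assms by auto
  have p0: "p \<noteq> 0" using p by auto
  define p' where "p' = smult (inverse (lead_coeff p)) p"
  have d: "degree p' = degree p" unfolding p'_def using p0 by simp
  have p'0: "p' \<noteq> 0" using d p by auto
  have dv: "p' dvd b" unfolding p'_def using p p0 by (simp add: smult_dvd_iff)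
  have "irreducible p'"
  proof (rule irreducibleI)
    show "p' \<noteq> 0" by fact
    show "\<not> is_unit p'" using d p p'0 by (simp add: is_unit_iff_degree)
    fix u v assume uv: "p' = u * v"
    then have nz: "u \<noteq> 0" "v \<noteq> 0" using p'0 by auto
    have "degree u + degree v = degree p" using uv nz d by (simp add: degree_mult_eq)
    moreover have "u dvd b" "v dvd b" using uv dv by (auto intro: dvd_trans)
    ultimately have "degree u = 0 \<or> degree v = 0" using min[of u] min[of v] p by linarith
    then show "is_unit u \<or> is_unit v" using nz by (simp add: is_unit_iff_degree)
  qed
  moreover have "lead_coeff p' = 1" unfolding p'_def using p0 by simp
  ultimately show ?thesis using that dv by blast
qed

lemma dvd_if_ord_le:
  fixes a b :: "'k::field poly"
  assumes "a \<noteq> 0" "b \<noteq> 0"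
    and "\<And>p. irreducible p \<Longrightarrow> lead_coeff p = 1 \<Longrightarrow> ord_poly (Place p) b \<le> ord_poly (Place p) a"
  shows "b dvd a"
  using assms
proof (induction "degree b" arbitrary: a b rule: less_induct)
  case less
  show ?case
  proof (cases "degree b = 0")
    case True
    then show ?thesis using less.prems by (simp add: is_unit_iff_degree unit_imp_dvd)
  next
    case False
    then obtain p where p: "irreducible p" "lead_coeff p = 1" "p dvd b"
      using irreducible_factor_exists[of b] by blast
    have dp: "degree p > 0" using irreducible_degree_pos p by blast
    have cl: "Place q \<in> closed_points" if "irreducible q" "lead_coeff q = 1" for q :: "'k poly"
      using that unfolding closed_points_def by auto
    obtain b' where b': "b = p * b'" using p by (auto elim: dvdE)
    then have nz: "p \<noteq> 0" "b' \<noteq> 0" using less.prems by auto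
    have "ord_poly (Place p) p = 1"
      using mult_eqI[OF dp, of p 1 1] dp by (auto simp: is_unit_iff_degree nz)
    moreover have "ord_poly (Place p) b' \<ge> 0" by simp
    ultimately have "ord_poly (Place p) b \<ge> 1"
      using ord_poly_mult[OF cl[OF p(1,2)] nz] b' by (metis add_increasing2 order_refl)
    then have "ord_poly (Place p) a \<noteq> 0" using less.prems(3)[OF p(1,2)] by linarith
    moreover obtain c where "a = p ^ Max {k. p ^ k dvd a} * c" "\<not> p dvd c"
      using mult_decomp[OF dp less.prems(1)] by blast
    ultimately have "p dvd a" by (metis dvd_power dvd_mult2 gr0I of_nat_0 ord_poly.simps(1))
    then obtain a' where a': "a = p * a'" by (auto elim: dvdE)
    then have a'0: "a' \<noteq> 0" using less.prems by auto
    have "b' dvd a'"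
    proof (rule less.hyps)
      show "degree b' < degree b" using b' nz dp by (simp add: degree_mult_eq)
      show "ord_poly (Place q) b' \<le> ord_poly (Place q) a'" if q: "irreducible q" "lead_coeff q = 1" for q
        using less.prems(3)[OF q] ord_poly_mult[OF cl[OF q] nz] ord_poly_mult[OF cl[OF q] nz(1) a'0]
        unfolding a' b' by linarith
    qed fact+
    then show ?thesis unfolding a' b' by simp
  qed
qed

lemma floor_div_H0_nonneg:
  fixes P :: "nat \<Rightarrow> ('k::field) closed_point"
  assumes P: "P ` {1..n} \<subseteq> rational_points" and f: "f \<in> H0 (floor_div n \<alpha> P d)" "f \<noteq> 0"
  shows "floor_deg n \<alpha> d \<ge> 0"
proof -
  have "\<forall>i\<in>{1..n}. \<exists>s. vanishes_only_at s (P i)" using P vanishes_only_at_exists by blast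
  then obtain t where t: "\<And>i. i \<in> {1..n} \<Longrightarrow> vanishes_only_at (t i) (P i)"
    unfolding bchoice_iff by blast
  define w where "w = (\<Prod>i=1..n. to_fract (t i) powi \<lfloor>of_nat d * \<alpha> i\<rfloor>)"
  have "w \<noteq> 0" unfolding w_def using t by (auto simp: vanishes_only_at_def power_int_eq_0_iff)
  have ord: "ord_at y (f * w) \<ge> (if y = Infinity then - floor_deg n \<alpha> d else 0)"
    if y: "y \<in> closed_points" for y
  proof -
    have "ord_at y w = floor_div n \<alpha> P d y - (if y = Infinity then floor_deg n \<alpha> d else 0)"
      unfolding w_def floor_div_def floor_deg_def by (rule ord_at_sections[OF t y])
    moreover have "ord_at y f + floor_div n \<alpha> P d y \<ge> 0" using f y unfolding H0_def by auto
    ultimately show ?thesis using ord_at_mult[OF y f(2) \<open>w \<noteq> 0\<close>] by auto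
  qed
  obtain a b where ab: "f * w = Fract a b" "b \<noteq> 0" using Fract_cases by blast
  have a: "a \<noteq> 0" using ab f \<open>w \<noteq> 0\<close> by (auto simp: fract_collapse)
  have "b dvd a"
  proof (rule dvd_if_ord_le[OF a ab(2)])
    fix p :: "'k poly" assume p: "irreducible p" "lead_coeff p = 1"
    then have "Place p \<in> closed_points" unfolding closed_points_def by auto
    from ord[OF this] show "ord_poly (Place p) b \<le> ord_poly (Place p) a"
      unfolding ab(1) ord_at_Fract[OF \<open>Place p \<in> closed_points\<close> a ab(2)] by simp
  qed
  then have "degree b \<le> degree a" using a by (rule dvd_imp_degree_le)
  moreover have inf: "(Infinity :: 'k closed_point) \<in> closed_points" unfolding closed_points_def by simp
  ultimately show ?thesis
    using ord[OF inf] unfolding ab(1) ord_at_Fract[OF inf a ab(2)] by simp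
qed

lemma canonical_piece_nonzero_iff:
  fixes P :: "nat \<Rightarrow> ('k::field) closed_point"
  assumes P: "P ` {1..n} \<subseteq> rational_points" and n: "n \<ge> 1"
  shows "canonical_piece n \<alpha> P d \<noteq> {0} \<longleftrightarrow> floor_deg n \<alpha> d \<ge> 0"
proof
  assume "canonical_piece n \<alpha> P d \<noteq> {0}"
  moreover have "0 \<in> canonical_piece n \<alpha> P d" unfolding canonical_piece_def H0_def by force
  ultimately obtain g where "g \<in> canonical_piece n \<alpha> P d" "g \<noteq> 0" by blast
  then obtain f where "f \<in> H0 (floor_div n \<alpha> P d)" "f \<noteq> 0"
    unfolding canonical_piece_def by auto
  then show "floor_deg n \<alpha> d \<ge> 0" using floor_div_H0_nonneg[OF P] by blast
next
  assume deg: "floor_deg n \<alpha> d \<ge> 0"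
  have "\<forall>i\<in>{1..n}. \<exists>s. vanishes_only_at s (P i)" using P vanishes_only_at_exists by blast
  then obtain t where t: "\<And>i. i \<in> {1..n} \<Longrightarrow> vanishes_only_at (t i) (P i)"
    unfolding bchoice_iff by blast
  define m where "m = (\<lambda>i::nat. if i = 1 then nat (floor_deg n \<alpha> d) else 0)"
  define f where "f = (\<Prod>i=1..n. to_fract (t i) powi (int (m i) - \<lfloor>of_nat d * \<alpha> i\<rfloor>))"
  have "int (\<Sum>i=1..n. m i) = floor_deg n \<alpha> d" unfolding m_def using n deg by simp
  then have "f \<in> H0 (floor_div n \<alpha> P d)" unfolding f_def by (intro section_monomial_in_H0[OF t])
  moreover have "f \<noteq> 0" unfolding f_def using t by (auto simp: vanishes_only_at_def power_int_eq_0_iff)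
  ultimately have "monom f d \<in> canonical_piece n \<alpha> P d" "monom f d \<noteq> 0"
    unfolding canonical_piece_def by auto
  then show "canonical_piece n \<alpha> P d \<noteq> {0}" by blast
qed

lemma stable_choice_independent:
  fixes P :: "nat \<Rightarrow> ('k::field) closed_point" and Q :: "nat \<Rightarrow> ('l::field) closed_point"
  assumes "P ` {1..n} \<subseteq> rational_points" "Q ` {1..n} \<subseteq> rational_points" "n \<ge> 1"
  shows "stable_choice n \<alpha> P e ms \<longleftrightarrow> stable_choice n \<alpha> Q e ms"
  using assms by (simp add: stable_choice_def drop_family_def canonical_piece_nonzero_iff)

lemma reduce_step_empty:
  assumes "reduce_step r F F'" "{} \<in> F"
  shows "{} \<in> F'"
  using assms by cases auto

lemma stable_choice_trivial:
  assumes "stable_choice n \<alpha> P e ms" and "{} \<in> drop_family n \<alpha> P e"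
  shows "ms = []"
proof (cases "floor_deg n \<alpha> e < 0")
  case True
  then show ?thesis using assms by (simp add: stable_choice_def)
next
  case False
  define r where "r = nat (floor_deg n \<alpha> e)"
  obtain F where F: "reduces_to r (drop_family n \<alpha> P e) F" and ms: "stable_monomials n r F ms"
    using assms(1) False unfolding stable_choice_def r_def by auto
  have "(reduce_step r)\<^sup>*\<^sup>* (drop_family n \<alpha> P e) F" using F by (simp add: reduces_to_def)
  then have e: "{} \<in> F"
    using assms(2) by (induction) (auto intro: reduce_step_empty)
  have "F = {{}}"
  proof (rule ccontr)
    assume "F \<noteq> {{}}"
    then obtain B where B: "B \<in> F" "B \<noteq> {}" using e by blast
    then have "\<exists>F''. reduce_step r F F''"
      using reduce_step.delete[of B F r] reduce_step.merge[OF e, of B r]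
      by (cases "card B > r") auto
    then show False using F unfolding reduces_to_def by blast
  qed
  with ms show ?thesis
    by (cases) (auto simp: doubleton_eq_iff)
qed

lemma finite_generator_degrees:
  fixes P :: "nat \<Rightarrow> ('k::field) closed_point"
  assumes P: "P ` {1..n} \<subseteq> rational_points" and n: "n \<ge> 1"
    and ms: "\<And>e. e \<ge> 1 \<Longrightarrow> stable_choice n \<alpha> P e (ms e)"
  shows "finite (generator_degrees ms)"
proof -
  have empty: "ms e = []" if c: "1 \<le> c" "c < e" "floor_deg n \<alpha> c \<ge> 0" "floor_deg n \<alpha> (e - c) \<ge> 0"
      and int: "\<And>i. i \<in> {1..n} \<Longrightarrow> of_nat c * \<alpha> i \<in> \<int>" for e c
  proof -
    have fl: "\<lfloor>of_nat c * \<alpha> i\<rfloor> + \<lfloor>of_nat (e - c) * \<alpha> i\<rfloor> = \<lfloor>of_nat e * \<alpha> i\<rfloor>" if i: "i \<in> {1..n}" for i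
    proof -
      obtain z where z: "of_nat c * \<alpha> i = of_int z" using int[OF i] by (auto elim: Ints_cases)
      have "of_nat e * \<alpha> i = of_int z + of_nat (e - c) * \<alpha> i"
        using c z by (simp add: of_nat_diff algebra_simps)
      then show ?thesis using z by simp
    qed
    define c' where "c' = min c (e - c)"
    have c': "1 \<le> c'" "c' \<le> e div 2" unfolding c'_def using c by (auto simp: min_def)
    have "{} = drop_set n \<alpha> e c'"
      unfolding drop_set_def c'_def using fl c by (auto simp: min_def add.commute)
    moreover have "canonical_piece n \<alpha> P c' \<noteq> {0}" "canonical_piece n \<alpha> P (e - c') \<noteq> {0}"
      unfolding canonical_piece_nonzero_iff[OF P n] c'_def using c by (auto simp: min_def)
    ultimately have "{} \<in> drop_family n \<alpha> P e"
      unfolding drop_family_def using c' by blast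
    then show ?thesis using stable_choice_trivial ms c by (metis le_trans less_imp_le_nat)
  qed
  have neg: "ms e = []" if "e \<ge> 1" "floor_deg n \<alpha> e < 0" for e
    using ms[OF that(1)] that(2) by (simp add: stable_choice_def)
  define q where "q = (\<Prod>i=1..n. nat (snd (quotient_of (\<alpha> i))))"
  have q1: "q \<ge> 1" unfolding q_def using quotient_of_denom_pos' by (simp add: Suc_le_eq prod_pos)
  have qint: "of_nat q * \<alpha> i \<in> \<int>" if i: "i \<in> {1..n}" for i
  proof -
    obtain a b where ab: "quotient_of (\<alpha> i) = (a, b)" by force
    then have "b > 0" "\<alpha> i = of_int a / of_int b" using quotient_of_denom_pos quotient_of_div by blast+
    then have "of_nat (nat b) * \<alpha> i = of_int a" by simp
    moreover have "nat b dvd q" unfolding q_def using i ab by (metis dvd_prod_eqI finite_atLeastAtMost snd_conv)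
    then obtain k where "q = nat b * k" by (auto elim: dvdE)
    ultimately have "of_nat q * \<alpha> i = of_int (int k * a)" by (simp add: mult_ac)
    then show ?thesis by (metis Ints_of_int)
  qed
  define \<sigma> where "\<sigma> = (\<Sum>i=1..n. \<alpha> i)"
  have le: "of_int (floor_deg n \<alpha> e) \<le> of_nat e * \<sigma>" for e
    unfolding floor_deg_def \<sigma>_def by (simp add: sum_distrib_left sum_mono)
  have ge: "of_nat e * \<sigma> - of_nat n \<le> of_int (floor_deg n \<alpha> e)" for e
  proof -
    have "(\<Sum>i=1..n. of_nat e * \<alpha> i - 1) \<le> (\<Sum>i=1..n. of_int \<lfloor>of_nat e * \<alpha> i\<rfloor>)"
      by (rule sum_mono) linarith
    then show ?thesis unfolding floor_deg_def \<sigma>_def by (simp add: sum_distrib_left sum_subtractf)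
  qed
  have q: "of_int (floor_deg n \<alpha> q) = of_nat q * \<sigma>"
    unfolding floor_deg_def \<sigma>_def using qint by (simp add: sum_distrib_left) 
  consider "\<sigma> < 0" | "\<sigma> = 0" | "\<sigma> > 0" by linarith
  then show ?thesis
  proof cases
    case 1
    have "ms e = []" if "e \<ge> 1" for e
    proof (rule neg[OF that])
      have "of_nat e * \<sigma> < 0" using 1 that by (simp add: mult_pos_neg)
      then show "floor_deg n \<alpha> e < 0" using le[of e] by linarith
    qed
    then have "generator_degrees ms = {}" by (auto simp: generator_degrees_def)
    then show ?thesis by simp
  next
    case 2
    have "ms e = []" if "e > q" for e
    proof (cases "floor_deg n \<alpha> e < 0")
      case False
      have fq: "floor_deg n \<alpha> q = 0" using q 2 by simp
      have "floor_deg n \<alpha> e = floor_deg n \<alpha> q + floor_deg n \<alpha> (e - q)"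
        unfolding floor_deg_def sum.distrib[symmetric]
      proof (rule sum.cong)
        fix i assume i: "i \<in> {1..n}"
        obtain z where z: "of_nat q * \<alpha> i = of_int z" using qint[OF i] by (auto elim: Ints_cases)
        have "of_nat e * \<alpha> i = of_int z + of_nat (e - q) * \<alpha> i"
          using that z by (simp add: of_nat_diff algebra_simps)
        then show "\<lfloor>of_nat e * \<alpha> i\<rfloor> = \<lfloor>of_nat q * \<alpha> i\<rfloor> + \<lfloor>of_nat (e - q) * \<alpha> i\<rfloor>" using z by simp
      qed simp
      then show ?thesis using empty[OF q1 that] fq qint False by simp
    qed (use neg that in auto)
    then have "generator_degrees ms \<subseteq> {..q}"
      unfolding generator_degrees_def by (auto simp: not_le[symmetric])
    then show ?thesis by (rule finite_subset) simp
  next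
    case 3
    define K where "K = nat \<lceil>of_nat n / \<sigma>\<rceil> + 1"
    have pos: "floor_deg n \<alpha> e \<ge> 0" if "e \<ge> K" for e
    proof -
      have "of_nat n / \<sigma> \<le> of_nat e" using that unfolding K_def by linarith
      then have "of_nat n \<le> of_nat e * \<sigma>" using 3 by (simp add: pos_divide_le_eq)
      then show ?thesis using ge[of e] by linarith
    qed
    have "ms e = []" if "e > q + K" for e
    proof (rule empty[OF q1])
      have "0 \<le> of_nat q * \<sigma>" using 3 by simp
      then show "floor_deg n \<alpha> q \<ge> 0" using q by linarith
      show "floor_deg n \<alpha> (e - q) \<ge> 0" using pos that by simp
    qed (use that qint in auto)
    then have "generator_degrees ms \<subseteq> {..q + K}"
      unfolding generator_degrees_def by (auto simp: not_le[symmetric])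
    then show ?thesis by (rule finite_subset) simp
  qed
qed

lemma stable_choice_sum:
  assumes "stable_choice n \<alpha> P e ms" and "m \<in> set ms"
  shows "int (\<Sum>i=1..n. m i) = floor_deg n \<alpha> e"
proof -
  have deg: "floor_deg n \<alpha> e \<ge> 0" using assms by (auto simp: stable_choice_def split: if_splits)
  then obtain F where "stable_monomials n (nat (floor_deg n \<alpha> e)) F ms"
    using assms(1) by (auto simp: stable_choice_def split: if_splits)
  then have "(\<Sum>i=1..n. m i) = nat (floor_deg n \<alpha> e)"
  proof cases
    case (none j k)
    have "m \<in> (\<lambda>i. (\<lambda>_. 0)(j := nat (floor_deg n \<alpha> e) - i, k := i)) `
        set [0..<nat (floor_deg n \<alpha> e) + 1]"
      using assms(2) unfolding none(2) set_map .
    then obtain i where "i \<in> set [0..<nat (floor_deg n \<alpha> e) + 1]"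
      and m: "m = (\<lambda>_. 0)(j := nat (floor_deg n \<alpha> e) - i, k := i)" by (rule imageE)
    then have i: "i \<le> nat (floor_deg n \<alpha> e)" by auto
    have "(\<Sum>x=1..n. m x) = (\<Sum>x\<in>{j, k}. m x)"
      by (rule sum.mono_neutral_right) (use none m in auto)
    then show ?thesis using none i m by simp
  qed (use assms(2) in \<open>auto simp: has_exponents_def\<close>)
  then show ?thesis using deg by simp
qed

lemma generators_in_canonical_ring:
  fixes P :: "nat \<Rightarrow> ('k::field) closed_point"
  assumes t: "\<And>i. i \<in> {1..n} \<Longrightarrow> vanishes_only_at (t i) (P i)"
    and ms: "\<And>e. e \<ge> 1 \<Longrightarrow> stable_choice n \<alpha> P e (ms e)"
  shows "set (generators n \<alpha> t ms) \<subseteq> canonical_ring n \<alpha> P"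
proof
  fix g assume g: "g \<in> set (generators n \<alpha> t ms)"
  have "\<exists>e m. e \<ge> 1 \<and> m \<in> set (ms e) \<and> g = generator n \<alpha> t e m"
  proof (cases "finite (generator_degrees ms)")
    case True
    then show ?thesis using g by (auto simp: generators_def generator_degrees_def)
  next
    case False
    then show ?thesis using g by (simp add: generators_def)
  qed
  then obtain e m where e: "e \<ge> 1" and m: "m \<in> set (ms e)" and g: "g = generator n \<alpha> t e m" by blast
  define f where "f = (\<Prod>i=1..n. to_fract (t i) powi (int (m i) - \<lfloor>of_nat e * \<alpha> i\<rfloor>))"
  have f: "f \<in> H0 (floor_div n \<alpha> P e)"
    unfolding f_def by (rule section_monomial_in_H0[OF t stable_choice_sum[OF ms[OF e] m]])
  have "monom (coeff (monom f e) d) d \<in> canonical_piece n \<alpha> P d" for d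
    using f by (cases "d = e") (auto simp: canonical_piece_def H0_def image_iff)
  then show "g \<in> canonical_ring n \<alpha> P"
    unfolding g generator_def f_def[symmetric] canonical_ring_def by blast
qed

end

(*
  Write S for the canonical ring, whose piece of degree d consists of the sections of some O(r), and
  J(k) for the ideal generated by the generators preceding g_k. In a fixed degree, the words smaller than
  x_k w are those starting with an earlier letter and those of the form x_k v with v smaller than w.
  Hence x_k w is an initial monomial modulo an ideal K of S iff w is one modulo the colon ideal
  (K + J(k)) : g_k, and a word is an initial monomial of the relation ideal iff 1 lies in the iterated
  colon ideal that starts from K = 0.

  Every piece of such an iterated colon ideal has a description independent of the field and the points.
  As long as each letter is the first generator of its degree and a power of some t_j, the pieces
  are sums of spaces V_A of sections vanishing on sets A of marked points. Such a sum reduces to at most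
  two summands, and because n <= 4 the only irreducible pairs are complementary two-element sets in O(2),
  for which the colon can be computed by hand. After the first letter of another kind, the colon ideal
  contains all sections that vanish at one point P_j to more than the minimal order. Since these have
  codimension at most one in each degree, it is enough to record the degrees in which the colon ideal is
  everything, and for this only the orders of vanishing at P_j matter.
*)
theory Submission
  imports Defs "HOL-Library.Multiset"
begin

text \<open>Dividing S_d by u^d and the monomial \<open>triv d\<close> leaves the polynomials of
  degree at most \<open>rk d\<close>, with product f, h \<mapsto> f h \<open>twist c d\<close>,
  where \<open>twist\<close> collects the t_i at which the floors of c \<alpha>_i and d \<alpha>_i
  add up to one too little. Ideals thus become conditions at marked points. The obstacle is the
  pencil V_A + V_B of a complementary pair in O(2): it has members without a marked zero, and
  membership of such a section depends on the position of the points. A member with a marked zero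
  lies in V_A or in V_B, so a power of t_j never meets this difficulty. For the other generators the
  ordering helps: the preceding ones, together with lower degrees, yield all multiples of t_j^s in
  the given degree, while the generator is t_j^(s-1) times a section q with q(P_j) \<noteq> 0. Every
  f with f(P_j) = 0 is therefore in the colon, and of q only the value at P_j is left. The recursion
  for the colons is set up in locales that mention neither field nor points, so stability holds once
  it is shown to compute the initial monomials.\<close>

interpretation lin: vector_space "smult :: 'k::field \<Rightarrow> 'k poly \<Rightarrow> 'k poly"
  by unfold_locales (simp_all add: smult_add_right smult_add_left)

lemma span_Un_span:
  fixes A B :: "'k::field poly set"
  shows "lin.span (A \<union> lin.span B) = lin.span (A \<union> B)" "lin.span (lin.span A \<union> B) = lin.span (A \<union> B)"
proof -
  have sub: "lin.span (A \<union> lin.span B) \<subseteq> lin.span (A \<union> B)" for A B :: "'k poly set"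
    using lin.span_mono[of B "A \<union> B"] lin.span_superset[of "A \<union> B"] by (intro lin.span_minimal) auto
  show *: "lin.span (A \<union> lin.span B) = lin.span (A \<union> B)" for A B :: "'k poly set"
    by (rule antisym[OF sub lin.span_mono]) (use lin.span_superset[of B] in blast)
  show "lin.span (lin.span A \<union> B) = lin.span (A \<union> B)" using *[of B A] by (simp add: Un_commute)
qed

lemma mult_image_subspace:
  fixes c :: "'k::field poly"
  assumes "lin.subspace X"
  shows "lin.subspace ((\<lambda>h. h * c) ` X)"
proof (rule lin.subspaceI)
  show "0 \<in> (\<lambda>h. h * c) ` X" using lin.subspace_0[OF assms] by (intro image_eqI[of _ _ 0]) auto
  fix x y and a :: 'k assume "x \<in> (\<lambda>h. h * c) ` X"
  then obtain h where h: "h \<in> X" "x = h * c" by blast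
  show "smult a x \<in> (\<lambda>h. h * c) ` X"
    using lin.subspace_scale[OF assms h(1)] h(2) by (intro image_eqI[of _ _ "smult a h"]) auto
  assume "y \<in> (\<lambda>h. h * c) ` X"
  then obtain h' where "h' \<in> X" "y = h' * c" by blast
  then show "x + y \<in> (\<lambda>h. h * c) ` X"
    using lin.subspace_add[OF assms h(1)] h(2) by (intro image_eqI[of _ _ "h + h'"]) (auto simp: algebra_simps)
qed

subsection \<open>Sections of line bundles\<close>

text \<open>H^0(O(r)) in the affine coordinate. A polynomial lies in these spaces for all large r,
  so r has to be carried along wherever infinity matters.\<close>

definition sections :: "nat \<Rightarrow> 'k::field poly set" where
  "sections r = {f. degree f \<le> r}"

text \<open>The value in the fibre of O(r) at a rational point. For \<open>Place [:-a, 1:]\<close>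
  the argument \<open>- coeff p 0\<close> is a; at infinity the value is the coefficient of degree
  r, which is 0 as soon as the degree is smaller.\<close>

fun section_value :: "'k::field closed_point \<Rightarrow> nat \<Rightarrow> 'k poly \<Rightarrow> 'k" where
  "section_value (Place p) r f = poly f (- coeff p 0)"
| "section_value Infinity r f = coeff f r"

text \<open>Any index other than a pushes one of the two factors of the convolution beyond its
  degree bound.\<close>

lemma coeff_mult_at_bound:
  fixes f g :: "'k::field poly"
  assumes "degree f \<le> a" "degree g \<le> b"
  shows "coeff (f * g) (a + b) = coeff f a * coeff g b"
proof -
  have "coeff (f * g) (a + b) = (\<Sum>i\<le>a + b. coeff f i * coeff g (a + b - i))"
    by (simp add: coeff_mult)
  also have "\<dots> = (\<Sum>i\<in>{a}. coeff f i * coeff g (a + b - i))"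
  proof (rule sum.mono_neutral_right)
    show "\<forall>i\<in>{..a + b} - {a}. coeff f i * coeff g (a + b - i) = 0"
    proof
      fix i assume "i \<in> {..a + b} - {a}"
      then have "i > a \<or> a + b - i > b" by auto
      then show "coeff f i * coeff g (a + b - i) = 0"
        using assms by (metis coeff_eq_0 le_less_trans mult_zero_left mult_zero_right)
    qed
  qed auto
  finally show ?thesis by simp
qed

lemma section_value_mult:
  fixes f g :: "'k::field poly"
  assumes "f \<in> sections a" "g \<in> sections b"
  shows "section_value x (a + b) (f * g) = section_value x a f * section_value x b g"
  using assms by (cases x) (auto simp: sections_def coeff_mult_at_bound)

lemma section_value_add [simp]: "section_value x r (f + g) = section_value x r f + section_value x r g"
  by (cases x) auto

lemma section_value_diff [simp]: "section_value x r (f - g) = section_value x r f - section_value x r g"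
  by (cases x) auto

lemma section_value_smult [simp]: "section_value x r (smult c f) = c * section_value x r f"
  by (cases x) auto

lemma section_value_0 [simp]: "section_value x r 0 = 0"
  by (cases x) auto

lemma sections_add [intro]: "f \<in> sections r \<Longrightarrow> g \<in> sections r \<Longrightarrow> f + g \<in> sections r"
  by (simp add: sections_def degree_add_le)

lemma sections_diff [intro]: "f \<in> sections r \<Longrightarrow> g \<in> sections r \<Longrightarrow> f - g \<in> sections r"
  by (simp add: sections_def degree_diff_le)

lemma sections_smult [intro]: "f \<in> sections r \<Longrightarrow> smult c f \<in> sections r"
  by (simp add: sections_def)

lemma sections_0 [simp, intro]: "0 \<in> sections r"
  by (simp add: sections_def)

lemma sections_1 [simp, intro]: "1 \<in> sections r"
  by (simp add: sections_def)

lemma sections_mult: "f \<in> sections a \<Longrightarrow> g \<in> sections b \<Longrightarrow> f * g \<in> sections (a + b)"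
  unfolding sections_def using degree_mult_le[of f g] by auto

lemma sections_zeroE:
  assumes "f \<in> sections 0"
  obtains c where "f = [:c:]"
  using assms by (auto simp: sections_def elim: degree_eq_zeroE)

lemma section_value_const: "section_value x 0 [:c:] = c"
  by (cases x) auto

section \<open>Marked points: evaluation, division and interpolation\<close>

locale marked_line =
  fixes n :: nat and P :: "nat \<Rightarrow> 'k::field closed_point" and t :: "nat \<Rightarrow> 'k poly"
  assumes n2: "2 \<le> n"
    and rational: "P ` {1..n} \<subseteq> rational_points" and distinct: "inj_on P {1..n}"
    and t: "\<And>i. i \<in> {1..n} \<Longrightarrow> vanishes_only_at (t i) (P i)"
begin

abbreviation ev :: "nat \<Rightarrow> nat \<Rightarrow> 'k poly \<Rightarrow> 'k" where
  "ev i \<equiv> section_value (P i)"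

lemma t_sections: "i \<in> {1..n} \<Longrightarrow> t i \<in> sections 1"
  using t by (auto simp: vanishes_only_at_def sections_def)

lemma t_nonzero: "i \<in> {1..n} \<Longrightarrow> t i \<noteq> 0"
  using t by (auto simp: vanishes_only_at_def)

text \<open>Translates orders of vanishing into values. At infinity the order of a section of O(1)
  is one minus its degree; at a finite point it is the multiplicity of the linear factor.\<close>

lemma ev_t:
  assumes i: "i \<in> {1..n}" and j: "j \<in> {1..n}"
  shows "ev i 1 (t j) = 0 \<longleftrightarrow> i = j"
proof -
  have cl: "P i \<in> closed_points"
  proof -
    have "P i \<in> rational_points" using rational i by blast
    moreover have "irreducible [:-a, 1 :: 'k:]" for a by (rule irreducible_linear_field_poly) simp
    ultimately show ?thesis unfolding rational_points_def closed_points_def by auto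
  qed
  have ij: "P i = P j \<longleftrightarrow> i = j" using distinct i j by (auto dest: inj_onD)
  have so: "section_ord (P i) (t j) = (if i = j then 1 else 0)"
    using section_ord_eq[OF t[OF j] cl] ij by simp
  have t0: "t j \<noteq> 0" "degree (t j) \<le> 1" using t[OF j] by (auto simp: vanishes_only_at_def)
  consider "P i = Infinity" | a where "P i = Place [:-a, 1:]"
    using rational i unfolding rational_points_def by blast
  then show ?thesis
  proof cases
    case 1
    then have "degree (t j) = (if i = j then 0 else 1)"
      using so by (auto simp: section_ord_def split: if_splits)
    then show ?thesis using 1 t0 leading_coeff_0_iff[of "t j"]
      by (cases "i = j") (auto simp: coeff_eq_0 simp del: leading_coeff_0_iff)
  next
    case (2 a)
    have M: "Max {k. [:-a, 1:] ^ k dvd t j} = (if i = j then 1 else 0)"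
      using so 2 by (auto simp: section_ord_def split: if_splits)
    obtain c where c: "t j = [:-a, 1:] ^ Max {k. [:-a, 1:] ^ k dvd t j} * c" "\<not> [:-a, 1:] dvd c"
      using mult_decomp[of "[:-a, 1:]" "t j"] t0 by auto
    have "[:-a, 1:] dvd t j \<longleftrightarrow> i = j"
    proof (cases "i = j")
      case True
      then show ?thesis using c(1) unfolding M by (metis dvd_triv_left power_one_right)
    next
      case False
      then show ?thesis using c unfolding M by auto
    qed
    then show ?thesis using 2 by (simp add: poly_eq_0_iff_dvd)
  qed
qed

lemma ev_mult:
  "f \<in> sections a \<Longrightarrow> g \<in> sections b \<Longrightarrow> r = a + b \<Longrightarrow> ev i r (f * g) = ev i a f * ev i b g"
  using section_value_mult by blast

text \<open>Division by t_i takes O(r + 1) to O(r). At infinity t_i is a constant and it is the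
  degree bound that drops; at a finite point t_i is a scalar multiple of the linear factor.\<close>

lemma ev_Suc_eq_0:
  assumes i: "i \<in> {1..n}" and f: "f \<in> sections (Suc r)"
  shows "ev i (Suc r) f = 0 \<longleftrightarrow> (\<exists>h\<in>sections r. f = t i * h)"
proof
  assume "\<exists>h\<in>sections r. f = t i * h"
  then show "ev i (Suc r) f = 0"
    using ev_mult[OF t_sections[OF i], of _ r "Suc r" i] ev_t[OF i i] by auto
next
  assume z: "ev i (Suc r) f = 0"
  have ti: "ev i 1 (t i) = 0" using ev_t[OF i i] by simp
  have t0: "t i \<noteq> 0" "degree (t i) \<le> 1" using t_nonzero t_sections i by (auto simp: sections_def)
  consider "P i = Infinity" | a where "P i = Place [:-a, 1:]"
    using rational i unfolding rational_points_def by blast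
  then show "\<exists>h\<in>sections r. f = t i * h"
  proof cases
    case 1
    have "degree (t i) = 0" using 1 ti t0 by (metis One_nat_def le_SucE le_zero_eq leading_coeff_0_iff section_value.simps(2))
    then obtain c where c: "t i = [:c:]" by (auto elim: degree_eq_zeroE)
    then have "c \<noteq> 0" using t0 by auto
    then have fe: "f = t i * smult (inverse c) f" using c by simp
    have "degree f \<le> r"
    proof (rule ccontr)
      assume "\<not> degree f \<le> r"
      then have "degree f = Suc r" using f by (auto simp: sections_def)
      then show False using z 1 by (metis leading_coeff_0_iff degree_0 section_value.simps(2) nat.distinct(1))
    qed
    then have "smult (inverse c) f \<in> sections r" by (simp add: sections_def)
    then show ?thesis using fe by blast
  next
    case (2 a)
    have "[:-a, 1:] dvd f" "[:-a, 1:] dvd t i" using z ti 2 by (auto simp: poly_eq_0_iff_dvd)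
    then obtain h c where h: "f = [:-a, 1:] * h" and c: "t i = [:-a, 1:] * c" by (auto elim!: dvdE)
    have c0: "c \<noteq> 0" using c t0 by auto
    then have "degree c = 0" using t0(2) unfolding c by (subst (asm) degree_mult_eq) auto
    then obtain c' where c': "c = [:c':]" by (auto elim: degree_eq_zeroE)
    then have "c' \<noteq> 0" using c0 by auto
    then have fe: "f = t i * smult (inverse c') h" unfolding h c c' by (simp add: mult.commute)
    have "degree h \<le> r"
    proof (cases "h = 0")
      case False
      then show ?thesis using f unfolding h sections_def by (simp add: degree_mult_eq del: mult_pCons_left)
    qed simp
    then have "smult (inverse c') h \<in> sections r" by (simp add: sections_def)
    then show ?thesis using fe by blast
  qed
qed

definition tmono :: "(nat \<Rightarrow> nat) \<Rightarrow> 'k poly" where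
  "tmono c = (\<Prod>i=1..n. t i ^ c i)"

definition tset :: "nat set \<Rightarrow> 'k poly" where
  "tset A = (\<Prod>i\<in>A. t i)"

lemma t_power:
  assumes i: "i \<in> {1..n}" and j: "j \<in> {1..n}"
  shows "t j ^ c \<in> sections c \<and> (ev i c (t j ^ c) = 0 \<longleftrightarrow> i = j \<and> c > 0)"
proof (induction c)
  case 0
  show ?case using section_value_const[of "P i" 1] by (simp flip: one_pCons)
next
  case (Suc c)
  have "ev i (Suc c) (t j ^ Suc c) = ev i 1 (t j) * ev i c (t j ^ c)"
    using ev_mult[OF t_sections[OF j], of "t j ^ c" c "Suc c" i] Suc by simp
  moreover have "t j ^ Suc c \<in> sections (Suc c)" using sections_mult[OF t_sections[OF j], of "t j ^ c" c] Suc by simp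
  ultimately show ?case using Suc ev_t[OF i j] by auto
qed

lemma prod_t_power:
  assumes "A \<subseteq> {1..n}" and i: "i \<in> {1..n}"
  shows "(\<Prod>j\<in>A. t j ^ c j) \<in> sections (sum c A) \<and>
    (ev i (sum c A) (\<Prod>j\<in>A. t j ^ c j) = 0 \<longleftrightarrow> i \<in> A \<and> c i > 0)"
  using finite_subset[OF assms(1) finite_atLeastAtMost] assms(1)
proof (induction A rule: finite_induct)
  case empty
  show ?case using section_value_const[of "P i" 1] by (simp flip: one_pCons)
next
  case (insert j A)
  have *: "t j ^ c j \<in> sections (c j)" "ev i (c j) (t j ^ c j) = 0 \<longleftrightarrow> i = j \<and> c j > 0"
    using t_power[OF i, of j "c j"] insert.prems by auto
  have "ev i (c j + sum c A) (t j ^ c j * (\<Prod>j\<in>A. t j ^ c j)) = ev i (c j) (t j ^ c j) * ev i (sum c A) (\<Prod>j\<in>A. t j ^ c j)"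
    using ev_mult[OF *(1)] insert by auto
  moreover have "t j ^ c j * (\<Prod>j\<in>A. t j ^ c j) \<in> sections (c j + sum c A)"
    using sections_mult[OF *(1)] insert by auto
  ultimately show ?case using insert * by auto
qed

lemma tmono_sections: "tmono c \<in> sections (\<Sum>i=1..n. c i)"
  unfolding tmono_def using prod_t_power[of "{1..n}" 1 c] n2 by simp

lemma ev_tmono: "i \<in> {1..n} \<Longrightarrow> ev i (\<Sum>i=1..n. c i) (tmono c) = 0 \<longleftrightarrow> c i > 0"
  unfolding tmono_def using prod_t_power[of "{1..n}" i c] by auto

lemma tset_sections: "A \<subseteq> {1..n} \<Longrightarrow> tset A \<in> sections (card A)"
  unfolding tset_def using prod_t_power[of A 1 "\<lambda>_. 1"] n2 by simp

lemma ev_tset: "A \<subseteq> {1..n} \<Longrightarrow> i \<in> {1..n} \<Longrightarrow> ev i (card A) (tset A) = 0 \<longleftrightarrow> i \<in> A"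
  unfolding tset_def using prod_t_power[of A i "\<lambda>_. 1"] by simp

lemma tset_nonzero: "A \<subseteq> {1..n} \<Longrightarrow> tset A \<noteq> 0"
  unfolding tset_def using t_nonzero finite_subset[of A "{1..n}"] by (auto simp: subset_iff)

lemma other_point:
  obtains k where "k \<in> {1..n}" "k \<noteq> j"
  using n2 that[of 1] that[of 2] by (cases "j = 1") auto

lemma separating_section:
  assumes X: "X \<subseteq> {1..n}" and x: "x \<in> {1..n}" "x \<notin> X" and "card X \<le> r"
  shows "\<exists>f\<in>sections r. ev x r f \<noteq> 0 \<and> (\<forall>i\<in>X. ev i r f = 0)"
proof -
  obtain k where k: "k \<in> {1..n}" "k \<noteq> x" using other_point .
  \<comment> \<open>The power of \<open>t k\<close> fills up the degree. It must not vanish at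
    \<open>P x\<close>, which is why k differs from x; k may well lie in X.\<close>
  define f where "f = tset X * t k ^ (r - card X)"
  have r: "r = card X + (r - card X)" using assms by simp
  have s: "tset X \<in> sections (card X)" "t k ^ (r - card X) \<in> sections (r - card X)"
    using tset_sections[OF X] t_power[OF k(1) k(1)] by auto
  have "f \<in> sections r" unfolding f_def using sections_mult[OF s] r by simp
  moreover have e: "ev i r f = ev i (card X) (tset X) * ev i (r - card X) (t k ^ (r - card X))" for i
    unfolding f_def by (rule ev_mult[OF s r])
  have "ev x r f \<noteq> 0" unfolding e using ev_tset[OF X x(1)] x t_power[OF x(1) k(1)] k by auto
  moreover have "ev i r f = 0" if "i \<in> X" for i
    unfolding e using ev_tset[OF X, of i] that X by auto
  ultimately show ?thesis by blast
qed

text \<open>Up to r + 1 points impose independent conditions on O(r): a new value is adjusted by a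
  section that vanishes at the points already treated.\<close>

lemma interpolation:
  assumes "X \<subseteq> {1..n}" and "card X \<le> Suc r"
  shows "\<exists>f\<in>sections r. \<forall>i\<in>X. ev i r f = v i"
  using finite_subset[OF assms(1) finite_atLeastAtMost] assms
proof (induction X rule: finite_induct)
  case empty
  show ?case by auto
next
  case (insert x X)
  then obtain f where f: "f \<in> sections r" "\<forall>i\<in>X. ev i r f = v i" by auto
  obtain g where g: "g \<in> sections r" "ev x r g \<noteq> 0" "\<forall>i\<in>X. ev i r g = 0"
    using separating_section[of X x r] insert by auto
  define c where "c = (v x - ev x r f) / ev x r g"
  have "f + smult c g \<in> sections r" using f g by auto
  moreover have "ev i r (f + smult c g) = v i" if "i \<in> insert x X" for i
    using that f g by (cases "i = x") (auto simp: c_def)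
  ultimately show ?case by blast
qed

definition vanishing :: "nat \<Rightarrow> nat set \<Rightarrow> 'k poly set" where
  "vanishing r A = {f\<in>sections r. \<forall>i\<in>A. ev i r f = 0}"

lemma vanishing_subspace: "lin.subspace (vanishing r A)"
  by (rule lin.subspaceI) (auto simp: vanishing_def)

lemma sections_subspace: "lin.subspace (sections r)"
  by (rule lin.subspaceI) auto

text \<open>The t_i are divided out one at a time, each lowering r by one. The degree cannot run out
  early, because a nonzero constant has no zeros.\<close>

lemma vanishing_factor:
  assumes "A \<subseteq> {1..n}" and "f \<in> vanishing r A" and "f \<noteq> 0"
  shows "card A \<le> r \<and> (\<exists>h\<in>sections (r - card A). f = tset A * h)"
  using finite_subset[OF assms(1) finite_atLeastAtMost] assms
proof (induction A arbitrary: f r rule: finite_induct)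
  case empty
  then show ?case by (auto simp: tset_def vanishing_def)
next
  case (insert x A)
  have x: "x \<in> {1..n}" using insert by auto
  have f: "f \<in> sections r" "ev x r f = 0" using insert by (auto simp: vanishing_def)
  have "r \<noteq> 0"
  proof
    assume "r = 0"
    then obtain c where "f = [:c:]" using f by (auto elim: sections_zeroE)
    then show False using f insert.prems \<open>r = 0\<close> section_value_const[of "P x" c] by simp
  qed
  then obtain s where s: "r = Suc s" by (cases r) auto
  then obtain h where h: "h \<in> sections s" "f = t x * h" using ev_Suc_eq_0[OF x] f by auto
  have "h \<in> vanishing s A"
    unfolding vanishing_def
  proof (safe)
    fix i assume i: "i \<in> A"
    then have i': "i \<in> {1..n}" "i \<noteq> x" using insert by auto
    have "ev i r f = ev i 1 (t x) * ev i s h" unfolding h(2) using ev_mult[OF t_sections[OF x] h(1)] s by simp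
    moreover have "ev i r f = 0" using insert i by (auto simp: vanishing_def)
    ultimately show "ev i s h = 0" using ev_t[OF i'(1) x] i' by auto
  qed fact
  then have "card A \<le> s \<and> (\<exists>h'\<in>sections (s - card A). h = tset A * h')"
    using insert.IH[of h s] insert.prems h by auto
  then show ?case using insert.hyps s h(2) by (auto simp: tset_def mult_ac)
qed

lemma vanishing_eq_0: "A \<subseteq> {1..n} \<Longrightarrow> card A > r \<Longrightarrow> vanishing r A = {0}"
  using vanishing_factor[of A _ r] by (auto simp: vanishing_def)

end

subsection \<open>Families of vanishing conditions\<close>

definition irreducible_family :: "nat \<Rightarrow> nat \<Rightarrow> nat set set \<Rightarrow> bool" where
  "irreducible_family n r F \<longleftrightarrow> F \<subseteq> Pow {1..n} \<and> (\<nexists>F'. reduce_step r F F')"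

lemma irreducible_family_card_le:
  "irreducible_family n r F \<Longrightarrow> A \<in> F \<Longrightarrow> card A \<le> r"
  unfolding irreducible_family_def by (meson leI reduce_step.delete)

lemma irreducible_family_card_Un:
  "irreducible_family n r F \<Longrightarrow> A \<in> F \<Longrightarrow> B \<in> F \<Longrightarrow> A \<noteq> B \<Longrightarrow> r + 2 \<le> card (A \<union> B)"
  unfolding irreducible_family_def using reduce_step.merge[of A F B r] by fastforce

text \<open>The bound on n enters through this count: r + 2 \<le> |A \<union> B| \<le> |A| + |B|
  \<le> 2r gives r \<ge> 2, and |A \<union> B| \<le> n \<le> 4 gives r \<le> 2, so that equality
  holds everywhere.\<close>

lemma irreducible_family_pair:
  assumes F: "irreducible_family n r F" and n: "n \<le> 4" and AB: "A \<in> F" "B \<in> F" "A \<noteq> B"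
  shows "r = 2 \<and> card A = 2 \<and> card B = 2 \<and> B = {1..n} - A"
proof -
  have sub: "A \<subseteq> {1..n}" "B \<subseteq> {1..n}" using F AB by (auto simp: irreducible_family_def)
  have fin: "finite A" "finite B" using sub finite_subset by blast+
  have le: "card A \<le> r" "card B \<le> r" using irreducible_family_card_le[OF F] AB by auto
  have ge: "r + 2 \<le> card (A \<union> B)" using irreducible_family_card_Un[OF F AB] .
  have "card (A \<union> B) \<le> card {1..n}" using sub by (intro card_mono) auto
  then have c4: "card (A \<union> B) \<le> n" by simp
  have sum: "card A + card B = card (A \<union> B) + card (A \<inter> B)" using card_Un_Int[OF fin] .
  have "card (A \<inter> B) = 0" "card (A \<union> B) = n" "r = 2" "card A = 2" "card B = 2"
    using le ge c4 sum n by linarith+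
  moreover have "A \<union> B = {1..n}" using calculation(2) sub by (intro card_subset_eq) auto
  ultimately show ?thesis using fin by auto
qed

lemma irreducible_family_cases:
  assumes F: "irreducible_family n r F" and n: "n \<le> 4"
  obtains "F = {}" | A where "F = {A}"
    | A B where "F = {A, B}" "A \<noteq> B" "r = 2" "card A = 2" "card B = 2" "B = {1..n} - A" "A \<subseteq> {1..n}"
proof -
  consider "F = {}" | A where "F = {A}" | A B where "A \<in> F" "B \<in> F" "A \<noteq> B" by blast
  then show thesis
  proof cases
    case (3 A B)
    have "F = {A, B}"
    \<comment> \<open>A third member would be the complement of A as well, hence equal to B.\<close>
    proof (rule ccontr)
      assume "F \<noteq> {A, B}"
      then obtain C where "C \<in> F" "C \<noteq> A" "C \<noteq> B" using 3 by blast
      then show False using irreducible_family_pair[OF F n] 3 by metis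
    qed
    moreover have "A \<subseteq> {1..n}" using F 3 by (auto simp: irreducible_family_def)
    ultimately show ?thesis using that(3) irreducible_family_pair[OF F n 3] 3 by metis
  qed (fact that)+
qed

lemma reduce_step_Pow:
  "reduce_step r F F' \<Longrightarrow> F \<subseteq> Pow S \<Longrightarrow> F' \<subseteq> Pow S"
  by (induction rule: reduce_step.induct) auto

text \<open>Termination of the reduction: a merge replaces two members by at most one new
  one.\<close>

lemma reduce_step_card:
  assumes "reduce_step r F F'" "finite F"
  shows "finite F' \<and> card F' < card F"
  using assms(1)
proof (cases rule: reduce_step.cases)
  case (delete A)
  have "card (F - {A}) < card F" using delete assms(2) by (intro card_Diff1_less)
  then show ?thesis using delete assms(2) by simp
next
  case (merge A B)
  have "card F' \<le> Suc (card (F - {A, B}))" using merge assms(2) by (simp add: card_insert_if)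
  moreover have "card (F - {A, B}) = card F - 2" using merge assms(2) by (subst card_Diff_subset) auto
  moreover have "card F \<ge> 2" using merge assms(2) card_mono[of F "{A, B}"] by auto
  ultimately show ?thesis using merge assms(2) by auto
qed

lemma reduces_to_exists: "finite F \<Longrightarrow> \<exists>F'. reduces_to r F F'"
proof (induction "card F" arbitrary: F rule: less_induct)
  case less
  show ?case
  proof (cases "\<exists>F'. reduce_step r F F'")
    case True
    then obtain F' where F': "reduce_step r F F'" by blast
    then obtain F'' where "reduces_to r F' F''" using less reduce_step_card by blast
    then show ?thesis using F' by (meson reduces_to_def converse_rtranclp_into_rtranclp)
  qed (auto simp: reduces_to_def)
qed

lemma reduces_to_Pow:
  assumes "reduces_to r F F'" "F \<subseteq> Pow S"
  shows "F' \<subseteq> Pow S"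
proof -
  have "(reduce_step r)\<^sup>*\<^sup>* F F'" using assms by (simp add: reduces_to_def)
  then show ?thesis using assms(2) by induction (auto dest: reduce_step_Pow)
qed

lemma reduces_to_irreducible:
  "reduces_to r F F' \<Longrightarrow> F \<subseteq> Pow {1..n} \<Longrightarrow> irreducible_family n r F'"
  using reduces_to_Pow[of r F F' "{1..n}"] by (auto simp: irreducible_family_def reduces_to_def)

text \<open>Any reduction will do, since all of them preserve the sum of the V_A. What matters is
  that the choice is a function of r and F alone, hence common to all fields.\<close>

definition normal_form :: "nat \<Rightarrow> nat set set \<Rightarrow> nat set set" where
  "normal_form r F = (SOME F'. reduces_to r F F')"

lemma normal_form: "finite F \<Longrightarrow> reduces_to r F (normal_form r F)"
  unfolding normal_form_def by (rule someI_ex[OF reduces_to_exists])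

section \<open>Sums of spaces V_A and their colons\<close>

context marked_line
begin

definition family_span :: "nat \<Rightarrow> nat set set \<Rightarrow> 'k poly set" where
  "family_span r F = lin.span (\<Union>A\<in>F. vanishing r A)"

lemma family_span_subspace: "lin.subspace (family_span r F)"
  by (simp add: family_span_def)

lemma vanishing_subset_family_span: "A \<in> F \<Longrightarrow> vanishing r A \<subseteq> family_span r F"
  unfolding family_span_def by (auto intro: lin.span_base)

lemma family_span_least:
  assumes "lin.subspace X" "\<And>A. A \<in> F \<Longrightarrow> vanishing r A \<subseteq> X"
  shows "family_span r F \<subseteq> X"
  unfolding family_span_def using assms by (intro lin.span_minimal) auto

lemma family_span_sections: "family_span r F \<subseteq> sections r"
  by (rule family_span_least[OF sections_subspace]) (auto simp: vanishing_def)

lemma family_span_empty [simp]: "family_span r {} = {0}"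
  by (simp add: family_span_def)

lemma span_vanishing [simp]: "lin.span (vanishing r A) = vanishing r A"
  using vanishing_subspace by (simp only: lin.span_eq_iff)

lemma family_span_singleton [simp]: "family_span r {A} = vanishing r A"
  by (simp add: family_span_def)

lemma family_span_Un: "family_span r (F \<union> G) = lin.span (family_span r F \<union> family_span r G)"
  by (simp add: family_span_def span_Un_span)

text \<open>Interpolate a section h that is zero on A and equals f on B - A. Then f - h vanishes on
  B, because f itself vanishes on the intersection.\<close>

lemma vanishing_Int_subset:
  assumes sub: "A \<subseteq> {1..n}" "B \<subseteq> {1..n}" and card: "card (A \<union> B) \<le> Suc r"
  shows "vanishing r (A \<inter> B) \<subseteq> lin.span (vanishing r A \<union> vanishing r B)"
proof
  fix f assume f: "f \<in> vanishing r (A \<inter> B)"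
  obtain h where h: "h \<in> sections r" "\<forall>i\<in>A \<union> B. ev i r h = (if i \<in> A then 0 else ev i r f)"
    using interpolation[of "A \<union> B" r "\<lambda>i. if i \<in> A then 0 else ev i r f"] sub card by (metis (no_types, lifting) Un_least)
  have "h \<in> vanishing r A" using h by (auto simp: vanishing_def)
  moreover have "f - h \<in> vanishing r B" using f h by (auto simp: vanishing_def)
  ultimately have "h + (f - h) \<in> lin.span (vanishing r A \<union> vanishing r B)"
    by (intro lin.span_add) (auto intro: lin.span_base)
  then show "f \<in> lin.span (vanishing r A \<union> vanishing r B)" by simp
qed

lemma vanishing_antimono: "A \<subseteq> B \<Longrightarrow> vanishing r B \<subseteq> vanishing r A"
  by (auto simp: vanishing_def)

text \<open>A deleted member has V_A = 0, and a merge is justified by V_A + V_B being the space of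
  the intersection.\<close>

lemma family_span_reduce_step:
  assumes "reduce_step r F F'" and F: "F \<subseteq> Pow {1..n}"
  shows "family_span r F' = family_span r F"
  using assms(1)
proof cases
  case (delete A)
  have A0: "vanishing r A = {0}" using delete F by (intro vanishing_eq_0) auto
  show ?thesis
  proof (rule antisym)
    show "family_span r F' \<subseteq> family_span r F"
      using delete by (intro family_span_least family_span_subspace vanishing_subset_family_span) auto
    show "family_span r F \<subseteq> family_span r F'"
    proof (intro family_span_least family_span_subspace)
      fix B assume "B \<in> F"
      then show "vanishing r B \<subseteq> family_span r F'"
        using delete A0 vanishing_subset_family_span[of B F' r] lin.subspace_0[OF family_span_subspace[of r F']]
        by (cases "A = B") auto
    qed
  qed
next
  case (merge A B)
  have sub: "A \<subseteq> {1..n}" "B \<subseteq> {1..n}" using merge F by auto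
  have "vanishing r A \<subseteq> family_span r F" "vanishing r B \<subseteq> family_span r F"
    using merge by (auto intro: vanishing_subset_family_span[THEN subsetD])
  then have "lin.span (vanishing r A \<union> vanishing r B) \<subseteq> family_span r F"
    by (intro lin.span_minimal family_span_subspace) auto
  then have i1: "vanishing r (A \<inter> B) \<subseteq> family_span r F"
    using vanishing_Int_subset[OF sub, of r] merge by auto
  have i2: "vanishing r (A \<inter> B) \<subseteq> family_span r F'" using merge by (intro vanishing_subset_family_span) auto
  show ?thesis
  proof (rule antisym)
    show "family_span r F' \<subseteq> family_span r F"
      using merge i1 by (intro family_span_least family_span_subspace) (auto dest: vanishing_subset_family_span)
    show "family_span r F \<subseteq> family_span r F'"
    proof (intro family_span_least family_span_subspace)
      fix X assume X: "X \<in> F"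
      show "vanishing r X \<subseteq> family_span r F'"
      proof (cases "X = A \<or> X = B")
        case True
        then have "vanishing r X \<subseteq> vanishing r (A \<inter> B)" by (intro vanishing_antimono) auto
        then show ?thesis using i2 by auto
      next
        case False
        then show ?thesis using X merge by (intro vanishing_subset_family_span) auto
      qed
    qed
  qed
qed

lemma family_span_reduces_to:
  assumes "reduces_to r F F'" and F: "F \<subseteq> Pow {1..n}"
  shows "family_span r F' = family_span r F"
proof -
  have "(reduce_step r)\<^sup>*\<^sup>* F F'" using assms by (simp add: reduces_to_def)
  then have "F' \<subseteq> Pow {1..n} \<and> family_span r F' = family_span r F"
    using F
  proof induction
    case (step y z)
    then show ?case using reduce_step_Pow[OF step(2)] family_span_reduce_step[OF step(2)] by metis
  qed simp
  then show ?thesis ..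
qed

text \<open>For a pair, let X be the member containing i and Y the other. In g = x + y the part y
  also vanishes at i, that is, at the three points of Y \<union> {i}; in O(2) this forces y =
  0.\<close>

lemma family_span_pair_zero:
  assumes F: "irreducible_family n r F" and n4: "n \<le> 4"
    and g: "g \<in> family_span r F" "g \<noteq> 0" and i: "i \<in> {1..n}" "ev i r g = 0"
  shows "\<exists>A\<in>F. g \<in> vanishing r A"
  using F n4
proof (cases rule: irreducible_family_cases)
  case 1
  then show ?thesis using g by simp
next
  case (2 A)
  then show ?thesis using g by simp
next
  case (3 A B)
  have "\<exists>X\<in>{A, B}. g \<in> vanishing r X" if X: "i \<in> X" "X \<in> {A, B}" "Y \<in> {A, B}" "X \<noteq> Y" for X Y
  proof -
    have XY: "card X = 2" "card Y = 2" "Y = {1..n} - X" "F = {X} \<union> {Y}" "X \<subseteq> {1..n}" using that 3 by auto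
    have "g \<in> lin.span (vanishing r X \<union> vanishing r Y)"
      using g(1) unfolding XY(4) family_span_Un by simp
    then obtain x y where xy: "g = x + y" "x \<in> vanishing r X" "y \<in> vanishing r Y"
      unfolding lin.span_Un span_vanishing by blast
    have "ev i r y = 0" using i xy X by (auto simp: vanishing_def)
    then have "y \<in> vanishing r (insert i Y)" using xy by (auto simp: vanishing_def)
    moreover have "card (insert i Y) = 3" using XY X finite_subset[of Y "{1..n}"] by auto
    ultimately have "y = 0" using vanishing_eq_0[of "insert i Y" r] XY(3) i 3 by auto
    then show ?thesis using xy X by auto
  qed
  note part = this
  have "i \<in> A \<or> i \<in> B" using i 3 by auto
  then show ?thesis
  proof
    assume "i \<in> A"
    then show ?thesis using part[of A B] 3(1,2) by simp
  next
    assume "i \<in> B"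
    then show ?thesis using part[of B A] 3(1,2) by simp
  qed
qed

text \<open>
  The case \<open>Z = {}\<close>, \<open>a \<noteq> 0\<close> has to be excluded: the linear system of \<open>V\<^sub>A + V\<^sub>B\<close> for a pair of disjoint
  two-element sets contains sections that vanish at no marked point.
\<close>

lemma family_span_colon:
  assumes F: "irreducible_family n r F" and n4: "n \<le> 4"
    and m: "m \<in> sections a" "m \<noteq> 0" and f: "f \<in> sections b" and r: "r = a + b"
    and Z: "Z = {i\<in>{1..n}. ev i a m = 0}" and Z0: "Z = {} \<Longrightarrow> a = 0"
  shows "f * m \<in> family_span r F \<longleftrightarrow> f \<in> family_span b ((\<lambda>A. A - Z) ` F)"
proof
  have ev: "ev i r (h * m) = ev i b h * ev i a m" if "h \<in> sections b" for h i
    using ev_mult[OF that m(1), of r i] r by simp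
  have sec: "h * m \<in> sections r" if "h \<in> sections b" for h using sections_mult[OF that m(1)] r by (simp add: add.commute)
  have colon: "h * m \<in> vanishing r A \<longleftrightarrow> h \<in> vanishing b (A - Z)" if "A \<subseteq> {1..n}" "h \<in> sections b" for A h
    using that ev sec unfolding vanishing_def Z by auto
  have sub: "\<And>A. A \<in> F \<Longrightarrow> A \<subseteq> {1..n}" using F by (auto simp: irreducible_family_def)
  show "f * m \<in> family_span r F" if "f \<in> family_span b ((\<lambda>A. A - Z) ` F)"
  proof -
    have "family_span b ((\<lambda>A. A - Z) ` F) \<subseteq> {h. h * m \<in> family_span r F}"
    proof (rule family_span_least)
      show "lin.subspace {h. h * m \<in> family_span r F}"
        using family_span_subspace[of r F]
        by (auto simp: lin.subspace_def algebra_simps)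
      show "vanishing b X \<subseteq> {h. h * m \<in> family_span r F}" if X: "X \<in> (\<lambda>A. A - Z) ` F" for X
      proof
        fix h assume h: "h \<in> vanishing b X"
        obtain A where A: "A \<in> F" "X = A - Z" using X by blast
        then have "h * m \<in> vanishing r A" using h colon[OF sub[OF A(1)], of h] by (auto simp: vanishing_def)
        then show "h \<in> {h. h * m \<in> family_span r F}" using vanishing_subset_family_span[OF A(1)] by blast
      qed
    qed
    then show ?thesis using that by auto
  qed
  assume fm: "f * m \<in> family_span r F"
  show "f \<in> family_span b ((\<lambda>A. A - Z) ` F)"
  proof (cases "f = 0")
    case True
    then show ?thesis by (simp add: lin.subspace_0 family_span_subspace)
  next
    case False
    have one: ?thesis if "A \<in> F" "f * m \<in> vanishing r A" for A
      using that colon[OF sub, of A f] f vanishing_subset_family_span[of "A - Z" "(\<lambda>A. A - Z) ` F" b] by auto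
    show ?thesis
    proof (cases "Z = {}")
      case True
      then have a: "a = 0" using Z0 by simp
      then obtain c where c: "m = [:c:]" using m by (auto elim: sections_zeroE)
      then have "f = smult (inverse c) (f * m)" using m by simp
      then have "f \<in> family_span r F" using fm lin.subspace_scale[OF family_span_subspace] by metis
      then show ?thesis using a r True by simp
    next
      case False
      \<comment> \<open>A marked zero of m is one of f * m, which is therefore in a single V_A; for
        a single V_A the conditions on f can be read off point by point.\<close>
      then obtain i where i: "i \<in> {1..n}" "ev i a m = 0" using Z by auto
      have ev0: "ev i r (f * m) = 0" using ev[OF f, of i] i by simp
      have "f * m \<noteq> 0" using \<open>f \<noteq> 0\<close> m by simp
      then show ?thesis using family_span_pair_zero[OF F n4 fm _ i(1) ev0] one by blast
    qed
  qed
qed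

text \<open>This decides whether the colon of the sum by m contains anything nonzero at
  \<open>P j\<close>. With a marked zero of m the product h * m lies in one V_A, so h lies in the
  space of A - Z, and that space has a member nonzero at \<open>P j\<close> exactly under the two
  stated conditions. Without one, m is a constant.\<close>

lemma family_span_tangent:
  assumes F: "irreducible_family n r F" and n4: "n \<le> 4" and j: "j \<in> {1..n}"
    and m: "m \<in> sections a" "m \<noteq> 0" and r: "r = a + b"
    and Z: "Z = {i\<in>{1..n}. ev i a m = 0}" and Z0: "Z = {} \<Longrightarrow> a = 0"
  shows "(\<exists>h\<in>sections b. ev j b h \<noteq> 0 \<and> h * m \<in> family_span r F) \<longleftrightarrow>
    (\<exists>A\<in>F. j \<notin> A - Z \<and> card (A - Z) \<le> b)" (is "_ \<longleftrightarrow> ?ex")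
proof
  have ev: "ev i r (h * m) = ev i b h * ev i a m" if "h \<in> sections b" for h i
    using ev_mult[OF that m(1), of r i] r by simp
  have sec: "h * m \<in> sections r" if "h \<in> sections b" for h using sections_mult[OF that m(1)] r by (simp add: add.commute)
  have sub: "\<And>A. A \<in> F \<Longrightarrow> A \<subseteq> {1..n}" using F by (auto simp: irreducible_family_def)
  show "\<exists>h\<in>sections b. ev j b h \<noteq> 0 \<and> h * m \<in> family_span r F" if ex: "\<exists>A\<in>F. j \<notin> A - Z \<and> card (A - Z) \<le> b"
  proof -
    obtain A where A: "A \<in> F" "j \<notin> A - Z" "card (A - Z) \<le> b" using ex by blast
    have AZ: "A - Z \<subseteq> {1..n}" using sub[OF A(1)] by blast
    obtain h where h: "h \<in> sections b" "ev j b h \<noteq> 0" "\<forall>i\<in>A - Z. ev i b h = 0"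
      using separating_section[OF AZ j A(2,3)] by blast
    have "ev i r (h * m) = 0" if "i \<in> A" for i
      using h ev[OF h(1), of i] that sub[OF A(1)] unfolding Z by auto
    then have "h * m \<in> vanishing r A" using sec[OF h(1)] unfolding vanishing_def by blast
    then show ?thesis using h vanishing_subset_family_span[OF A(1)] by blast
  qed
  assume "\<exists>h\<in>sections b. ev j b h \<noteq> 0 \<and> h * m \<in> family_span r F"
  then obtain h where h: "h \<in> sections b" "ev j b h \<noteq> 0" and hm: "h * m \<in> family_span r F" by blast
  have h0: "h \<noteq> 0" using h by auto
  have one: ?ex if A: "A \<in> F" "h * m \<in> vanishing r A" for A
  proof -
    have v: "h \<in> vanishing b (A - Z)" using that h ev[OF h(1)] sub[OF A(1)] unfolding vanishing_def Z by auto
    then have "j \<notin> A - Z" using h by (auto simp: vanishing_def)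
    moreover have "A - Z \<subseteq> {1..n}" using sub[OF A(1)] by blast
    then have "card (A - Z) \<le> b" using vanishing_factor[OF _ v h0] by blast
    ultimately show ?ex using A(1) by (intro bexI[of _ A] conjI)
  qed
  show ?ex
  proof (cases "Z = {}")
    case False
    then obtain i where i: "i \<in> {1..n}" "ev i a m = 0" using Z by auto
    have ev0: "ev i r (h * m) = 0" using ev[OF h(1), of i] i by simp
    have "h * m \<noteq> 0" using h0 m by simp
    then show ?ex using family_span_pair_zero[OF F n4 hm _ i(1) ev0] one by blast
  next
    case True
    then have a: "a = 0" using Z0 by simp
    show ?ex using F n4
    proof (cases rule: irreducible_family_cases)
      case 1
      then show ?ex using hm h0 m by simp
    next
      case (2 A)
      then show ?ex using hm one[of A] by simp
    next
      case (3 A B)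
      \<comment> \<open>Of two complementary sets one misses j, and its two points do not exceed the
        degree of O(2).\<close>
      have "j \<notin> A \<or> j \<notin> B" using 3(6) by blast
      then obtain X where "X \<in> F" "j \<notin> X" using 3(1) by blast
      moreover have "card X = 2" using \<open>X \<in> F\<close> 3 by blast
      ultimately show ?ex using 3(3) a r by (intro bexI[of _ X]) (simp_all add: True)
    qed
  qed
qed

end

subsection \<open>The field-independent data\<close>

text \<open>
  Let \<open>I\<close> be the ideal generated by the generators preceding a given one, of degree \<open>e\<close>, and \<open>I'\<close> the
  ideal generated by those of degree less than \<open>e\<close>.  A generator of kind \<open>Pure j\<close> is a power of \<open>t j\<close> and
  the first of its degree, so that \<open>I = I'\<close>.  For one of kind \<open>Tangent j s\<close>, the degree \<open>e\<close> part of \<open>I\<close> is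
  that of \<open>I'\<close> plus the multiples of \<open>t j ^ s\<close>, and the generator is exactly divisible by \<open>t j ^ (s - 1)\<close>.
\<close>

datatype letter_kind = Pure nat | Tangent nat nat

text \<open>Neither a field nor points occur here, so whatever is defined in this locale is stable
  automatically.\<close>

locale stable_data =
  fixes n :: nat and \<alpha> :: "nat \<Rightarrow> rat" and ms :: "nat \<Rightarrow> (nat \<Rightarrow> nat) list"
begin

text \<open>By \<open>canonical_piece_nonzero_iff\<close> this says S_d \<noteq> 0, whatever the
  field.\<close>

definition effective :: "nat \<Rightarrow> bool" where
  "effective d \<longleftrightarrow> 0 \<le> floor_deg n \<alpha> d"

definition rk :: "nat \<Rightarrow> nat" where
  "rk d = nat (floor_deg n \<alpha> d)"

text \<open>The set A_c of the construction for e = c + d, indexed by both summands so that symmetry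
  and the cocycle identity \<open>carry_assoc\<close> can be stated.\<close>

definition carry :: "nat \<Rightarrow> nat \<Rightarrow> nat set" where
  "carry c d = drop_set n \<alpha> (c + d) c"

text \<open>The vanishing conditions that describe the degree d piece of the ideal generated by S_1,
  ..., S_{e-1}. For d = e this is the family from which the generators of degree e are
  built.\<close>

definition below :: "nat \<Rightarrow> nat \<Rightarrow> nat set set" where
  "below e d = {carry c (d - c) | c. 1 \<le> c \<and> c < e \<and> c \<le> d \<and> effective c \<and> effective (d - c)}"

definition letters :: "(nat \<times> (nat \<Rightarrow> nat)) list" where
  "letters = concat (map (\<lambda>e. map (Pair e) (ms e)) (sorted_list_of_set (generator_degrees ms)))"

abbreviation N :: nat where
  "N \<equiv> length letters"

definition deg :: "nat \<Rightarrow> nat" where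
  "deg k = fst (letters ! k)"

definition letter_exp :: "nat \<Rightarrow> nat \<Rightarrow> nat" where
  "letter_exp k = snd (letters ! k)"

definition letter_pos :: "nat \<Rightarrow> nat" where
  "letter_pos k = card {l. l < k \<and> deg l = deg k}"

definition weight :: "nat list \<Rightarrow> nat" where
  "weight w = sum_list (map deg w)"

text \<open>The position b counts the preceding generators of degree e. If b = \<open>rk e\<close> +
  1 - s, their exponents at j run from \<open>rk e\<close> down to s and they alone give all
  multiples of t_j^s. The alternative is the last generator in the case of a single set A, with
  exponent 0 at j; there V_A supplies what the exponents left out would have given.\<close>

fun has_kind :: "nat \<Rightarrow> nat \<Rightarrow> letter_kind \<Rightarrow> bool" where
  "has_kind e b (Pure j) \<longleftrightarrow> b = 0 \<and> j \<in> {1..n} \<and> (\<forall>i\<in>{1..n}. (ms e ! 0) i = (if i = j then rk e else 0))"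
| "has_kind e b (Tangent j s) \<longleftrightarrow> j \<in> {1..n} \<and> 1 \<le> s \<and> s \<le> rk e \<and> (ms e ! b) j = s - 1 \<and>
     (\<forall>b'<b. (ms e ! b') j = rk e - b') \<and>
     (b = rk e + 1 - s \<or> s = 1 \<and> (\<exists>A. reduces_to (rk e) (below e e) {A} \<and> j \<in> A \<and> b = card A - 1))"

lemma carry_altdef:
  "carry c d = {i\<in>{1..n}. \<lfloor>of_nat (c + d) * \<alpha> i\<rfloor> \<noteq> \<lfloor>of_nat c * \<alpha> i\<rfloor> + \<lfloor>of_nat d * \<alpha> i\<rfloor>}"
  and floor_add: "\<lfloor>of_nat (c + d) * \<alpha> i\<rfloor> = \<lfloor>of_nat c * \<alpha> i\<rfloor> + \<lfloor>of_nat d * \<alpha> i\<rfloor> +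
    (if \<lfloor>of_nat (c + d) * \<alpha> i\<rfloor> \<noteq> \<lfloor>of_nat c * \<alpha> i\<rfloor> + \<lfloor>of_nat d * \<alpha> i\<rfloor> then 1 else 0)"
proof -
  have *: "\<lfloor>of_nat (c + d) * \<alpha> i\<rfloor> = \<lfloor>of_nat c * \<alpha> i\<rfloor> + \<lfloor>of_nat d * \<alpha> i\<rfloor> \<or>
    \<lfloor>of_nat (c + d) * \<alpha> i\<rfloor> = \<lfloor>of_nat c * \<alpha> i\<rfloor> + \<lfloor>of_nat d * \<alpha> i\<rfloor> + 1" for i
  proof -
    have "of_nat (c + d) * \<alpha> i = of_nat c * \<alpha> i + of_nat d * \<alpha> i" by (simp add: algebra_simps)
    then show ?thesis by linarith
  qed
  show "carry c d = {i\<in>{1..n}. \<lfloor>of_nat (c + d) * \<alpha> i\<rfloor> \<noteq> \<lfloor>of_nat c * \<alpha> i\<rfloor> + \<lfloor>of_nat d * \<alpha> i\<rfloor>}"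
    unfolding carry_def drop_set_def using * by force
  show "\<lfloor>of_nat (c + d) * \<alpha> i\<rfloor> = \<lfloor>of_nat c * \<alpha> i\<rfloor> + \<lfloor>of_nat d * \<alpha> i\<rfloor> +
    (if \<lfloor>of_nat (c + d) * \<alpha> i\<rfloor> \<noteq> \<lfloor>of_nat c * \<alpha> i\<rfloor> + \<lfloor>of_nat d * \<alpha> i\<rfloor> then 1 else 0)"
    using *[of i] by auto
qed

lemma floor_carry:
  "i \<in> {1..n} \<Longrightarrow> \<lfloor>of_nat (c + d) * \<alpha> i\<rfloor> = \<lfloor>of_nat c * \<alpha> i\<rfloor> + \<lfloor>of_nat d * \<alpha> i\<rfloor> + of_bool (i \<in> carry c d)"
  using floor_add[of c d i] unfolding carry_altdef by auto

lemma carry_subset: "carry c d \<subseteq> {1..n}"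
  by (auto simp: carry_altdef)

lemma finite_carry [simp]: "finite (carry c d)"
  using carry_subset finite_subset by blast

lemma carry_commute: "carry c d = carry d c"
  by (auto simp: carry_altdef add.commute)

lemma carry_0 [simp]: "carry 0 d = {}" "carry d 0 = {}"
  by (auto simp: carry_altdef)

text \<open>Both sides measure by how much the floor of (a + b + c) \<alpha>_i exceeds the sum of
  the floors of the three summands.\<close>

lemma carry_assoc:
  assumes "i \<in> {1..n}"
  shows "of_bool (i \<in> carry a b) + of_bool (i \<in> carry (a + b) c) =
    (of_bool (i \<in> carry b c) + of_bool (i \<in> carry a (b + c)) :: nat)"
proof -
  have "of_bool (i \<in> carry a b) + of_bool (i \<in> carry (a + b) c) =
    (of_bool (i \<in> carry b c) + of_bool (i \<in> carry a (b + c)) :: int)"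
    using floor_carry[OF assms, of a b] floor_carry[OF assms, of "a + b" c] floor_carry[OF assms, of b c]
      floor_carry[OF assms, of a "b + c"] by (simp add: add.assoc)
  then have "int (of_bool (i \<in> carry a b) + of_bool (i \<in> carry (a + b) c)) =
    int (of_bool (i \<in> carry b c) + of_bool (i \<in> carry a (b + c)))"
    unfolding of_nat_add of_nat_of_bool .
  then show ?thesis by (rule of_nat_eq_iff[THEN iffD1])
qed

lemma floor_deg_add: "floor_deg n \<alpha> (c + d) = floor_deg n \<alpha> c + floor_deg n \<alpha> d + int (card (carry c d))"
proof -
  have "(\<Sum>i=1..n. of_bool (i \<in> carry c d) :: int) = int (card ({1..n} \<inter> carry c d))"
    by (simp add: sum.inter_restrict[symmetric] of_bool_def)
  also have "{1..n} \<inter> carry c d = carry c d" using carry_subset by blast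
  finally have *: "(\<Sum>i=1..n. of_bool (i \<in> carry c d) :: int) = int (card (carry c d))" .
  have "floor_deg n \<alpha> (c + d) =
    (\<Sum>i=1..n. \<lfloor>of_nat c * \<alpha> i\<rfloor> + \<lfloor>of_nat d * \<alpha> i\<rfloor> + of_bool (i \<in> carry c d))"
    unfolding floor_deg_def by (intro sum.cong floor_carry) auto
  then show ?thesis unfolding sum.distrib * by (simp add: floor_deg_def)
qed

lemma effective_0 [simp]: "effective 0" and rk_0 [simp]: "rk 0 = 0"
  by (simp_all add: effective_def rk_def floor_deg_def)

lemma effective_add: "effective c \<Longrightarrow> effective d \<Longrightarrow> effective (c + d)"
  by (simp add: effective_def floor_deg_add)

lemma rk_add: "effective c \<Longrightarrow> effective d \<Longrightarrow> rk (c + d) = rk c + rk d + card (carry c d)"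
  by (simp add: effective_def rk_def floor_deg_add nat_add_distrib)

lemma below_subset: "below e d \<subseteq> Pow {1..n}"
  unfolding below_def using carry_subset by blast

lemma finite_family: "F \<subseteq> Pow {1..n} \<Longrightarrow> finite F"
  by (rule finite_subset) auto

text \<open>By the symmetry between c and e - c, letting c run up to e - 1 instead of e div 2 adds
  no new sets.\<close>

lemma drop_family_eq_below:
  "{drop_set n \<alpha> e c | c. 1 \<le> c \<and> c \<le> e div 2 \<and> effective c \<and> effective (e - c)} = below e e"
proof (rule set_eqI, rule iffI)
  fix A assume "A \<in> {drop_set n \<alpha> e c | c. 1 \<le> c \<and> c \<le> e div 2 \<and> effective c \<and> effective (e - c)}"
  then obtain c where c: "A = drop_set n \<alpha> e c" "1 \<le> c" "c \<le> e div 2" "effective c" "effective (e - c)" by blast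
  then have "A = carry c (e - c)" "c < e" by (auto simp: carry_def)
  then show "A \<in> below e e" unfolding below_def using c by auto
next
  fix A assume "A \<in> below e e"
  then obtain c where c: "A = carry c (e - c)" "1 \<le> c" "c < e" "effective c" "effective (e - c)"
    unfolding below_def by blast
  show "A \<in> {drop_set n \<alpha> e c | c. 1 \<le> c \<and> c \<le> e div 2 \<and> effective c \<and> effective (e - c)}"
  proof (cases "c \<le> e div 2")
    case True
    then have "A = drop_set n \<alpha> e c" using c by (simp add: carry_def)
    then show ?thesis using c True by blast
  next
    case False
    have "A = drop_set n \<alpha> e (e - c)" "e - (e - c) = c"
      using c carry_def[of "e - c" c] by (simp_all add: carry_commute[of c])
    then show ?thesis using c False by (intro CollectI exI[of _ "e - c"]) auto
  qed
qed

lemma weight_simps [simp]: "weight [] = 0" "weight (k # w) = deg k + weight w"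
  "weight (v @ w) = weight v + weight w"
  by (simp_all add: weight_def)

lemma weight_insort [simp]: "weight (insort k w) = deg k + weight w"
  by (induction w) auto

lemma weight_sort [simp]: "weight (sort w) = weight w"
  by (induction w) auto

end

text \<open>The conditions on the choices, with \<open>below e e\<close> in place of
  \<open>drop_family\<close> and \<open>effective\<close> in place of nonzero pieces, so that the
  field disappears from them.\<close>

locale stable_choices = stable_data +
  assumes n2: "2 \<le> n" and n4: "n \<le> 4"
    and finite_degrees: "finite (generator_degrees ms)"
    and stable: "\<And>e. e \<ge> 1 \<Longrightarrow> effective e \<Longrightarrow>
      \<exists>F. reduces_to (rk e) (below e e) F \<and> stable_monomials n (rk e) F (ms e)"
    and no_sections: "\<And>e. e \<ge> 1 \<Longrightarrow> \<not> effective e \<Longrightarrow> ms e = []"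
begin

text \<open>The letters of one degree form a contiguous block; it is found by splitting the sorted
  list of degrees at e, and b is the offset of k in it.\<close>

lemma letters_block:
  assumes "k < N"
  defines "e \<equiv> deg k" and "b \<equiv> letter_pos k"
  shows "e \<ge> 1" "effective e" "b < length (ms e)" "letter_exp k = ms e ! b"
    "{l. l < N \<and> deg l < e} \<subseteq> {..<k}"
    "\<And>l. l < k \<Longrightarrow> deg l < e \<or> deg l = e \<and> (\<exists>b'<b. letter_exp l = ms e ! b')"
    "\<And>b'. b' < b \<Longrightarrow> \<exists>l<k. deg l = e \<and> letter_exp l = ms e ! b'"
proof -
  let ?B = "\<lambda>e. map (Pair e) (ms e)"
  have "letters ! k \<in> set letters" using assms by simp
  then obtain e' where e': "e' \<in> generator_degrees ms" "letters ! k \<in> set (?B e')"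
    unfolding letters_def using finite_degrees by auto
  then have ee: "e = e'" by (auto simp: e_def deg_def)
  then have e: "e \<in> generator_degrees ms" "letters ! k \<in> set (?B e)" using e' by auto
  then show e1: "e \<ge> 1" by (auto simp: generator_degrees_def)
  show "effective e" using e no_sections[OF e1] by (auto simp: generator_degrees_def)
  have "e \<in> set (sorted_list_of_set (generator_degrees ms))" using e finite_degrees by simp
  then obtain xs ys where split: "sorted_list_of_set (generator_degrees ms) = xs @ e # ys"
    by (meson split_list)
  have "sorted_wrt (<) (xs @ e # ys)" unfolding split[symmetric] by simp
  then have lt: "\<And>x. x \<in> set xs \<Longrightarrow> x < e" "\<And>y. y \<in> set ys \<Longrightarrow> e < y" by (auto simp: sorted_wrt_append)
  define pre where "pre = concat (map ?B xs)"
  define post where "post = concat (map ?B ys)"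
  have L: "letters = pre @ ?B e @ post" unfolding letters_def split pre_def post_def by simp
  have pre: "fst x < e" if "x \<in> set pre" for x using that lt unfolding pre_def by auto
  have post: "e < fst x" if "x \<in> set post" for x using that lt unfolding post_def by auto
  have d1: "deg l < e" if "l < length pre" for l
    using that pre[OF nth_mem[OF that]] unfolding deg_def L by (simp add: nth_append)
  have d2: "deg (length pre + b') = e \<and> letter_exp (length pre + b') = ms e ! b'" if "b' < length (ms e)" for b'
    using that unfolding deg_def letter_exp_def L by (simp add: nth_append)
  have d3: "deg l > e" if "length pre + length (ms e) \<le> l" "l < N" for l
  proof -
    have "\<not> l - length pre < length (ms e)" "\<not> l < length pre" using that by linarith+
    then have "letters ! l = post ! (l - length pre - length (ms e))" unfolding L by (simp add: nth_append)
    moreover have "l - length pre - length (ms e) < length post" using that unfolding L by simp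
    ultimately show ?thesis unfolding deg_def using post[OF nth_mem] by simp
  qed
  have ke: "deg k = e" by (simp add: e_def)
  have k1: "length pre \<le> k" using d1[of k] ke by force
  have k2: "k < length pre + length (ms e)" using d3[of k] ke assms(1) by force
  have "{l. l < k \<and> deg l = deg k} = {length pre..<k}"
  proof (rule set_eqI)
    fix l
    show "l \<in> {l. l < k \<and> deg l = deg k} \<longleftrightarrow> l \<in> {length pre..<k}"
      using d1[of l] d2[of "l - length pre"] ke k2 by (cases "l < length pre") auto
  qed
  then have b: "b = k - length pre" unfolding b_def letter_pos_def by simp
  then have kb: "k = length pre + b" using k1 by simp
  show blt: "b < length (ms e)" using b k1 k2 by simp
  then show "letter_exp k = ms e ! b" using d2[of b] kb by simp
  show "{l. l < N \<and> deg l < e} \<subseteq> {..<k}"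
  proof
    fix l assume l: "l \<in> {l. l < N \<and> deg l < e}"
    have "l < length pre"
    proof (rule ccontr)
      assume nl: "\<not> l < length pre"
      show False
      proof (cases "l < length pre + length (ms e)")
        case True
        then have "l - length pre < length (ms e)" using nl by linarith
        then show False using l nl d2[of "l - length pre"] by simp
      next
        case False
        then show False using l d3[of l] by simp
      qed
    qed
    then show "l \<in> {..<k}" using k1 by simp
  qed
  show "deg l < e \<or> deg l = e \<and> (\<exists>b'<b. letter_exp l = ms e ! b')" if "l < k" for l
  proof (cases "l < length pre")
    case False
    then have "l - length pre < b" using that kb by simp
    then show ?thesis using d2[of "l - length pre"] False blt by (intro disjI2) auto
  qed (use d1 in auto)
  show "\<exists>l<k. deg l = e \<and> letter_exp l = ms e ! b'" if "b' < b" for b'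
    using d2[of b'] that blt kb by (intro exI[of _ "length pre + b'"]) auto
qed

lemma letter_exp_sum:
  assumes "e \<ge> 1" "effective e" "m \<in> set (ms e)"
  shows "(\<Sum>i=1..n. m i) = rk e"
proof -
  obtain F where "stable_monomials n (rk e) F (ms e)" using stable assms by blast
  then show ?thesis
  proof cases
    case (none j k)
    have "m \<in> (\<lambda>i. (\<lambda>_. 0)(j := rk e - i, k := i)) ` set [0..<rk e + 1]"
      using assms(3) unfolding none(2) set_map .
    then obtain i where "i \<in> set [0..<rk e + 1]"
      and m: "m = (\<lambda>_. 0)(j := rk e - i, k := i)" by (rule imageE)
    then have i: "i \<le> rk e" by auto
    have "(\<Sum>x=1..n. m x) = (\<Sum>x\<in>{j, k}. m x)"
      by (rule sum.mono_neutral_right) (use none m in auto)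
    then show ?thesis using none i m by simp
  qed (use assms(3) in \<open>auto simp: has_exponents_def\<close>)
qed

section \<open>Exponents of the chosen monomials and kinds of generators\<close>

lemma has_exponents_nth:
  assumes "has_exponents n r j es qs"
  shows "length qs = length es" "\<And>b. b < length es \<Longrightarrow> (qs ! b) j = es ! b"
proof -
  have es: "es = map (\<lambda>m. m j) qs" using assms by (simp add: has_exponents_def)
  show "length qs = length es" by (simp add: es)
  show "(qs ! b) j = es ! b" if "b < length es" for b using that by (simp add: es)
qed

lemma descending_nth: "b < c - 1 \<Longrightarrow> c \<le> r + 1 \<Longrightarrow> rev [r + 2 - c..<r + 1] ! b = r - b"
  by (simp add: rev_nth del: upt_Suc)

lemma stable_monomials_one:
  assumes irr: "irreducible_family n r {A}" and j: "j \<in> A"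
    and ex: "has_exponents n r j (rev [r + 2 - card A..<r + 1] @ [0]) qs"
  shows "A \<subseteq> {1..n}" "card A \<le> r" "1 \<le> card A" "j \<in> {1..n}" "length qs = card A"
    "\<And>b. b < card A - 1 \<Longrightarrow> (qs ! b) j = r - b" "(qs ! (card A - 1)) j = 0"
proof -
  show sub: "A \<subseteq> {1..n}" using irr unfolding irreducible_family_def by blast
  show le: "card A \<le> r" using irreducible_family_card_le[OF irr] by blast
  have "finite A" using sub finite_subset by blast
  then have "card A \<noteq> 0" using j by auto
  then show ge: "1 \<le> card A" by simp
  show "j \<in> {1..n}" using j sub by blast
  note ne = has_exponents_nth[OF ex]
  show "length qs = card A" using ne(1) le ge by (simp del: upt_Suc)
  show "(qs ! b) j = r - b" if "b < card A - 1" for b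
    using ne(2)[of b] that le descending_nth[of b "card A" r] by (simp add: nth_append del: upt_Suc)
  show "(qs ! (card A - 1)) j = 0" using ne(2)[of "card A - 1"] le ge by (simp add: nth_append del: upt_Suc)
qed

lemma stable_monomials_two:
  assumes irr: "irreducible_family n r {A, B}" and AB: "A \<noteq> B" "j \<in> A - B"
    and ex: "has_exponents n r j (rev [r + 2 - card A..<r + 1]) qs"
  shows "r = 2" "card A = 2" "card B = 2" "A \<subseteq> {1..n}" "B \<subseteq> {1..n}" "j \<in> {1..n}" "length qs = 1" "(qs ! 0) j = 2"
proof -
  show r: "r = 2" "card A = 2" "card B = 2" using irreducible_family_pair[OF irr n4 _ _ AB(1)] by blast+
  show sub: "A \<subseteq> {1..n}" "B \<subseteq> {1..n}" using irr unfolding irreducible_family_def by blast+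
  show "j \<in> {1..n}" using AB sub by blast
  have es: "rev [r + 2 - card A..<r + 1] = [2]" unfolding r by (simp add: upt_rec)
  note ne = has_exponents_nth[OF ex, unfolded es]
  show "length qs = 1" "(qs ! 0) j = 2" using ne(1) ne(2)[of 0] by simp_all
qed

text \<open>With exponent r - b at j, position b = 0 is a pure power and any later one has s = r + 1
  - b. In the case of two sets, n \<le> 4 leaves a single monomial, with exponent 2 at j in O(2), so
  it is pure.\<close>

lemma has_kind_exists:
  assumes e: "e \<ge> 1" "effective e" and b: "b < length (ms e)"
  shows "\<exists>\<kappa>. has_kind e b \<kappa>"
proof -
  let ?r = "rk e"
  obtain F where red: "reduces_to ?r (below e e) F" and st: "stable_monomials n ?r F (ms e)"
    using stable e by blast
  have irr: "irreducible_family n ?r F" using reduces_to_irreducible[OF red below_subset] .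
  \<comment> \<open>The exponents add up to r, so exponent r at j leaves nothing for the other
    points.\<close>
  have pure: "has_kind e 0 (Pure j)" if j: "j \<in> {1..n}" "(ms e ! 0) j = ?r" and b0: "0 < length (ms e)" for j
  proof -
    have "(\<Sum>i=1..n. (ms e ! 0) i) = ?r" using letter_exp_sum[OF e] b0 by simp
    moreover have "(\<Sum>i=1..n. (ms e ! 0) i) = (ms e ! 0) j + (\<Sum>i\<in>{1..n} - {j}. (ms e ! 0) i)"
      using j by (intro sum.remove) auto
    ultimately have "(\<Sum>i\<in>{1..n} - {j}. (ms e ! 0) i) = 0" using j by simp
    then show ?thesis using j by auto
  qed
  show ?thesis
    using st
  proof cases
    case (none j k)
    have nth: "(ms e ! b') j = ?r - b'" if "b' \<le> ?r" for b'
      using that none(2,5) by (simp add: nth_append del: upt_Suc)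
    have br: "b \<le> ?r" using b none(2) by simp
    show ?thesis
    proof (cases "b = 0")
      case True
      then have "has_kind e b (Pure j)" using pure[OF none(3)] nth[of 0] b by simp
      then show ?thesis ..
    next
      case False
      then have "has_kind e b (Tangent j (?r + 1 - b))" using nth none(3) br by auto
      then show ?thesis ..
    qed
  next
    case one_empty
    then show ?thesis using b by simp
  next
    case (one j A)
    note o = stable_monomials_one[OF irr[unfolded one(1)] one(2,3)]
    show ?thesis
    \<comment> \<open>For |A| = 1 this already applies to b = 0: the only generator then has
      exponent 0 at j.\<close>
    proof (cases "b = card A - 1")
      case True
      then have "has_kind e b (Tangent j 1)" using o one red by auto
      then show ?thesis ..
    next
      case False
      then have b': "b < card A - 1" using b o(5) by simp
      show ?thesis
      proof (cases "b = 0")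
        case True
        then have "has_kind e b (Pure j)" using pure[OF o(4)] o(6)[of 0] b' b by simp
        then show ?thesis ..
      next
        case False
        then have "has_kind e b (Tangent j (?r + 1 - b))" using o b' by auto
        then show ?thesis ..
      qed
    qed
  next
    case (two A B j)
    note o = stable_monomials_two[OF irr[unfolded two(1)] two(2,4,5)]
    have "has_kind e b (Pure j)" using pure[OF o(6)] o(1,7,8) b by simp
    then show ?thesis ..
  qed
qed

text \<open>Kinds need not be unique: a constant, for instance, is \<open>Pure j\<close> for every
  j. The choice depends on stable data only.\<close>

definition kind_of :: "nat \<Rightarrow> letter_kind" where
  "kind_of k = (SOME \<kappa>. has_kind (deg k) (letter_pos k) \<kappa>)"

lemma kind_of: "k < N \<Longrightarrow> has_kind (deg k) (letter_pos k) (kind_of k)"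
  unfolding kind_of_def by (rule someI_ex) (intro has_kind_exists letters_block(1-3))

end

subsection \<open>Generation of the canonical ring\<close>

locale stable_ring = stable_choices n \<alpha> ms + marked_line n P t
  for n \<alpha> ms and P :: "nat \<Rightarrow> 'k::field closed_point" and t
begin

text \<open>The factor by which multiplication in the trivialised ring differs from that of
  polynomials; see \<open>triv_mult\<close>.\<close>

definition twist :: "nat \<Rightarrow> nat \<Rightarrow> 'k poly" where
  "twist c d = tset (carry c d)"

definition gen :: "nat \<Rightarrow> 'k poly" where
  "gen k = tmono (letter_exp k)"

text \<open>The product of the letters after division by \<open>triv (weight w)\<close> and the
  power of u, as confirmed by \<open>word_evaluation\<close>. Words need not be sorted here.\<close>

fun word_value :: "nat list \<Rightarrow> 'k poly" where
  "word_value [] = 1"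
| "word_value (k # w) = gen k * word_value w * twist (deg k) (weight w)"

definition words :: "nat \<Rightarrow> nat list set" where
  "words d = {w. set w \<subseteq> {..<N} \<and> weight w = d}"

abbreviation piece :: "nat \<Rightarrow> 'k poly set" where
  "piece d \<equiv> sections (rk d)"

abbreviation word_span :: "nat \<Rightarrow> 'k poly set" where
  "word_span d \<equiv> lin.span (word_value ` words d)"

definition ideal_part :: "nat set \<Rightarrow> nat \<Rightarrow> 'k poly set" where
  "ideal_part L d = lin.span (\<Union>l\<in>{l\<in>L. deg l \<le> d \<and> effective (d - deg l)}.
     (\<lambda>h. gen l * h * twist (deg l) (d - deg l)) ` piece (d - deg l))"

lemma twist_0 [simp]: "twist 0 d = 1" "twist d 0 = 1"
  by (simp_all add: twist_def tset_def)

lemma twist_commute: "twist c d = twist d c"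
  by (simp add: twist_def carry_commute)

lemma tset_eq_prod:
  assumes "A \<subseteq> {1..n}"
  shows "tset A = (\<Prod>i=1..n. t i ^ of_bool (i \<in> A))"
proof -
  have "(\<Prod>i=1..n. t i ^ of_bool (i \<in> A)) = (\<Prod>i\<in>{1..n}. if i \<in> A then t i else 1)"
    by (rule prod.cong) auto
  also have "\<dots> = (\<Prod>i\<in>{1..n} \<inter> A. t i)" by (rule prod.inter_restrict[symmetric]) simp
  also have "{1..n} \<inter> A = A" using assms by blast
  finally show ?thesis by (simp add: tset_def)
qed

text \<open>Associativity of the twisted product, from the cocycle identity at each marked
  point.\<close>

lemma twist_assoc: "twist a b * twist (a + b) c = twist b c * twist a (b + c)"
  unfolding twist_def tset_eq_prod[OF carry_subset] prod.distrib[symmetric] power_add[symmetric]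
  by (rule prod.cong) (simp_all add: carry_assoc)

lemma twist_sections: "twist c d \<in> sections (card (carry c d))"
  unfolding twist_def by (rule tset_sections[OF carry_subset])

lemma ev_twist: "i \<in> {1..n} \<Longrightarrow> ev i (card (carry c d)) (twist c d) = 0 \<longleftrightarrow> i \<in> carry c d"
  unfolding twist_def by (rule ev_tset[OF carry_subset])

lemma twist_nonzero: "twist c d \<noteq> 0"
  unfolding twist_def by (rule tset_nonzero[OF carry_subset])

lemma mult_twist_sections:
  assumes "effective c" "effective d" "f \<in> piece c" "h \<in> piece d"
  shows "f * h * twist c d \<in> piece (c + d)"
  unfolding rk_add[OF assms(1,2)] by (intro sections_mult assms twist_sections)

lemma letter_facts:
  assumes k: "k < N"
  shows "deg k \<ge> 1" "effective (deg k)" "letter_exp k \<in> set (ms (deg k))"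
    "(\<Sum>i=1..n. letter_exp k i) = rk (deg k)" "gen k \<in> piece (deg k)"
    "\<And>i. i \<in> {1..n} \<Longrightarrow> ev i (rk (deg k)) (gen k) = 0 \<longleftrightarrow> letter_exp k i > 0"
proof -
  show 1: "deg k \<ge> 1" "effective (deg k)" using letters_block[OF k] by simp_all
  show 2: "letter_exp k \<in> set (ms (deg k))" using letters_block(3,4)[OF k] by simp
  show 3: "(\<Sum>i=1..n. letter_exp k i) = rk (deg k)" using letter_exp_sum[OF 1 2] .
  show "gen k \<in> piece (deg k)" using tmono_sections[of "letter_exp k"] 3 by (simp add: gen_def)
  show "ev i (rk (deg k)) (gen k) = 0 \<longleftrightarrow> letter_exp k i > 0" if "i \<in> {1..n}" for i
    using ev_tmono[OF that, of "letter_exp k"] 3 by (simp add: gen_def)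
qed

lemma word_value_sections:
  "set w \<subseteq> {..<N} \<Longrightarrow> effective (weight w) \<and> word_value w \<in> piece (weight w)"
proof (induction w)
  case (Cons k w)
  then show ?case using letter_facts[of k] by (auto intro: effective_add mult_twist_sections)
qed auto

lemma word_value_append:
  "word_value (v @ w) = word_value v * word_value w * twist (weight v) (weight w)"
proof (induction v)
  case (Cons k v)
  have "word_value ((k # v) @ w) = gen k * word_value v * word_value w *
    (twist (weight v) (weight w) * twist (deg k) (weight v + weight w))"
    using Cons by (simp add: mult_ac)
  then show ?case unfolding twist_assoc[symmetric] by (simp add: mult_ac)
qed simp

text \<open>Commutativity of the twisted product. It makes the value of a word depend on its
  multiset of letters only.\<close>

lemma word_value_swap: "word_value (k # l # w) = word_value (l # k # w)"
proof -
  let ?a = "deg k" and ?b = "deg l" and ?c = "weight w"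
  have "twist ?b ?c * twist ?a (?b + ?c) = twist ?a ?c * twist ?b (?a + ?c)"
    using twist_assoc[of ?a ?b ?c] twist_assoc[of ?b ?a ?c] twist_commute[of ?a ?b] by (simp add: add.commute)
  then have "gen k * gen l * word_value w * (twist ?b ?c * twist ?a (?b + ?c)) =
    gen k * gen l * word_value w * (twist ?a ?c * twist ?b (?a + ?c))" by simp
  then show ?thesis by (simp add: mult_ac)
qed

lemma word_value_insort: "word_value (insort k w) = word_value (k # w)"
proof (induction w)
  case (Cons x w)
  show ?case
  proof (cases "k \<le> x")
    case False
    then have "word_value (insort k (x # w)) = gen x * word_value (k # w) * twist (deg x) (deg k + weight w)"
      using Cons by simp
    also have "\<dots> = word_value (x # k # w)" by simp
    finally show ?thesis using word_value_swap by metis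
  qed simp
qed simp

lemma word_value_sort: "word_value (sort w) = word_value w"
  by (induction w) (simp_all add: word_value_insort)

section \<open>Products of section spaces and flags at a marked point\<close>

lemma span_image_mult_subset:
  assumes "\<And>x. x \<in> X \<Longrightarrow> x * c \<in> Y" and "lin.subspace Y" and "x \<in> lin.span X"
  shows "x * c \<in> Y"
proof -
  have "lin.span X \<subseteq> {x. x * c \<in> Y}"
    using assms(1,2) by (intro lin.span_minimal) (auto simp: lin.subspace_def algebra_simps)
  then show ?thesis using assms(3) by auto
qed

text \<open>Surjectivity of multiplication H^0(O(a)) \<otimes> H^0(O(b)) \<rightarrow> H^0(O(a+b)),
  checked on powers of the coordinate by splitting the exponent i at min(i, a).\<close>

lemma sections_add_subset:
  "sections (a + b) \<subseteq> lin.span {f * h | f h. f \<in> sections a \<and> h \<in> (sections b :: 'k poly set)}"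
proof
  fix y :: "'k poly" assume y: "y \<in> sections (a + b)"
  let ?X = "{f * h | f h. f \<in> sections a \<and> h \<in> (sections b :: 'k poly set)}"
  have mon: "monom c i \<in> lin.span ?X" if i: "i \<le> a + b" for i and c :: 'k
  proof -
    have "monom c i = monom c (min i a) * monom 1 (i - min i a)"
      by (simp add: mult_monom)
    moreover have "monom c (min i a) \<in> sections a" "(monom 1 (i - min i a) :: 'k poly) \<in> sections b"
      using i by (auto simp: sections_def intro!: degree_monom_le[THEN order_trans])
    ultimately have "monom c i \<in> ?X" by blast
    then show ?thesis by (rule lin.span_base)
  qed
  have "y = (\<Sum>i\<le>degree y. monom (coeff y i) i)" by (simp add: poly_as_sum_of_monoms)
  also have "\<dots> \<in> lin.span ?X"
    using y by (intro lin.span_sum mon) (auto simp: sections_def)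
  finally show "y \<in> lin.span ?X" .
qed

text \<open>S_c S_d is the whole space of sections vanishing on \<open>carry c d\<close>: divide by
  the twist and write the quotient as a sum of products.\<close>

lemma vanishing_carry_subset:
  assumes "effective c" "effective d" and X: "lin.subspace X"
    and prod: "\<And>f h. f \<in> piece c \<Longrightarrow> h \<in> piece d \<Longrightarrow> f * h * twist c d \<in> X"
  shows "vanishing (rk (c + d)) (carry c d) \<subseteq> X"
proof
  fix x assume x: "x \<in> vanishing (rk (c + d)) (carry c d)"
  show "x \<in> X"
  proof (cases "x = 0")
    case True
    then show ?thesis using X by (simp add: lin.subspace_0)
  next
    case False
    obtain y where y: "y \<in> sections (rk c + rk d)" "x = tset (carry c d) * y"
      using vanishing_factor[OF carry_subset x False] unfolding rk_add[OF assms(1,2)] by auto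
    have "y \<in> lin.span {f * h | f h. f \<in> piece c \<and> h \<in> piece d}"
      using sections_add_subset y(1) by blast
    moreover have "z * twist c d \<in> X" if "z \<in> {f * h | f h. f \<in> piece c \<and> h \<in> piece d}" for z
      using that prod by blast
    ultimately have "y * twist c d \<in> X" using span_image_mult_subset[OF _ X] by blast
    then show ?thesis using y by (simp add: twist_def mult.commute)
  qed
qed

lemma mult_twist_vanishing:
  assumes "effective c" "effective d" "f \<in> piece c" "h \<in> piece d"
  shows "f * h * twist c d \<in> vanishing (rk (c + d)) (carry c d)"
proof -
  have "ev i (rk (c + d)) (f * h * twist c d) = 0" if "i \<in> carry c d" for i
  proof -
    have i: "i \<in> {1..n}" using that carry_subset by blast
    have "ev i (rk c + rk d + card (carry c d)) (f * h * twist c d) =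
      ev i (rk c + rk d) (f * h) * ev i (card (carry c d)) (twist c d)"
      by (rule section_value_mult[OF sections_mult[OF assms(3,4)] twist_sections])
    then show ?thesis using ev_twist[OF i] that rk_add[OF assms(1,2)] by simp
  qed
  then show ?thesis using mult_twist_sections[OF assms] by (simp add: vanishing_def)
qed

lemma tmono_split:
  assumes j: "j \<in> {1..n}" and s: "s \<le> c j"
  shows "\<exists>u\<in>sections ((\<Sum>i=1..n. c i) - s). tmono c = t j ^ s * u \<and>
    (ev j ((\<Sum>i=1..n. c i) - s) u = 0 \<longleftrightarrow> s < c j)"
proof -
  let ?c = "c(j := c j - s)"
  have "(\<Sum>i=1..n. c i) = c j + (\<Sum>i\<in>{1..n} - {j}. c i)" using j by (intro sum.remove) auto
  moreover have "(\<Sum>i=1..n. ?c i) = ?c j + (\<Sum>i\<in>{1..n} - {j}. ?c i)" using j by (intro sum.remove) auto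
  moreover have "(\<Sum>i\<in>{1..n} - {j}. ?c i) = (\<Sum>i\<in>{1..n} - {j}. c i)" by (intro sum.cong) auto
  ultimately have sum: "(\<Sum>i=1..n. ?c i) = (\<Sum>i=1..n. c i) - s" using s by simp
  have "tmono c = t j ^ c j * (\<Prod>i\<in>{1..n} - {j}. t i ^ c i)" unfolding tmono_def using j by (intro prod.remove) auto
  moreover have "tmono ?c = t j ^ ?c j * (\<Prod>i\<in>{1..n} - {j}. t i ^ ?c i)" unfolding tmono_def using j by (intro prod.remove) auto
  moreover have "(\<Prod>i\<in>{1..n} - {j}. t i ^ ?c i) = (\<Prod>i\<in>{1..n} - {j}. t i ^ c i)" by (intro prod.cong) auto
  moreover have "t j ^ c j = t j ^ s * t j ^ (c j - s)" using s by (simp flip: power_add)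
  ultimately have "tmono c = t j ^ s * tmono ?c" by (simp add: mult_ac)
  moreover have "tmono ?c \<in> sections ((\<Sum>i=1..n. c i) - s)" using tmono_sections[of ?c] unfolding sum .
  moreover have "ev j ((\<Sum>i=1..n. c i) - s) (tmono ?c) = 0 \<longleftrightarrow> s < c j" using ev_tmono[OF j, of ?c] unfolding sum by simp
  ultimately show ?thesis by blast
qed

text \<open>Vanishing at one point is a condition of codimension one, so any u nonzero there spans a
  complement.\<close>

lemma sections_reduce:
  assumes j: "j \<in> {1..n}" and u: "u \<in> sections r" "ev j r u \<noteq> 0" and f: "f \<in> sections r"
  obtains c where "f - smult c u \<in> vanishing r {j}"
proof -
  have "f - smult (ev j r f / ev j r u) u \<in> vanishing r {j}"
    using u f by (auto simp: vanishing_def)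
  then show thesis using that by blast
qed

lemma vanishing_point:
  assumes "j \<in> {1..n}" "f \<in> vanishing r {j}"
  shows "f = 0 \<or> r > 0 \<and> (\<exists>h\<in>sections (r - 1). f = t j * h)"
  using vanishing_factor[of "{j}" f r] assms by (auto simp: tset_def)

text \<open>A triangular system: the b-th monomial vanishes at \<open>P j\<close> to order exactly r
  - b, so the first B of them span all multiples of t_j^(r-B+1) in O(r).\<close>

lemma flag_span:
  assumes j: "j \<in> {1..n}" and q: "\<And>b. b < B \<Longrightarrow> (\<Sum>i=1..n. q b i) = r \<and> q b j = r - b"
    and "1 \<le> B" "B \<le> Suc r" and y: "y \<in> sections (B - 1)"
  shows "t j ^ (r - (B - 1)) * y \<in> lin.span ((\<lambda>b. tmono (q b)) ` {..<B})"
  using assms(3) y \<open>B \<le> Suc r\<close> q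
proof (induction B arbitrary: y rule: nat_induct_at_least)
  case base
  obtain u where u: "u \<in> sections 0" "tmono (q 0) = t j ^ r * u" "ev j 0 u \<noteq> 0"
    using tmono_split[OF j, of r "q 0"] base(3)[of 0] by auto
  obtain c d where cd: "y = [:c:]" "u = [:d:]" using base(1) u(1) by (auto elim!: sections_zeroE)
  have "d \<noteq> 0" using u(3) cd by (auto simp: section_value_const)
  then have "t j ^ r * y = smult (c / d) (tmono (q 0))" unfolding u(2) cd by simp
  moreover have "tmono (q 0) \<in> (\<lambda>b. tmono (q b)) ` {..<1}" by (rule imageI) simp
  then have "smult (c / d) (tmono (q 0)) \<in> lin.span ((\<lambda>b. tmono (q b)) ` {..<1})"
    by (intro lin.span_scale lin.span_base)
  ultimately show ?case by (simp only: diff_self_eq_0 minus_nat.diff_0)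
next
  case (Suc B)
  let ?S = "lin.span ((\<lambda>b. tmono (q b)) ` {..<Suc B})"
  have Br: "B \<le> r" "1 \<le> B" using Suc by auto
  obtain u where u: "u \<in> sections B" "tmono (q B) = t j ^ (r - B) * u" "ev j B u \<noteq> 0"
    using tmono_split[OF j, of "r - B" "q B"] Suc.prems(3)[of B] Br by auto
  have y: "y \<in> sections B" using Suc.prems by simp
  \<comment> \<open>Cancelling the value of the cofactor at \<open>P j\<close> leaves a multiple of
    the next higher power of t_j, to which the induction hypothesis applies.\<close>
  obtain c where c: "y - smult c u \<in> vanishing B {j}" using sections_reduce[OF j u(1,3) y] .
  obtain h where h: "h \<in> sections (B - 1)" "y - smult c u = t j * h"
  proof (cases "y - smult c u = 0")
    case True
    then show ?thesis using that[of 0] by auto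
  qed (use vanishing_point[OF j c] that in blast)
  have "t j ^ (r - (B - 1)) * h \<in> lin.span ((\<lambda>b. tmono (q b)) ` {..<B})"
    using h Br Suc.prems by (intro Suc.IH) auto
  then have "t j ^ (r - (B - 1)) * h \<in> ?S"
    by (rule subsetD[OF lin.span_mono, rotated]) auto
  moreover have "smult c (tmono (q B)) \<in> ?S" by (intro lin.span_scale lin.span_base) auto
  ultimately have "smult c (tmono (q B)) + t j ^ (r - (B - 1)) * h \<in> ?S" by (intro lin.span_add)
  moreover have "t j ^ (r - B) * y = smult c (tmono (q B)) + t j ^ (r - (B - 1)) * h"
  proof -
    have "r - (B - 1) = Suc (r - B)" using Br by simp
    then have "t j ^ (r - (B - 1)) * h = t j ^ (r - B) * (y - smult c u)" unfolding h(2) by (simp add: mult_ac)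
    then show ?thesis unfolding u(2) by (simp add: algebra_simps)
  qed
  ultimately show ?case by simp
qed

text \<open>Every section vanishing at \<open>P j\<close> is in V_A up to a multiple of
  t_j^(r-|A|+2). The cofactor has degree |A| - 2, just enough to match f at the |A| - 1 other points
  of A, where the power of t_j is nonzero.\<close>

lemma tangent_fill:
  assumes A: "A \<subseteq> {1..n}" "j \<in> A" "card A \<le> r" and B: "card A = Suc B" "1 \<le> B" and f: "f \<in> vanishing r {j}"
  shows "\<exists>y\<in>sections (B - 1). f - t j ^ (r - (B - 1)) * y \<in> vanishing r A"
proof -
  define s where "s = r - (B - 1)"
  have s: "r = s + (B - 1)" "s > 0" using A B unfolding s_def by auto
  have j: "j \<in> {1..n}" using A by blast
  have finA: "finite A" using A finite_subset by blast
  obtain y where y: "y \<in> sections (B - 1)" "\<forall>i\<in>A - {j}. ev i (B - 1) y = ev i r f / ev i s (t j ^ s)"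
    using interpolation[of "A - {j}" "B - 1" "\<lambda>i. ev i r f / ev i s (t j ^ s)"] A B finA by auto
  have "ev i r (f - t j ^ s * y) = 0" if i: "i \<in> A" for i
  proof -
    have i': "i \<in> {1..n}" using i A by blast
    have ts: "t j ^ s \<in> sections s" "ev i s (t j ^ s) = 0 \<longleftrightarrow> i = j"
      using t_power[OF i' j, of s] s by auto
    have e: "ev i r (t j ^ s * y) = ev i s (t j ^ s) * ev i (B - 1) y" by (rule ev_mult[OF ts(1) y(1) s(1)])
    show ?thesis
    proof (cases "i = j")
      case True
      then show ?thesis using e ts f by (simp add: vanishing_def)
    next
      case False
      then show ?thesis using e ts y(2) i by simp
    qed
  qed
  moreover have "f - t j ^ s * y \<in> sections r"
    using f sections_mult[OF conjunct1[OF t_power[OF j j, of s]] y(1)] s(1) by (auto simp: vanishing_def)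
  ultimately show ?thesis using y(1) unfolding s_def by (auto simp: vanishing_def)
qed

text \<open>Without sets the monomials form a full flag. For one set, the last monomial is nonzero
  at \<open>P j\<close>, and the sections vanishing there come from V_A and the remaining flag. For
  two sets, V_A, V_B and the single monomial fill O(2).\<close>

lemma generators_span:
  assumes e: "e \<ge> 1" "effective e"
  shows "piece e \<subseteq> lin.span (family_span (rk e) (below e e) \<union> tmono ` set (ms e))"
    (is "_ \<subseteq> ?X")
proof
  fix f :: "'k poly" assume f: "f \<in> piece e"
  let ?r = "rk e"
  obtain F where red: "reduces_to ?r (below e e) F" and st: "stable_monomials n ?r F (ms e)"
    using stable e by blast
  have irr: "irreducible_family n ?r F" using reduces_to_irreducible[OF red below_subset] .
  have FS: "family_span ?r F = family_span ?r (below e e)" using family_span_reduces_to[OF red below_subset] .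
  have base: "x \<in> ?X" if "A \<in> F" "x \<in> vanishing ?r A" for x A
    using that vanishing_subset_family_span[of A F ?r] FS by (intro lin.span_base) auto
  have baseg: "tmono (ms e ! b) \<in> ?X" if "b < length (ms e)" for b
    using that by (intro lin.span_base) auto
  have sum: "(\<Sum>i=1..n. (ms e ! b) i) = ?r" if "b < length (ms e)" for b
    using letter_exp_sum[OF e] that by simp
  show "f \<in> ?X"
    using st
  proof cases
    case (none j k)
    have len: "length (ms e) = Suc ?r" using none(2) by simp
    have nth: "(ms e ! b) j = ?r - b" if "b \<le> ?r" for b
      using that none(2,5) by (simp add: nth_append del: upt_Suc)
    have "t j ^ (?r - (Suc ?r - 1)) * f \<in> lin.span ((\<lambda>b. tmono (ms e ! b)) ` {..<Suc ?r})"
      by (rule flag_span[OF none(3)]) (use nth sum len f in auto)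
    also have "\<dots> \<subseteq> ?X" using len by (intro lin.span_mono) auto
    finally show ?thesis by simp
  next
    case one_empty
    then show ?thesis using base[of "{}" f] f by (auto simp: vanishing_def)
  next
    case (one j A)
    have AF: "A \<in> F" using one(1) by simp
    note o = stable_monomials_one[OF irr[unfolded one(1)] one(2,3)]
    define q where "q = tmono (ms e ! (card A - 1))"
    have cA: "card A - 1 < length (ms e)" using o(3,5) by simp
    have q: "q \<in> sections ?r" "ev j ?r q \<noteq> 0" "q \<in> ?X"
      using tmono_sections[of "ms e ! (card A - 1)"] ev_tmono[OF o(4), of "ms e ! (card A - 1)"]
        sum[OF cA] o(7) baseg[OF cA] unfolding q_def by auto
    obtain c where c: "f - smult c q \<in> vanishing ?r {j}" using sections_reduce[OF o(4) q(1,2) f] .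
    have "f - smult c q \<in> ?X"
    proof (cases "card A = 1")
      case True
      then have "A = {j}" using one(2) by (metis card_1_singletonE singletonD)
      then show ?thesis using c base[OF AF] by blast
    next
      case False
      define B where "B = card A - 1"
      have B: "card A = Suc B" "1 \<le> B" using o(3) False unfolding B_def by auto
      obtain y where y: "y \<in> sections (B - 1)" "f - smult c q - t j ^ (?r - (B - 1)) * y \<in> vanishing ?r A"
        using tangent_fill[OF o(1) one(2) o(2) B c] by blast
      have "t j ^ (?r - (B - 1)) * y \<in> lin.span ((\<lambda>b. tmono (ms e ! b)) ` {..<B})"
        by (rule flag_span[OF o(4)]) (use o sum y B in auto)
      also have "\<dots> \<subseteq> ?X" using o(5) B by (intro lin.span_mono) auto
      finally have "(f - smult c q - t j ^ (?r - (B - 1)) * y) + t j ^ (?r - (B - 1)) * y \<in> ?X"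
        using base[OF AF y(2)] by (intro lin.span_add)
      then show ?thesis by simp
    qed
    then have "(f - smult c q) + smult c q \<in> ?X" using q(3) by (intro lin.span_add lin.span_scale)
    then show ?thesis by simp
  next
    case (two A B j)
    have AF: "A \<in> F" "B \<in> F" using two(1) by simp_all
    note o = stable_monomials_two[OF irr[unfolded two(1)] two(2,4,5)]
    note r2 = o(1-3) and sub = o(4,5) and len = o(7) and ex = o(8)
    have j: "j \<in> {1..n}" "j \<in> A" "j \<notin> B" using o(6) two(4) by blast+
    have "card (A - {j}) = 1" using r2 j by simp
    then obtain k where k': "A - {j} = {k}" by (rule card_1_singletonE)
    then have k: "A = {j, k}" "k \<noteq> j" "k \<in> {1..n}" using j sub by auto
    define q where "q = tmono (ms e ! 0)"
    have sum0: "(\<Sum>i=1..n. (ms e ! 0) i) = 2" using sum[of 0] len r2 by simp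
    moreover have "(\<Sum>i=1..n. (ms e ! 0) i) = (ms e ! 0) j + (\<Sum>i\<in>{1..n} - {j}. (ms e ! 0) i)"
      using j by (intro sum.remove) auto
    ultimately have "(ms e ! 0) k = 0" using ex k by simp
    then have q: "q \<in> sections 2" "ev j 2 q = 0" "ev k 2 q \<noteq> 0" "q \<in> ?X"
      using tmono_sections[of "ms e ! 0"] ev_tmono[OF j(1), of "ms e ! 0"] ev_tmono[OF k(3), of "ms e ! 0"]
        sum0 ex baseg[of 0] len unfolding q_def by auto
    have tB: "tset B \<in> sections 2" "ev j 2 (tset B) \<noteq> 0" "tset B \<in> vanishing 2 B"
      using tset_sections[OF sub(2)] ev_tset[OF sub(2)] sub(2) j r2 by (auto simp: vanishing_def subset_iff)
    have tBX: "tset B \<in> ?X" using base[OF AF(2)] tB r2 by simp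
    have f2: "f \<in> sections 2" using f r2 by simp
    \<comment> \<open>With A = {j, k}, a multiple of \<open>tset B\<close> cancels the value at j;
      then a multiple of q cancels that at k without disturbing the first, since q vanishes at
      j.\<close>
    obtain b where b: "f - smult b (tset B) \<in> vanishing 2 {j}" using sections_reduce[OF j(1) tB(1,2) f2] .
    then have b': "f - smult b (tset B) \<in> sections 2" by (simp add: vanishing_def)
    obtain c where c: "f - smult b (tset B) - smult c q \<in> vanishing 2 {k}"
      using sections_reduce[OF k(3) q(1,3) b'] .
    have "f - smult b (tset B) - smult c q \<in> vanishing 2 A" using b c q(2) unfolding k(1) by (auto simp: vanishing_def)
    then have "f - smult b (tset B) - smult c q \<in> ?X" using base[OF AF(1)] r2 by simp
    then have "f - smult b (tset B) - smult c q + smult c q + smult b (tset B) \<in> ?X"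
      using q(4) tBX by (intro lin.span_add lin.span_scale)
    then show ?thesis by simp
  qed
qed

end

lemma (in stable_choices) letter_exists:
  assumes "e \<ge> 1" "m \<in> set (ms e)"
  shows "\<exists>k<N. deg k = e \<and> letter_exp k = m"
proof -
  have "e \<in> generator_degrees ms" using assms unfolding generator_degrees_def by auto
  then have "(e, m) \<in> set letters" using assms finite_degrees unfolding letters_def by auto
  then obtain k where "k < N" "letters ! k = (e, m)" by (auto simp: in_set_conv_nth)
  then show ?thesis by (auto simp: deg_def letter_exp_def)
qed

definition (in stable_choices) lower :: "nat \<Rightarrow> nat set" where
  "lower e = {l. l < N \<and> deg l < e}"

context stable_ring
begin

lemma words_mult:
  assumes f: "f \<in> word_span c" and h: "h \<in> word_span d"
  shows "f * (h * twist c d) \<in> word_span (c + d)"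
proof (rule span_image_mult_subset[OF _ lin.subspace_span f])
  fix x assume "x \<in> word_value ` words c"
  then obtain v where v: "v \<in> words c" "x = word_value v" by blast
  have "h * (word_value v * twist c d) \<in> word_span (c + d)"
  proof (rule span_image_mult_subset[OF _ lin.subspace_span h])
    fix y assume "y \<in> word_value ` words d"
    then obtain w where w: "w \<in> words d" "y = word_value w" by blast
    have "y * (word_value v * twist c d) = word_value (v @ w)"
      using v w by (simp add: word_value_append words_def mult_ac)
    moreover have "v @ w \<in> words (c + d)" using v w by (simp add: words_def)
    ultimately show "y * (word_value v * twist c d) \<in> word_span (c + d)"
      by (simp add: lin.span_base)
  qed
  then show "x * (h * twist c d) \<in> word_span (c + d)"
    unfolding v(2) by (simp add: mult_ac)
qed

text \<open>Induction on the degree: S_d is spanned by the generators of degree d and the products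
  S_c S_{d-c} with 0 < c < d. This is the generation of the ring by the chosen elements.\<close>

lemma sections_subset_words: "effective d \<Longrightarrow> piece d \<subseteq> word_span d"
proof (induction d rule: less_induct)
  case (less d)
  let ?X = "word_span d"
  show ?case
  proof (cases "d = 0")
    case True
    show ?thesis
    proof
      fix f :: "'k poly" assume "f \<in> piece d"
      then obtain c where c: "f = [:c:]" using True by (auto elim!: sections_zeroE)
      have "1 \<in> word_value ` words d" using True by (intro image_eqI[of _ _ "[]"]) (auto simp: words_def)
      then have "smult c 1 \<in> ?X" by (intro lin.span_scale lin.span_base)
      then show "f \<in> ?X" by (simp add: c)
    qed
  next
    case False
    then have d: "d \<ge> 1" by simp
    have "family_span (rk d) (below d d) \<subseteq> ?X"
    proof (rule family_span_least[OF lin.subspace_span])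
      fix A assume "A \<in> below d d"
      then obtain c where c: "A = carry c (d - c)" "1 \<le> c" "c < d" "effective c" "effective (d - c)"
        unfolding below_def by blast
      have "vanishing (rk (c + (d - c))) (carry c (d - c)) \<subseteq> ?X"
      proof (rule vanishing_carry_subset[OF c(4,5) lin.subspace_span])
        fix f h :: "'k poly" assume "f \<in> piece c" "h \<in> piece (d - c)"
        then have "f * (h * twist c (d - c)) \<in> word_span (c + (d - c))"
          using less.IH[of c] less.IH[of "d - c"] c by (intro words_mult) auto
        then show "f * h * twist c (d - c) \<in> ?X" using c(3) by (simp add: mult.assoc)
      qed
      then show "vanishing (rk d) A \<subseteq> ?X" using c by simp
    qed
    moreover have "tmono ` set (ms d) \<subseteq> ?X"
    proof
      fix x assume "x \<in> tmono ` set (ms d)"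
      then obtain k where k: "k < N" "deg k = d" "x = gen k"
        using letter_exists[OF d] unfolding gen_def by blast
      then have "x = word_value [k]" "[k] \<in> words d" by (simp_all add: words_def)
      then show "x \<in> ?X" by (simp add: lin.span_base del: word_value.simps)
    qed
    ultimately have "lin.span (family_span (rk d) (below d d) \<union> tmono ` set (ms d)) \<subseteq> ?X"
      by (intro lin.span_minimal) auto
    then show ?thesis using generators_span[OF d less.prems] by blast
  qed
qed

subsection \<open>Ideals generated by initial segments of the generators\<close>

lemma ideal_part_subspace: "lin.subspace (ideal_part L d)"
  by (simp add: ideal_part_def)

lemma ideal_part_base:
  assumes "l \<in> L" "deg l \<le> d" "effective (d - deg l)" "h \<in> piece (d - deg l)"
  shows "gen l * h * twist (deg l) (d - deg l) \<in> ideal_part L d"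
  unfolding ideal_part_def using assms by (intro lin.span_base) blast

lemma ideal_part_least:
  assumes "lin.subspace X"
    and "\<And>l h. l \<in> L \<Longrightarrow> deg l \<le> d \<Longrightarrow> effective (d - deg l) \<Longrightarrow>
      h \<in> piece (d - deg l) \<Longrightarrow> gen l * h * twist (deg l) (d - deg l) \<in> X"
  shows "ideal_part L d \<subseteq> X"
  unfolding ideal_part_def using assms by (intro lin.span_minimal) blast+

lemma ideal_part_mono: "L \<subseteq> L' \<Longrightarrow> ideal_part L d \<subseteq> ideal_part L' d"
  unfolding ideal_part_def by (rule lin.span_mono) blast

lemma ideal_part_mult:
  assumes x: "x \<in> ideal_part L d" and z: "z \<in> sections (rk d')" "effective d'"
  shows "x * (z * twist d d') \<in> ideal_part L (d + d')"
proof -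
  have "ideal_part L d \<subseteq> {x. x * (z * twist d d') \<in> ideal_part L (d + d')}"
  proof (rule ideal_part_least)
    show "lin.subspace {x. x * (z * twist d d') \<in> ideal_part L (d + d')}"
      using ideal_part_subspace[of L "d + d'"] by (auto simp: lin.subspace_def algebra_simps)
    fix l and h :: "'k poly" assume l: "l \<in> L" "deg l \<le> d" "effective (d - deg l)" and h: "h \<in> piece (d - deg l)"
    let ?e = "deg l" and ?c = "d - deg l"
    have dd: "d + d' - ?e = ?c + d'" "?e + ?c = d" using l by simp_all
    have "gen l * (h * z * twist ?c d') * twist ?e (d + d' - ?e) \<in> ideal_part L (d + d')"
    proof (rule ideal_part_base[OF l(1)])
      show "?e \<le> d + d'" using l(2) by simp
      show "effective (d + d' - ?e)" unfolding dd(1) by (rule effective_add[OF l(3) z(2)])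
      show "h * z * twist ?c d' \<in> piece (d + d' - ?e)"
        unfolding dd(1) by (rule mult_twist_sections[OF l(3) z(2) h z(1)])
    qed
    moreover have "gen l * (h * z * twist ?c d') * twist ?e (d + d' - ?e) =
      gen l * h * z * (twist ?c d' * twist ?e (?c + d'))" unfolding dd(1) by (simp only: mult_ac)
    ultimately show "gen l * h * twist ?e ?c \<in> {x. x * (z * twist d d') \<in> ideal_part L (d + d')}"
      unfolding twist_assoc[symmetric] dd(2) by (simp only: mem_Collect_eq mult_ac)
  qed
  then show ?thesis using x by blast
qed

text \<open>A word of positive weight c starts with some letter, and that letter has degree at most
  c < e.\<close>

lemma sections_subset_ideal_lower:
  assumes c: "1 \<le> c" "c < e" "effective c"
  shows "piece c \<subseteq> ideal_part (lower e) c"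
proof -
  have "word_value ` words c \<subseteq> ideal_part (lower e) c"
  proof
    fix x assume "x \<in> word_value ` words c"
    then obtain w where w: "w \<in> words c" "x = word_value w" by blast
    then obtain l v where lv: "w = l # v" using c by (cases w) (auto simp: words_def)
    have l: "l < N" "set v \<subseteq> {..<N}" "deg l + weight v = c"
      using w lv by (auto simp: words_def)
    then have "weight v = c - deg l" "deg l \<le> c" by simp_all
    moreover have "l \<in> lower e" using l c by (simp add: lower_def)
    ultimately show "x \<in> ideal_part (lower e) c"
      using ideal_part_base[of l "lower e" c "word_value v"] word_value_sections[OF l(2)] w lv by simp
  qed
  then have "word_span c \<subseteq> ideal_part (lower e) c"
    by (rule lin.span_minimal[OF _ ideal_part_subspace])
  then show ?thesis using sections_subset_words[OF c(3)] by blast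
qed

text \<open>The letters of degree below e generate the same ideal as S_1, ..., S_{e-1}, and each
  product S_c S_{d-c} is the space V of the corresponding carry set.\<close>

lemma ideal_part_lower: "ideal_part (lower e) d = family_span (rk d) (below e d)"
proof
  show "ideal_part (lower e) d \<subseteq> family_span (rk d) (below e d)"
  proof (rule ideal_part_least[OF family_span_subspace])
    fix l and h :: "'k poly" assume l: "l \<in> lower e" "deg l \<le> d" "effective (d - deg l)"
      and h: "h \<in> piece (d - deg l)"
    let ?c = "deg l"
    have lN: "l < N" "?c < e" using l by (auto simp: lower_def)
    note lf = letter_facts[OF lN(1)]
    have "gen l * h * twist ?c (d - ?c) \<in> vanishing (rk (?c + (d - ?c))) (carry ?c (d - ?c))"
      by (rule mult_twist_vanishing[OF lf(2) l(3) lf(5) h])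
    moreover have "carry ?c (d - ?c) \<in> below e d" unfolding below_def using lf l lN by blast
    ultimately show "gen l * h * twist ?c (d - ?c) \<in> family_span (rk d) (below e d)"
      using vanishing_subset_family_span[of "carry ?c (d - ?c)" "below e d" "rk d"] l(2) by auto
  qed
  show "family_span (rk d) (below e d) \<subseteq> ideal_part (lower e) d"
  proof (rule family_span_least[OF ideal_part_subspace])
    fix A assume "A \<in> below e d"
    then obtain c where c: "A = carry c (d - c)" "1 \<le> c" "c < e" "c \<le> d" "effective c" "effective (d - c)"
      unfolding below_def by blast
    have "vanishing (rk (c + (d - c))) (carry c (d - c)) \<subseteq> ideal_part (lower e) d"
    proof (rule vanishing_carry_subset[OF c(5,6) ideal_part_subspace])
      fix f h :: "'k poly" assume f: "f \<in> piece c" and h: "h \<in> piece (d - c)"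
      have "f \<in> ideal_part (lower e) c" using sections_subset_ideal_lower[OF c(2,3,5)] f by blast
      from ideal_part_mult[OF this h c(6)] show "f * h * twist c (d - c) \<in> ideal_part (lower e) d"
        using c(4) by (simp add: mult.assoc)
    qed
    then show "vanishing (rk d) A \<subseteq> ideal_part (lower e) d" using c by simp
  qed
qed

lemma ideal_part_first:
  assumes k: "k < N" and "letter_pos k = 0"
  shows "ideal_part {..<k} d = family_span (rk d) (below (deg k) d)"
proof -
  have "{..<k} = lower (deg k)"
    using letters_block(5)[OF k] letters_block(6)[OF k] assms unfolding lower_def by auto
  then show ?thesis by (simp add: ideal_part_lower)
qed

text \<open>The product of S_d with the subspace t_j^s H^0(O(\<open>rk e\<close> - s)) of S_e,
  written as one image thanks to \<open>sections_add_subset\<close>.\<close>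

definition tangent_part :: "nat \<Rightarrow> nat \<Rightarrow> nat \<Rightarrow> nat \<Rightarrow> 'k poly set" where
  "tangent_part e j s d = (\<lambda>h. h * (t j ^ s * twist e d)) ` sections (rk e - s + rk d)"

lemma tangent_part_subspace: "lin.subspace (tangent_part e j s d)"
  unfolding tangent_part_def by (rule mult_image_subspace[OF sections_subspace])

text \<open>Either the preceding monomials of the same degree are a flag reaching down to t_j^s, or
  s = 1 and \<open>tangent_fill\<close> combines a shorter flag with V_A, which comes from lower
  degrees.\<close>

lemma tangent_power_in_ideal:
  assumes k: "k < N" and kind: "has_kind (deg k) (letter_pos k) (Tangent j s)"
    and y: "y \<in> sections (rk (deg k) - s)"
  shows "t j ^ s * y \<in> ideal_part {..<k} (deg k)"
proof -
  let ?e = "deg k" and ?b = "letter_pos k"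
  let ?r = "rk ?e" and ?X = "ideal_part {..<k} ?e"
  note blk = letters_block[OF k]
  have kd: "j \<in> {1..n}" "1 \<le> s" "s \<le> ?r" "\<And>b'. b' < ?b \<Longrightarrow> (ms ?e ! b') j = ?r - b'"
    "?b = ?r + 1 - s \<or> s = 1 \<and> (\<exists>A. reduces_to ?r (below ?e ?e) {A} \<and> j \<in> A \<and> ?b = card A - 1)"
    using kind by auto
  have sum: "(\<Sum>i=1..n. (ms ?e ! b') i) = ?r" if "b' < ?b" for b'
    using letter_exp_sum[OF blk(1,2), of "ms ?e ! b'"] that blk(3) by simp
  have gens: "(\<lambda>b. tmono (ms ?e ! b)) ` {..<?b} \<subseteq> ?X"
  proof
    fix x assume "x \<in> (\<lambda>b. tmono (ms ?e ! b)) ` {..<?b}"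
    then obtain b' where "b' < ?b" "x = tmono (ms ?e ! b')" by blast
    then obtain l where l: "l < k" "deg l = ?e" "x = gen l" using blk(7) unfolding gen_def by metis
    have "gen l * 1 * twist ?e (?e - ?e) \<in> ?X"
      using ideal_part_base[of l "{..<k}" ?e 1] l by simp
    then show "x \<in> ?X" using l by simp
  qed
  then have span: "lin.span ((\<lambda>b. tmono (ms ?e ! b)) ` {..<?b}) \<subseteq> ?X"
    by (rule lin.span_minimal[OF _ ideal_part_subspace])
  have flag: "t j ^ (?r - (?b - 1)) * z \<in> ?X" if "1 \<le> ?b" "?b \<le> Suc ?r" "z \<in> sections (?b - 1)" for z
    using flag_span[OF kd(1), of ?b "\<lambda>b. ms ?e ! b" ?r z] that sum kd(4) span by blast
  show ?thesis
  proof (cases "?b = ?r + 1 - s")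
    case True
    then have "1 \<le> ?b" "?b \<le> Suc ?r" "?b - 1 = ?r - s" "?r - (?b - 1) = s" using kd by auto
    then show ?thesis using flag[of y] y by simp
  next
    case False
    then obtain A where s: "s = 1" and A: "reduces_to ?r (below ?e ?e) {A}" "j \<in> A" "?b = card A - 1" using kd(5) by blast
    have irr: "irreducible_family n ?r {A}" using reduces_to_irreducible[OF A(1) below_subset] .
    have sub: "A \<subseteq> {1..n}" "card A \<le> ?r" using irr irreducible_family_card_le[OF irr, of A]
      unfolding irreducible_family_def by blast+
    have "finite A" using sub(1) finite_subset by blast
    then have "card A \<noteq> 0" using A(2) by auto
    have vA: "vanishing ?r A \<subseteq> ?X"
    proof -
      have "vanishing ?r A = family_span ?r (below ?e ?e)" using family_span_reduces_to[OF A(1) below_subset] by simp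
      also have "\<dots> = ideal_part (lower ?e) ?e" by (simp add: ideal_part_lower)
      also have "\<dots> \<subseteq> ?X" using blk(5) by (intro ideal_part_mono) (simp add: lower_def)
      finally show ?thesis .
    qed
    have ts: "t j \<in> sections 1" "ev j 1 (t j) = 0" using t_sections[OF kd(1)] ev_t[OF kd(1) kd(1)] by simp_all
    have r: "?r = 1 + (?r - s)" using kd s by simp
    have f: "t j * y \<in> vanishing ?r {j}"
      using sections_mult[OF ts(1) y] ev_mult[OF ts(1) y r] ts(2) r by (simp add: vanishing_def)
    have "t j * y \<in> ?X"
    proof (cases "card A = 1")
      case True
      then have "A = {j}" using A(2) by (metis card_1_singletonE singletonD)
      then show ?thesis using f vA by blast
    next
      case False
      then have B: "card A = Suc ?b" "1 \<le> ?b" using A(3) \<open>card A \<noteq> 0\<close> by simp_all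
      obtain z where z: "z \<in> sections (?b - 1)" "t j * y - t j ^ (?r - (?b - 1)) * z \<in> vanishing ?r A"
        using tangent_fill[OF sub(1) A(2) sub(2) B f] by blast
      have "t j ^ (?r - (?b - 1)) * z \<in> ?X" using flag[OF B(2) _ z(1)] B sub by simp
      then have "(t j * y - t j ^ (?r - (?b - 1)) * z) + t j ^ (?r - (?b - 1)) * z \<in> ?X"
        using vA z(2) by (intro lin.subspace_add[OF ideal_part_subspace]) auto
      then show ?thesis by simp
    qed
    then show ?thesis using s by simp
  qed
qed

lemma ideal_part_tangent:
  assumes k: "k < N" and kind: "has_kind (deg k) (letter_pos k) (Tangent j s)"
    and d: "effective d"
  defines "e \<equiv> deg k"
  shows "ideal_part {..<k} (e + d) =
    lin.span (family_span (rk (e + d)) (below e (e + d)) \<union> tangent_part e j s d)"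
    (is "_ = ?X")
proof
  note blk = letters_block[OF k, folded e_def]
  have kd: "j \<in> {1..n}" "1 \<le> s" "s \<le> rk e" "\<And>b'. b' < letter_pos k \<Longrightarrow> (ms e ! b') j = rk e - b'"
    "letter_pos k = rk e + 1 - s \<or> s = 1 \<and> (\<exists>A. reduces_to (rk e) (below e e) {A} \<and> j \<in> A \<and> letter_pos k = card A - 1)"
    using kind unfolding e_def by auto
  \<comment> \<open>All predecessors of degree e are divisible by t_j^s. In the second alternative s
    = 1, and the exponent stays positive because |A| \<le> \<open>rk e\<close>.\<close>
  have pos: "rk e - b' \<ge> s" if "b' < letter_pos k" for b'
  proof (cases "letter_pos k = rk e + 1 - s")
    case True
    then show ?thesis using that by simp
  next
    case False
    then obtain A where s: "s = 1" and A: "reduces_to (rk e) (below e e) {A}" "letter_pos k = card A - 1" using kd(5) by blast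
    have "card A \<le> rk e"
      using irreducible_family_card_le[OF reduces_to_irreducible[OF A(1) below_subset]] by simp
    then show ?thesis using that s A(2) by simp
  qed
  show "ideal_part {..<k} (e + d) \<subseteq> ?X"
  proof (rule ideal_part_least[OF lin.subspace_span])
    fix l and h :: "'k poly" assume l: "l \<in> {..<k}" "deg l \<le> e + d" "effective (e + d - deg l)"
      and h: "h \<in> piece (e + d - deg l)"
    have lk: "l < k" using l by simp
    show "gen l * h * twist (deg l) (e + d - deg l) \<in> ?X"
    proof (cases "deg l < e")
      case True
      then have "l \<in> lower e" using lk k by (simp add: lower_def)
      then have "gen l * h * twist (deg l) (e + d - deg l) \<in> ideal_part (lower e) (e + d)"
        using ideal_part_base l h by blast
      then show ?thesis unfolding ideal_part_lower by (intro lin.span_base) blast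
    next
      case False
      then obtain b' where le: "deg l = e" and b': "b' < letter_pos k" "letter_exp l = ms e ! b'"
        using blk(6)[OF lk] by blast
      have "(\<Sum>i=1..n. letter_exp l i) = rk e" using letter_exp_sum[OF blk(1,2)] b' blk(3) by simp
      moreover have "s \<le> letter_exp l j" using pos[OF b'(1)] kd(4)[OF b'(1)] b'(2) by simp
      ultimately obtain u where u: "u \<in> sections (rk e - s)" "gen l = t j ^ s * u"
        using tmono_split[OF kd(1), of s "letter_exp l"] unfolding gen_def by auto
      have "u * h \<in> sections (rk e - s + rk d)" using sections_mult[OF u(1), of h "rk d"] h le by simp
      moreover have "gen l * h * twist e d = (u * h) * (t j ^ s * twist e d)" unfolding u(2) by (simp add: mult_ac)
      ultimately have "gen l * h * twist e d \<in> tangent_part e j s d" unfolding tangent_part_def by blast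
      then show ?thesis using le by (intro lin.span_base) simp
    qed
  qed
  have "family_span (rk (e + d)) (below e (e + d)) \<subseteq> ideal_part {..<k} (e + d)"
    unfolding ideal_part_lower[symmetric] using blk(5) by (intro ideal_part_mono) (simp add: lower_def)
  moreover have "tangent_part e j s d \<subseteq> ideal_part {..<k} (e + d)"
  proof
    fix x assume "x \<in> tangent_part e j s d"
    then obtain y where y: "y \<in> sections (rk e - s + rk d)" "x = y * (t j ^ s * twist e d)"
      unfolding tangent_part_def by blast
    have "y * (t j ^ s * twist e d) \<in> ideal_part {..<k} (e + d)"
    proof (rule span_image_mult_subset[OF _ ideal_part_subspace])
      show "y \<in> lin.span {f * h | f h. f \<in> sections (rk e - s) \<and> h \<in> piece d}"
        using sections_add_subset y(1) by blast
      fix z assume "z \<in> {f * h | f h. f \<in> sections (rk e - s) \<and> h \<in> (piece d :: 'k poly set)}"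
      then obtain f h where fh: "f \<in> sections (rk e - s)" "h \<in> piece d" "z = f * h" by blast
      have "t j ^ s * f \<in> ideal_part {..<k} e"
        using tangent_power_in_ideal[OF k kind] fh(1) unfolding e_def by blast
      from ideal_part_mult[OF this fh(2) d] show "z * (t j ^ s * twist e d) \<in> ideal_part {..<k} (e + d)"
        unfolding fh(3) by (simp add: mult_ac)
    qed
    then show "x \<in> ideal_part {..<k} (e + d)" using y(2) by simp
  qed
  ultimately show "?X \<subseteq> ideal_part {..<k} (e + d)"
    by (intro lin.span_minimal ideal_part_subspace) blast
qed

end

subsection \<open>Iterated colon ideals\<close>

text \<open>
  The homogeneous pieces of the iterated colon ideals have two possible shapes: sums of spaces of sections
  vanishing at given sets of points, or spaces between all sections and those vanishing at one point.
\<close>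

datatype ideal_shape = Vanishing "nat \<Rightarrow> nat set set" | Point nat "nat \<Rightarrow> bool"

context stable_choices
begin

text \<open>\<open>G d\<close> describes the given ideal plus the letters of lower degree,
  normalised because colons are computed for irreducible families. A pure letter removes from each
  set the marked zeros of t_j^(\<open>rk e\<close>) times the twist. For a tangent letter the
  predicate says that the colon has an element nonzero at \<open>P j\<close>. In the last equation
  it says that the target piece is everything already, or that multiplication by the letter forces a
  zero at \<open>P j\<close>, or that a multiple of a preceding letter is nonzero there.\<close>

fun colon_shape :: "ideal_shape \<Rightarrow> nat \<Rightarrow> ideal_shape" where
  "colon_shape (Vanishing F) k =
    (let e = deg k; G = (\<lambda>d. normal_form (rk (e + d)) (F (e + d) \<union> below e (e + d))) in
     case kind_of k of
       Pure j \<Rightarrow> Vanishing (\<lambda>d. (\<lambda>A. A - (carry e d \<union> (if 0 < rk e then {j} else {}))) ` G d)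
     | Tangent j s \<Rightarrow> Point j (\<lambda>d. \<exists>A\<in>G d. j \<notin> A - (carry e d \<union> (if 1 < s then {j} else {})) \<and>
         card (A - (carry e d \<union> (if 1 < s then {j} else {}))) \<le> rk e - (s - 1) + rk d))"
| "colon_shape (Point j S) k =
    (let e = deg k in
     Point j (\<lambda>d. S (e + d) \<or> 0 < letter_exp k j \<or> j \<in> carry e d \<or>
       (\<exists>l<k. deg l \<le> e + d \<and> effective (e + d - deg l) \<and> letter_exp l j = 0 \<and>
          j \<notin> carry (deg l) (e + d - deg l))))"

fun wf_shape :: "ideal_shape \<Rightarrow> bool" where
  "wf_shape (Vanishing F) \<longleftrightarrow> (\<forall>d. F d \<subseteq> Pow {1..n})"
| "wf_shape (Point j S) \<longleftrightarrow> j \<in> {1..n}"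

fun is_unit_shape :: "ideal_shape \<Rightarrow> bool" where
  "is_unit_shape (Vanishing F) \<longleftrightarrow> {} \<in> F 0"
| "is_unit_shape (Point j S) \<longleftrightarrow> S 0"

definition nonstandard :: "nat list \<Rightarrow> bool" where
  "nonstandard w \<longleftrightarrow> is_unit_shape (foldl colon_shape (Vanishing (\<lambda>_. {})) w)"

definition smaller_words :: "nat list \<Rightarrow> nat list set" where
  "smaller_words w = {v. sorted v \<and> set v \<subseteq> {..<N} \<and> weight v = weight w \<and>
     (v, w) \<in> lexord {(i, j). i < j}}"

lemma normal_form_Un_below:
  assumes "F \<subseteq> Pow {1..n}"
  shows "irreducible_family n r (normal_form r (F \<union> below e d))"
    and "reduces_to r (F \<union> below e d) (normal_form r (F \<union> below e d))"
    and "F \<union> below e d \<subseteq> Pow {1..n}"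
proof -
  show sub: "F \<union> below e d \<subseteq> Pow {1..n}" using assms below_subset by blast
  show red: "reduces_to r (F \<union> below e d) (normal_form r (F \<union> below e d))"
    by (rule normal_form[OF finite_family[OF sub]])
  show "irreducible_family n r (normal_form r (F \<union> below e d))" by (rule reduces_to_irreducible[OF red sub])
qed

lemma wf_colon_shape:
  assumes "wf_shape I" "k < N"
  shows "wf_shape (colon_shape I k)"
proof (cases I)
  case (Vanishing F)
  show ?thesis
  proof (cases "kind_of k")
    case (Pure j)
    have "normal_form r (F d \<union> below e d) \<subseteq> Pow {1..n}" for r e d
      using normal_form_Un_below(1)[of "F d" r e d] assms(1) Vanishing by (simp add: irreducible_family_def)
    then show ?thesis using Vanishing Pure by (fastforce simp: Let_def)
  next
    case (Tangent j s)
    then show ?thesis using Vanishing kind_of[OF assms(2)] by (simp add: Let_def)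
  qed
next
  case (Point j S)
  then show ?thesis using assms(1) by (simp add: Let_def)
qed

end

section \<open>Correctness of the recursion for colons\<close>

context stable_ring
begin

fun shape_part :: "ideal_shape \<Rightarrow> nat \<Rightarrow> 'k poly set" where
  "shape_part (Vanishing F) d = family_span (rk d) (F d)"
| "shape_part (Point j S) d = (if S d then piece d else vanishing (rk d) {j})"

lemma shape_part_subspace: "lin.subspace (shape_part I d)"
  by (cases I) (simp_all add: family_span_subspace sections_subspace vanishing_subspace)

abbreviation in_colon :: "ideal_shape \<Rightarrow> nat \<Rightarrow> nat \<Rightarrow> 'k poly \<Rightarrow> bool" where
  "in_colon I k d f \<equiv> gen k * f * twist (deg k) d \<in>
     lin.span (shape_part I (deg k + d) \<union> ideal_part {..<k} (deg k + d))"

lemma gen_twist: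
  assumes k: "k < N"
  shows "gen k * twist (deg k) d \<in> sections (rk (deg k) + card (carry (deg k) d))"
    and "gen k * twist (deg k) d \<noteq> 0"
    and "i \<in> {1..n} \<Longrightarrow> ev i (rk (deg k) + card (carry (deg k) d)) (gen k * twist (deg k) d) = 0 \<longleftrightarrow>
      0 < letter_exp k i \<or> i \<in> carry (deg k) d"
proof -
  note lf = letter_facts[OF k]
  show "gen k * twist (deg k) d \<in> sections (rk (deg k) + card (carry (deg k) d))"
    by (rule sections_mult[OF lf(5) twist_sections])
  have "gen k \<noteq> 0" unfolding gen_def tmono_def using t_nonzero by simp
  then show "gen k * twist (deg k) d \<noteq> 0" using twist_nonzero by simp
  show "ev i (rk (deg k) + card (carry (deg k) d)) (gen k * twist (deg k) d) = 0 \<longleftrightarrow>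
      0 < letter_exp k i \<or> i \<in> carry (deg k) d" if i: "i \<in> {1..n}"
    using section_value_mult[OF lf(5) twist_sections, of "P i" "deg k" d] lf(6)[OF i] ev_twist[OF i] by simp
qed

lemma colon_shape_pure:
  assumes k: "k < N" and kind: "kind_of k = Pure j" and F: "\<And>d. F d \<subseteq> Pow {1..n}"
    and d: "effective d" and f: "f \<in> piece d"
  shows "f \<in> shape_part (colon_shape (Vanishing F) k) d \<longleftrightarrow>
    in_colon (Vanishing F) k d f"
proof -
  define e where "e = deg k"
  define m where "m = gen k * twist e d"
  define Z where "Z = carry e d \<union> (if 0 < rk e then {j} else {})"
  define r where "r = rk (e + d)"
  note gt = gen_twist[OF k, where d = d, folded e_def, folded m_def]
  have hk: "letter_pos k = 0" "j \<in> {1..n}" "\<forall>i\<in>{1..n}. letter_exp k i = (if i = j then rk e else 0)"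
    using kind_of[OF k] letters_block(4)[OF k] unfolding kind e_def by auto
  have r: "r = (rk e + card (carry e d)) + rk d"
    using rk_add[OF letter_facts(2)[OF k] d] unfolding r_def e_def by simp
  have Z': "Z = {i\<in>{1..n}. ev i (rk e + card (carry e d)) m = 0}"
    using gt(3) hk(2,3) carry_subset[of e d] unfolding Z_def by (auto split: if_splits)
  \<comment> \<open>Without marked zeros both the power of t_j and the twist are trivial, so m is a
    constant; this is the proviso of \<open>family_span_colon\<close>.\<close>
  have Z0: "rk e + card (carry e d) = 0" if "Z = {}"
    using that unfolding Z_def by (auto split: if_splits)
  note nf = normal_form_Un_below(1,2)[OF F[of "e + d"], of r e "e + d"]
    normal_form_Un_below(3)[OF F[of "e + d"], of e "e + d"]
  have g1: "gen k * f * twist e d = f * m" unfolding m_def by (simp add: mult_ac)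
  have g2: "lin.span (family_span r (F (e + d)) \<union> ideal_part {..<k} (e + d)) =
    family_span r (normal_form r (F (e + d) \<union> below e (e + d)))"
    unfolding family_span_reduces_to[OF nf(2,3)] family_span_Un
    using ideal_part_first[OF k hk(1), of "e + d"] unfolding e_def r_def by simp
  have g3: "shape_part (colon_shape (Vanishing F) k) d =
    family_span (rk d) ((\<lambda>A. A - Z) ` normal_form r (F (e + d) \<union> below e (e + d)))"
    using kind unfolding Z_def r_def e_def by (simp add: Let_def)
  have "f \<in> shape_part (colon_shape (Vanishing F) k) d \<longleftrightarrow> gen k * f * twist e d \<in>
      lin.span (shape_part (Vanishing F) (e + d) \<union> ideal_part {..<k} (e + d))"
    unfolding g3 g1 shape_part.simps(1) r_def[symmetric] g2
    using family_span_colon[OF nf(1) n4 gt(1,2) f r Z' Z0] by blast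
  then show ?thesis unfolding e_def .
qed

text \<open>Write \<open>gen k\<close> = t_j^(s-1) q with q nonzero at \<open>P j\<close>, and m =
  t_j^(s-1) \<open>twist e d\<close>. The enlarged ideal contains all multiples of t_j m, so whether
  q f m belongs to it depends on the value of q f, hence of f, at \<open>P j\<close> only. If that
  value is nonzero, membership amounts to the existence of some h m in the family span with h
  nonzero at \<open>P j\<close>.\<close>

lemma colon_shape_tangent:
  assumes k: "k < N" and kind: "kind_of k = Tangent j s" and F: "\<And>d. F d \<subseteq> Pow {1..n}"
    and d: "effective d" and f: "f \<in> piece d"
  shows "f \<in> shape_part (colon_shape (Vanishing F) k) d \<longleftrightarrow>
    in_colon (Vanishing F) k d f"
proof -
  define e where "e = deg k"
  define m where "m = t j ^ (s - 1) * twist e d"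
  define Z where "Z = carry e d \<union> (if 1 < s then {j} else {})"
  define r where "r = rk (e + d)"
  define a where "a = s - 1 + card (carry e d)"
  define b where "b = rk e - (s - 1) + rk d"
  define G where "G = normal_form r (F (e + d) \<union> below e (e + d))"
  define X where "X = lin.span (family_span r G \<union> tangent_part e j s d)"
  have hk: "j \<in> {1..n}" "1 \<le> s" "s \<le> rk e" "letter_exp k j = s - 1"
    using kind_of[OF k] letters_block(4)[OF k] unfolding kind e_def by auto
  have hkind: "has_kind (deg k) (letter_pos k) (Tangent j s)" using kind_of[OF k] unfolding kind .
  have r: "r = a + b"
    using rk_add[OF letter_facts(2)[OF k] d] hk unfolding r_def e_def a_def b_def by simp
  have tp: "t j ^ (s - 1) \<in> sections (s - 1)" using t_power[OF hk(1) hk(1)] by blast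
  have m: "m \<in> sections a" "m \<noteq> 0"
    unfolding m_def a_def using sections_mult[OF tp twist_sections] twist_nonzero t_nonzero[OF hk(1)] by simp_all
  have evm: "ev i a m = 0 \<longleftrightarrow> i \<in> Z" if i: "i \<in> {1..n}" for i
    using section_value_mult[OF tp twist_sections, of "P i" e d] t_power[OF i hk(1), of "s - 1"] ev_twist[OF i, of e d]
    unfolding m_def a_def Z_def by auto
  have Z': "Z = {i\<in>{1..n}. ev i a m = 0}"
    using evm hk(1) carry_subset[of e d] unfolding Z_def by auto
  have Z0: "a = 0" if "Z = {}"
    using that unfolding Z_def a_def by (auto split: if_splits)
  obtain q where q: "q \<in> sections (rk e - (s - 1))" "gen k = t j ^ (s - 1) * q" "ev j (rk e - (s - 1)) q \<noteq> 0"
    using tmono_split[OF hk(1), of "s - 1" "letter_exp k"] letter_facts(4)[OF k] hk(4) unfolding gen_def e_def by auto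
  have qf: "q * f \<in> sections b" unfolding b_def by (rule sections_mult[OF q(1) f])
  have evqf: "ev j b (q * f) = 0 \<longleftrightarrow> ev j (rk d) f = 0"
    using section_value_mult[OF q(1) f, of "P j"] q(3) unfolding b_def by simp
  have prod: "gen k * f * twist e d = (q * f) * m" unfolding m_def q(2) by (simp add: mult_ac)
  have bs: "rk e - s + rk d = b - 1" "b > 0" using hk unfolding b_def by simp_all
  have ts: "t j ^ s = t j * t j ^ (s - 1)" using hk(2) by (cases s) simp_all
  have tan: "t j * h * m \<in> tangent_part e j s d" if "h \<in> sections (b - 1)" for h
    unfolding tangent_part_def bs(1) m_def ts by (rule image_eqI[OF _ that]) (simp add: mult_ac)
  note nf = normal_form_Un_below(1,2)[OF F[of "e + d"], of r e "e + d", folded G_def]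
    normal_form_Un_below(3)[OF F[of "e + d"], of e "e + d"]
  have X: "lin.span (family_span r (F (e + d)) \<union> ideal_part {..<k} (e + d)) = X"
  proof -
    have "ideal_part {..<k} (e + d) = lin.span (family_span r (below e (e + d)) \<union> tangent_part e j s d)"
      using ideal_part_tangent[OF k hkind d] unfolding e_def r_def .
    moreover have "family_span r G = lin.span (family_span r (F (e + d)) \<union> family_span r (below e (e + d)))"
      unfolding family_span_reduces_to[OF nf(2,3)] family_span_Un ..
    ultimately show ?thesis unfolding X_def by (simp add: span_Un_span Un_assoc)
  qed
  define crit where "crit \<longleftrightarrow> (\<exists>A\<in>G. j \<notin> A - Z \<and> card (A - Z) \<le> b)"
  have crit: "(\<exists>h\<in>sections b. ev j b h \<noteq> 0 \<and> h * m \<in> family_span r G) \<longleftrightarrow> crit"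
    unfolding crit_def by (rule family_span_tangent[OF nf(1) n4 hk(1) m r Z' Z0])
  have zero: "h * m \<in> X" if h: "h \<in> vanishing b {j}" for h
  proof -
    consider "h = 0" | h' where "h' \<in> sections (b - 1)" "h = t j * h'" using vanishing_point[OF hk(1) h] by blast
    then show ?thesis
    proof cases
      case 1
      then show ?thesis using lin.span_zero unfolding X_def by simp
    next
      case (2 h')
      then show ?thesis using tan[of h'] unfolding X_def by (intro lin.span_base) simp
    qed
  qed
  have "(q * f) * m \<in> X \<longleftrightarrow> crit \<or> ev j (rk d) f = 0"
  proof
    assume "crit \<or> ev j (rk d) f = 0"
    then show "(q * f) * m \<in> X"
    proof
      assume "ev j (rk d) f = 0"
      then show ?thesis using zero[of "q * f"] evqf qf by (simp add: vanishing_def)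
    next
      assume crit
      then obtain h where h: "h \<in> sections b" "ev j b h \<noteq> 0" "h * m \<in> family_span r G" using crit by blast
      \<comment> \<open>One such h suffices for every f: q f differs from a multiple of h by a
        section that vanishes at \<open>P j\<close>.\<close>
      obtain c where c: "q * f - smult c h \<in> vanishing b {j}" using sections_reduce[OF hk(1) h(1,2) qf] .
      have "h * m \<in> X" unfolding X_def using h(3) by (intro lin.span_base) simp
      then have "(q * f - smult c h) * m + smult c (h * m) \<in> X"
        using zero[OF c] unfolding X_def by (intro lin.span_add lin.span_scale)
      then show ?thesis by (simp add: algebra_simps)
    qed
  next
    assume "(q * f) * m \<in> X"
    then obtain x y where xy: "(q * f) * m = x + y" "x \<in> family_span r G" "y \<in> tangent_part e j s d"
      unfolding X_def lin.span_Un
      using family_span_subspace[of r G] tangent_part_subspace[of e j s d] by (auto simp: lin.span_eq_iff[THEN iffD2])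
    then obtain h where h: "h \<in> sections (b - 1)" "y = t j * h * m"
      unfolding tangent_part_def bs(1) m_def ts by (auto simp: mult_ac)
    \<comment> \<open>Subtracting the tangent summand does not change the value at
      \<open>P j\<close>, so this cofactor witnesses the criterion when f is nonzero there.\<close>
    have x: "x = (q * f - t j * h) * m" using xy(1) h(2) by (simp add: algebra_simps)
    have b1: "b = 1 + (b - 1)" using bs(2) by simp
    have th: "t j * h \<in> sections b" "ev j b (t j * h) = 0"
      using sections_mult[OF t_sections[OF hk(1)] h(1)] ev_mult[OF t_sections[OF hk(1)] h(1) b1, of j] ev_t[OF hk(1) hk(1)] b1
      by simp_all
    show "crit \<or> ev j (rk d) f = 0"
    proof (cases "ev j (rk d) f = 0")
      case False
      then have "ev j b (q * f - t j * h) \<noteq> 0" using evqf th(2) by simp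
      moreover have "q * f - t j * h \<in> sections b" using qf th(1) by (rule sections_diff)
      ultimately show ?thesis using crit xy(2) unfolding x by blast
    qed simp
  qed
  moreover have "shape_part (colon_shape (Vanishing F) k) d = (if crit then piece d else vanishing (rk d) {j})"
    unfolding colon_shape.simps Let_def kind letter_kind.case shape_part.simps crit_def G_def Z_def b_def r_def e_def
    by (rule refl)
  then have "f \<in> shape_part (colon_shape (Vanishing F) k) d \<longleftrightarrow> crit \<or> ev j (rk d) f = 0"
    using f by (simp add: vanishing_def)
  ultimately have "f \<in> shape_part (colon_shape (Vanishing F) k) d \<longleftrightarrow> gen k * f * twist e d \<in>
      lin.span (shape_part (Vanishing F) (e + d) \<union> ideal_part {..<k} (e + d))"
    unfolding prod shape_part.simps(1) r_def[symmetric] X by blast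
  then show ?thesis unfolding e_def .
qed

lemma vanishing_point_maximal:
  assumes "j \<in> {1..n}" "lin.subspace X" "vanishing r {j} \<subseteq> X" "x \<in> X" "x \<in> sections r" "ev j r x \<noteq> 0"
  shows "sections r \<subseteq> X"
proof
  fix f :: "'k poly" assume f: "f \<in> sections r"
  obtain c where "f - smult c x \<in> vanishing r {j}" using sections_reduce[OF assms(1,5,6) f] .
  then have "(f - smult c x) + smult c x \<in> X"
    using assms(2,3,4) by (intro lin.subspace_add lin.subspace_scale) auto
  then show "f \<in> X" by simp
qed

text \<open>The ideal already contains all sections vanishing at \<open>P j\<close>, so its sum with
  the ideal of the preceding letters is, in each degree, either that hyperplane or everything. One
  element nonzero at \<open>P j\<close> decides, and \<open>hit\<close> says that the letters
  provide it.\<close>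

lemma colon_shape_point:
  assumes k: "k < N" and j: "j \<in> {1..n}" and d: "effective d" and f: "f \<in> piece d"
  shows "f \<in> shape_part (colon_shape (Point j S) k) d \<longleftrightarrow>
    in_colon (Point j S) k d f"
proof -
  define e where "e = deg k"
  define r where "r = rk (e + d)"
  define m where "m = gen k * twist e d"
  define X where "X = lin.span (shape_part (Point j S) (e + d) \<union> ideal_part {..<k} (e + d))"
  define hit where "hit \<longleftrightarrow> (\<exists>l<k. deg l \<le> e + d \<and> effective (e + d - deg l) \<and> letter_exp l j = 0 \<and>
          j \<notin> carry (deg l) (e + d - deg l))"
  have sub: "lin.subspace X" unfolding X_def by simp
  have vX: "vanishing r {j} \<subseteq> X"
    unfolding X_def r_def by (auto intro!: lin.span_base simp: vanishing_def)
  have gval: "gen l * h * twist (deg l) c \<in> piece (deg l + c) \<and>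
    ev j (rk (deg l + c)) (gen l * h * twist (deg l) c) =
      ev j (rk (deg l) + card (carry (deg l) c)) (gen l * twist (deg l) c) * ev j (rk c) h"
    if l: "l < N" and c: "effective c" and h: "h \<in> piece c" for l h c
  proof -
    have r': "rk (deg l + c) = (rk (deg l) + card (carry (deg l) c)) + rk c"
      using rk_add[OF letter_facts(2)[OF l] c] by simp
    have eq: "gen l * h * twist (deg l) c = (gen l * twist (deg l) c) * h" by (simp add: mult_ac)
    show ?thesis
      unfolding r' eq using sections_mult[OF gen_twist(1)[OF l] h] section_value_mult[OF gen_twist(1)[OF l] h] by blast
  qed
  have fX: "gen k * f * twist e d \<in> X \<longleftrightarrow> S (e + d) \<or> hit \<or> 0 < letter_exp k j \<or> j \<in> carry e d \<or> ev j (rk d) f = 0"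
  proof (cases "S (e + d) \<or> hit")
    case True
    have "sections r \<subseteq> X"
    proof (cases "S (e + d)")
      case True
      then show ?thesis unfolding X_def r_def by (auto intro!: lin.span_base)
    next
      case False
      then obtain l where l: "l < k" "deg l \<le> e + d" "effective (e + d - deg l)" "letter_exp l j = 0"
        "j \<notin> carry (deg l) (e + d - deg l)" using \<open>S (e + d) \<or> hit\<close> unfolding hit_def by blast
      let ?c = "e + d - deg l"
      have lN: "l < N" using l(1) k by simp
      obtain h where h: "h \<in> piece ?c" "ev j (rk ?c) h \<noteq> 0"
        using separating_section[of "{}" j "rk ?c"] j by auto
      have le: "deg l + ?c = e + d" using l(2) by simp
      have "gen l * h * twist (deg l) ?c \<in> X"
        unfolding X_def using ideal_part_base[of l "{..<k}" "e + d" h] l h(1) by (intro lin.span_base) simp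
      moreover have "gen l * h * twist (deg l) ?c \<in> sections r" "ev j r (gen l * h * twist (deg l) ?c) \<noteq> 0"
        using gval[OF lN l(3) h(1)] gen_twist(3)[OF lN j, where d = ?c] l(4,5) h(2) unfolding le r_def by simp_all
      ultimately show ?thesis by (rule vanishing_point_maximal[OF j sub vX])
    qed
    then show ?thesis using True gval[OF k d f] unfolding r_def e_def by blast
  next
    case False
    have "ideal_part {..<k} (e + d) \<subseteq> vanishing r {j}"
    proof (rule ideal_part_least[OF vanishing_subspace])
      fix l and h :: "'k poly"
      assume l: "l \<in> {..<k}" "deg l \<le> e + d" "effective (e + d - deg l)"
        and h: "h \<in> piece (e + d - deg l)"
      let ?c = "e + d - deg l"
      have lN: "l < N" using l(1) k by simp
      have le: "deg l + ?c = e + d" using l(2) by simp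
      have "letter_exp l j > 0 \<or> j \<in> carry (deg l) ?c"
      proof (rule ccontr)
        assume "\<not> ?thesis"
        then have hit unfolding hit_def using l by (intro exI[of _ l]) simp
        then show False using False by simp
      qed
      then show "gen l * h * twist (deg l) ?c \<in> vanishing r {j}"
        using gval[OF lN l(3) h] gen_twist(3)[OF lN j, where d = ?c] unfolding le r_def vanishing_def by simp
    qed
    then have "X \<subseteq> vanishing r {j}"
      unfolding X_def using False by (intro lin.span_minimal vanishing_subspace) (simp add: r_def)
    then have "X = vanishing r {j}" using vX by blast
    then show ?thesis
      using False gval[OF k d f] gen_twist(3)[OF k j, where d = d] unfolding r_def e_def vanishing_def by auto
  qed
  have "f \<in> shape_part (colon_shape (Point j S) k) d \<longleftrightarrow>
    S (e + d) \<or> hit \<or> 0 < letter_exp k j \<or> j \<in> carry e d \<or> ev j (rk d) f = 0"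
    using f unfolding hit_def e_def by (auto simp add: Let_def vanishing_def)
  then show ?thesis using fX unfolding X_def e_def by simp
qed

lemma colon_shape:
  assumes "k < N" "wf_shape I" "effective d" "f \<in> piece d"
  shows "f \<in> shape_part (colon_shape I k) d \<longleftrightarrow>
    in_colon I k d f"
proof (cases I)
  case (Vanishing F)
  then have F: "\<And>d. F d \<subseteq> Pow {1..n}" using assms(2) by simp
  show ?thesis
  proof (cases "kind_of k")
    case (Pure j)
    show ?thesis unfolding Vanishing by (rule colon_shape_pure[OF assms(1) Pure F assms(3,4)])
  next
    case (Tangent j s)
    show ?thesis unfolding Vanishing by (rule colon_shape_tangent[OF assms(1) Tangent F assms(3,4)])
  qed
next
  case (Point j S)
  then have "j \<in> {1..n}" using assms(2) by simp
  then show ?thesis unfolding Point by (rule colon_shape_point[OF assms(1) _ assms(3,4)])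
qed

section \<open>Reduction of words letter by letter\<close>

definition reducible_modulo :: "ideal_shape \<Rightarrow> nat list \<Rightarrow> bool" where
  "reducible_modulo I w \<longleftrightarrow>
     word_value w \<in> lin.span (shape_part I (weight w) \<union> word_value ` smaller_words w)"

text \<open>The cofactor of l < k is a combination of words, and inserting l into a sorted word
  leaves a first letter at most l.\<close>

lemma ideal_part_eq_words:
  assumes d: "effective d" and k: "k \<le> N"
  shows "ideal_part {..<k} d =
    lin.span (word_value ` {v. sorted v \<and> set v \<subseteq> {..<N} \<and> weight v = d \<and> (\<exists>l v'. v = l # v' \<and> l < k)})"
    (is "_ = lin.span (word_value ` ?W)")
proof
  show "ideal_part {..<k} d \<subseteq> lin.span (word_value ` ?W)"
  proof (rule ideal_part_least[OF lin.subspace_span])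
    fix l and h :: "'k poly"
    assume l: "l \<in> {..<k}" "deg l \<le> d" "effective (d - deg l)" and h: "h \<in> piece (d - deg l)"
    let ?c = "d - deg l"
    have "h * (gen l * twist (deg l) ?c) \<in> lin.span (word_value ` ?W)"
    proof (rule span_image_mult_subset[OF _ lin.subspace_span])
      show "h \<in> word_span ?c" using sections_subset_words[OF l(3)] h by blast
      fix x assume "x \<in> word_value ` words ?c"
      then obtain v where v: "v \<in> words ?c" "x = word_value v" by blast
      define u where "u = insort l (sort v)"
      have "x * (gen l * twist (deg l) ?c) = word_value (l # sort v)"
        using v by (simp add: words_def word_value_sort mult_ac)
      also have "\<dots> = word_value u" unfolding u_def word_value_insort ..
      finally have "x * (gen l * twist (deg l) ?c) = word_value u" .
      moreover have "u \<in> ?W"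
      proof -
        have su: "sorted u" unfolding u_def by (simp add: sorted_insort)
        have "set u = insert l (set v)" unfolding u_def by (simp add: set_insort_key)
        moreover from this obtain a u' where u: "u = a # u'" by (cases u) auto
        moreover have "a \<le> l" using su calculation by (metis insertI1 list.set_intros(1) set_ConsD sorted_simps(2) order_refl)
        moreover have "weight u = d" using v l(2) unfolding u_def by (simp add: words_def)
        ultimately show ?thesis using su v l(1) k by (auto simp: words_def)
      qed
      ultimately show "x * (gen l * twist (deg l) ?c) \<in> lin.span (word_value ` ?W)"
        by (simp add: lin.span_base)
    qed
    then show "gen l * h * twist (deg l) ?c \<in> lin.span (word_value ` ?W)" by (simp add: mult_ac)
  qed
  show "lin.span (word_value ` ?W) \<subseteq> ideal_part {..<k} d"
  proof (rule lin.span_minimal[OF _ ideal_part_subspace])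
    show "word_value ` ?W \<subseteq> ideal_part {..<k} d"
    proof
      fix x assume "x \<in> word_value ` ?W"
      then obtain l v' where v: "set (l # v') \<subseteq> {..<N}" "weight (l # v') = d" "l < k" "x = word_value (l # v')" by blast
      have "weight v' = d - deg l" "deg l \<le> d" using v(2) by auto
      then show "x \<in> ideal_part {..<k} d"
        using ideal_part_base[of l "{..<k}" d "word_value v'"] word_value_sections[of v'] v by simp
    qed
  qed
qed

lemma smaller_words_Cons:
  assumes w: "sorted (k # w)" "set (k # w) \<subseteq> {..<N}"
  shows "smaller_words (k # w) =
    {v. sorted v \<and> set v \<subseteq> {..<N} \<and> weight v = weight (k # w) \<and> (\<exists>l v'. v = l # v' \<and> l < k)} \<union>
    {k # v | v. v \<in> smaller_words w \<and> sorted (k # v)}" (is "?L = ?A \<union> ?B")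
proof (rule set_eqI)
  fix v
  \<comment> \<open>Excludes the empty word: it precedes \<open>k # w\<close> in the dictionary but
    has weight 0.\<close>
  have deg: "deg k \<ge> 1" using letter_facts(1)[of k] w by simp
  show "v \<in> ?L \<longleftrightarrow> v \<in> ?A \<union> ?B"
    using w deg by (cases v) (auto simp: smaller_words_def lexord_cons_cons)
qed

text \<open>All words \<open>k # v\<close> of the given weight share the factor g =
  \<open>gen k\<close> times the twist. Cancelling it turns a relation among them modulo K into one
  among their tails modulo the colon.\<close>

lemma reducible_modulo_Cons:
  assumes w: "sorted (k # w)" "set (k # w) \<subseteq> {..<N}" and I: "wf_shape I"
  shows "reducible_modulo I (k # w) \<longleftrightarrow> reducible_modulo (colon_shape I k) w"
proof -
  have k: "k < N" and w': "set w \<subseteq> {..<N}" using w by simp_all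
  let ?e = "deg k" and ?c = "weight w"
  define K where "K = lin.span (shape_part I (?e + ?c) \<union> ideal_part {..<k} (?e + ?c))"
  define Wk where "Wk = {v. sorted v \<and> set v \<subseteq> {..<N} \<and> weight v = weight (k # w) \<and> (\<exists>l v'. v = l # v' \<and> l < k)}"
  define g where "g = gen k * twist ?e ?c"
  have eff: "effective ?c" "word_value w \<in> piece ?c" using word_value_sections[OF w'] by simp_all
  have effd: "effective (?e + ?c)" using effective_add[OF letter_facts(2)[OF k] eff(1)] .
  have J: "ideal_part {..<k} (?e + ?c) = lin.span (word_value ` Wk)"
    using ideal_part_eq_words[OF effd, of k] k unfolding Wk_def by simp
  define R where "R = lin.span (K \<union> (\<lambda>v. word_value v * g) ` smaller_words w)"
  have smaller: "v \<in> smaller_words w \<Longrightarrow> weight v = ?c \<and> set v \<subseteq> {..<N} \<and> sorted v" for v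
    by (simp add: smaller_words_def)
  have val: "word_value (k # v) = word_value v * g" if "weight v = ?c" for v
    unfolding g_def using that by (simp add: mult_ac)
  have L: "lin.span (shape_part I (weight (k # w)) \<union> word_value ` smaller_words (k # w)) = R"
  proof (rule antisym; unfold R_def; rule lin.span_minimal[OF _ lin.subspace_span])
    let ?R = "lin.span (K \<union> (\<lambda>v. word_value v * g) ` smaller_words w)"
    have KR: "K \<subseteq> ?R" by (auto intro: lin.span_base)
    have KI: "shape_part I (?e + ?c) \<subseteq> K" "ideal_part {..<k} (?e + ?c) \<subseteq> K"
      unfolding K_def by (auto intro: lin.span_base)
    have "word_value ` Wk \<subseteq> ideal_part {..<k} (?e + ?c)" unfolding J by (auto intro: lin.span_base)
    then have "word_value ` Wk \<subseteq> ?R" using KI(2) KR by (rule order_trans[OF order_trans])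
    moreover have "shape_part I (?e + ?c) \<subseteq> ?R" using KI(1) KR by (rule order_trans)
    moreover have "word_value (k # v) \<in> ?R" if "v \<in> smaller_words w" for v
      using val[of v] smaller[OF that] that by (auto intro!: lin.span_base)
    ultimately show "shape_part I (weight (k # w)) \<union> word_value ` smaller_words (k # w) \<subseteq> ?R"
      unfolding smaller_words_Cons[OF w] Wk_def[symmetric] by auto
    let ?L = "lin.span (shape_part I (weight (k # w)) \<union> word_value ` smaller_words (k # w))"
    have Wk: "word_value ` Wk \<subseteq> ?L"
      unfolding smaller_words_Cons[OF w] Wk_def[symmetric] by (auto intro: lin.span_base)
    then have JL: "ideal_part {..<k} (?e + ?c) \<subseteq> ?L" unfolding J by (rule lin.span_minimal) simp
    have "shape_part I (?e + ?c) \<subseteq> ?L" by (auto intro: lin.span_base)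
    then have "K \<subseteq> ?L" unfolding K_def using JL by (intro lin.span_minimal) auto
    moreover have "word_value v * g \<in> ?L" if v: "v \<in> smaller_words w" for v
    proof (cases "sorted (k # v)")
      case True
      then have "k # v \<in> smaller_words (k # w)" unfolding smaller_words_Cons[OF w] using v by blast
      then have "word_value (k # v) \<in> ?L" by (intro lin.span_base UnI2 imageI)
      then show ?thesis unfolding val[OF conjunct1[OF smaller[OF v]]] .
    next
      case False
      then obtain l v' where lv: "v = l # v'" "l < k" using smaller[OF v] by (cases v) (auto simp: not_le)
      then have l: "set v' \<subseteq> {..<N}" "deg l + weight v' = ?c" using smaller[OF v] by auto
      have lw: "word_value (k # v) = word_value (l # k # v')" unfolding lv word_value_swap ..
      have "word_value (k # v') \<in> piece (?e + weight v')"
        using word_value_sections[of "k # v'"] k l by simp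
      moreover have "effective (?e + weight v')" using word_value_sections[of "k # v'"] k l by simp
      moreover have "?e + ?c - deg l = ?e + weight v'" "deg l \<le> ?e + ?c" using l(2) by simp_all
      ultimately have "word_value (l # k # v') \<in> ideal_part {..<k} (?e + ?c)"
        using ideal_part_base[of l "{..<k}" "?e + ?c" "word_value (k # v')"] lv(2) by simp
      then show ?thesis using JL unfolding lw[symmetric] val[OF conjunct1[OF smaller[OF v]]] by blast
    qed
    ultimately show "K \<union> (\<lambda>v. word_value v * g) ` smaller_words w \<subseteq> ?L" by auto
  qed
  let ?C = "shape_part (colon_shape I k) ?c"
  have colon: "f \<in> ?C \<longleftrightarrow> f * g \<in> K" if "f \<in> piece ?c" for f
    using colon_shape[OF k I eff(1) that] unfolding K_def g_def by (simp add: mult_ac)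
  have Csub: "?C \<subseteq> piece ?c"
    using family_span_sections by (cases "colon_shape I k") (auto simp: vanishing_def)
  have Wsub: "word_value ` smaller_words w \<subseteq> piece ?c"
    using smaller word_value_sections by force
  have "word_value w \<in> lin.span (?C \<union> word_value ` smaller_words w) \<longleftrightarrow> word_value w * g \<in> R"
  proof
    assume "word_value w \<in> lin.span (?C \<union> word_value ` smaller_words w)"
    then show "word_value w * g \<in> R"
    proof (rule span_image_mult_subset[rotated 2])
      show "lin.subspace R" by (simp add: R_def)
      show "x * g \<in> R" if "x \<in> ?C \<union> word_value ` smaller_words w" for x
        unfolding R_def using that colon Csub by (intro lin.span_base) auto
    qed
  next
    assume "word_value w * g \<in> R"
    then obtain x y where xy: "word_value w * g = x + y" "x \<in> K" "y \<in> lin.span ((\<lambda>v. word_value v * g) ` smaller_words w)"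
      unfolding R_def lin.span_Un unfolding K_def by (auto simp: lin.span_span)
    have "lin.span ((\<lambda>v. word_value v * g) ` smaller_words w) \<subseteq>
      (\<lambda>z. z * g) ` lin.span (word_value ` smaller_words w)"
    proof (rule lin.span_minimal)
      show "(\<lambda>v. word_value v * g) ` smaller_words w \<subseteq> (\<lambda>z. z * g) ` lin.span (word_value ` smaller_words w)"
        by (auto intro: lin.span_base)
      show "lin.subspace ((\<lambda>z. z * g) ` lin.span (word_value ` smaller_words w))"
        by (rule mult_image_subspace) simp
    qed
    \<comment> \<open>The combination of the smaller words is itself a multiple of g, so the
      difference of the cofactors is in the colon.\<close>
    then obtain z where z: "y = z * g" "z \<in> lin.span (word_value ` smaller_words w)" using xy(3) by blast
    have "z \<in> piece ?c" using lin.span_minimal[OF Wsub sections_subspace] z(2) by blast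
    then have "word_value w - z \<in> piece ?c" using eff(2) by blast
    moreover have "(word_value w - z) * g \<in> K" using xy(1,2) z(1) by (simp add: algebra_simps)
    ultimately have "word_value w - z \<in> ?C" using colon by blast
    then have "(word_value w - z) + z \<in> lin.span (?C \<union> word_value ` smaller_words w)"
      using z(2) lin.span_mono[of "word_value ` smaller_words w" "?C \<union> word_value ` smaller_words w"]
      by (intro lin.span_add) (auto intro: lin.span_base)
    then show "word_value w \<in> lin.span (?C \<union> word_value ` smaller_words w)" by simp
  qed
  then show ?thesis unfolding reducible_modulo_def L val[OF refl] by blast
qed

text \<open>No word is smaller than the empty one, and in degree 0, where all sections are
  constants, V_A vanishes unless A is empty.\<close>

lemma reducible_modulo_Nil:
  assumes "wf_shape I"
  shows "reducible_modulo I [] \<longleftrightarrow> is_unit_shape I"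
proof -
  have "smaller_words [] = {}" by (auto simp: smaller_words_def)
  then have *: "reducible_modulo I [] \<longleftrightarrow> 1 \<in> shape_part I 0"
    using shape_part_subspace[of I 0] by (simp add: reducible_modulo_def lin.span_eq_iff[THEN iffD2])
  have ev1: "ev i 0 1 = 1" for i using section_value_const[of "P i" 1] by (simp flip: one_pCons)
  show ?thesis
  proof (cases I)
    case (Vanishing F)
    have "1 \<in> family_span 0 (F 0) \<longleftrightarrow> {} \<in> F 0"
    proof
      assume "{} \<in> F 0"
      then show "1 \<in> family_span 0 (F 0)"
        using vanishing_subset_family_span[of "{}" "F 0" 0] by (auto simp: vanishing_def)
    next
      assume one: "1 \<in> family_span 0 (F 0)"
      show "{} \<in> F 0"
      proof (rule ccontr)
        assume ne: "{} \<notin> F 0"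
        have "family_span 0 (F 0) \<subseteq> {0}"
        proof (rule family_span_least)
          show "lin.subspace {0 :: 'k poly}" by (rule lin.subspace_single_0)
          fix A assume A: "A \<in> F 0"
          then have "A \<subseteq> {1..n}" "A \<noteq> {}" using assms Vanishing ne by auto
          then show "vanishing 0 A \<subseteq> {0}" using vanishing_eq_0[of A 0] finite_subset[of A "{1..n}"] by (simp add: card_gt_0_iff)
        qed
        then show False using one by auto
      qed
    qed
    then show ?thesis using * Vanishing by simp
  next
    case (Point j S)
    then show ?thesis using * ev1 by (simp add: vanishing_def)
  qed
qed

lemma reducible_iff_nonstandard:
  assumes "sorted w" "set w \<subseteq> {..<N}"
  shows "word_value w \<in> lin.span (word_value ` smaller_words w) \<longleftrightarrow> nonstandard w"
proof -
  have "reducible_modulo I w \<longleftrightarrow> is_unit_shape (foldl colon_shape I w)" if "wf_shape I" for I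
    using assms that
  proof (induction w arbitrary: I)
    case Nil
    then show ?case using reducible_modulo_Nil by simp
  next
    case (Cons k w)
    then show ?case using reducible_modulo_Cons[of k w I] wf_colon_shape[of I k] by simp
  qed
  from this[of "Vanishing (\<lambda>_. {})"]
  have "reducible_modulo (Vanishing (\<lambda>_. {})) w \<longleftrightarrow> nonstandard w" by (simp add: nonstandard_def)
  moreover have "lin.span ({0} \<union> X) = lin.span X" for X :: "'k poly set"
    using lin.span_insert_0 by simp
  ultimately show ?thesis by (simp add: reducible_modulo_def)
qed

end

subsection \<open>The dictionary order\<close>

abbreviation (input) "keys \<equiv> Poly_Mapping.keys"
abbreviation (input) "lookup \<equiv> Poly_Mapping.lookup"
abbreviation (input) "single \<equiv> Poly_Mapping.single"

lemma mset_concat_replicate: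
  "distinct xs \<Longrightarrow> count (mset (concat (map (\<lambda>i. replicate (c i) i) xs))) i = (if i \<in> set xs then c i else 0)"
  by (induction xs) auto

lemma count_word_of [simp]: "count (mset (word_of m)) i = lookup m i"
  unfolding word_of_def by (subst mset_concat_replicate) (auto simp: in_keys_iff)

lemma set_word_of [simp]: "set (word_of m) = keys m"
  by (auto simp: word_of_def in_keys_iff)

lemma sorted_concat_replicate:
  "sorted xs \<Longrightarrow> sorted (concat (map (\<lambda>i. replicate (c i) i) xs))"
  by (induction xs) (auto simp: sorted_append)

lemma sorted_word_of [simp]: "sorted (word_of m)"
  unfolding word_of_def by (rule sorted_concat_replicate) simp

lemma word_of_inject: "word_of m = word_of m' \<longleftrightarrow> m = m'"
proof
  assume "word_of m = word_of m'"
  then have "lookup m i = lookup m' i" for i by (metis count_word_of)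
  then show "m = m'" by (rule poly_mapping_eqI)
qed simp

lemma word_of_surj:
  assumes "sorted w"
  obtains m where "word_of m = w"
proof -
  define m where "m = Abs_poly_mapping (count (mset w))"
  have "finite {i. count (mset w) i \<noteq> 0}" by (rule finite_subset[of _ "set w"]) (auto simp: count_mset_0_iff)
  then have "lookup m = count (mset w)" unfolding m_def by (rule Abs_poly_mapping_inverse[OF CollectI])
  then have "mset (word_of m) = mset w" by (intro multiset_eqI) simp
  then have "word_of m = w" using assms properties_for_sort[of "word_of m" w] by (simp add: sorted_sort_id)
  then show thesis using that by blast
qed

lemma mset_word_of_add: "mset (word_of (m + m')) = mset (word_of m) + mset (word_of m')"
  by (rule multiset_eqI) (simp add: lookup_add)

lemma dict_less_irrefl [simp]: "\<not> m \<prec> m"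
  unfolding dict_less_def by (rule lexord_irreflexive) auto

lemma dict_less_trans: "a \<prec> b \<Longrightarrow> b \<prec> c \<Longrightarrow> a \<prec> c"
  unfolding dict_less_def by (rule lexord_trans) (auto intro: transI)

lemma dict_less_linear: "a \<prec> b \<or> a = b \<or> b \<prec> a"
proof -
  have "\<forall>a b :: nat. (a, b) \<in> {(i, j). i < j} \<or> a = b \<or> (b, a) \<in> {(i, j). i < j}" by auto
  from lexord_linear[OF this, of "word_of a" "word_of b"] show ?thesis
    unfolding dict_less_def word_of_inject .
qed

lemma dict_max_exists:
  assumes "finite S" "S \<noteq> {}"
  shows "\<exists>m\<in>S. \<forall>m'\<in>S. m' \<noteq> m \<longrightarrow> m' \<prec> m"
  using assms
proof (induction S rule: finite_ne_induct)
  case (insert x S)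
  then obtain m where m: "m \<in> S" "\<forall>m'\<in>S. m' \<noteq> m \<longrightarrow> m' \<prec> m" by blast
  show ?case
  proof (cases "x \<prec> m")
    case True
    then show ?thesis using m by blast
  next
    case False
    then have "m \<prec> x" using dict_less_linear insert m by metis
    then have "\<forall>m'\<in>S. m' \<prec> x" using m dict_less_trans by metis
    then show ?thesis by (intro bexI[of _ x]) auto
  qed
qed simp

lemma initial_monomialI:
  assumes "m \<in> keys f" "\<And>m'. m' \<in> keys f \<Longrightarrow> m' \<noteq> m \<Longrightarrow> m' \<prec> m"
  shows "initial_monomial f = m"
  unfolding initial_monomial_def
proof (rule the_equality)
  show "m \<in> keys f \<and> (\<forall>m'\<in>keys f. m' \<noteq> m \<longrightarrow> m' \<prec> m)" using assms by blast
  fix m' assume m': "m' \<in> keys f \<and> (\<forall>x\<in>keys f. x \<noteq> m' \<longrightarrow> x \<prec> m')"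
  show "m' = m"
  proof (rule ccontr)
    assume ne: "m' \<noteq> m"
    then have "m' \<prec> m" "m \<prec> m'" using assms m' by auto
    then show False using dict_less_trans dict_less_irrefl by blast
  qed
qed

lemma initial_monomial:
  assumes "f \<noteq> 0"
  shows "initial_monomial f \<in> keys f"
    and "\<And>m'. m' \<in> keys f \<Longrightarrow> m' \<noteq> initial_monomial f \<Longrightarrow> m' \<prec> initial_monomial f"
proof -
  have "keys f \<noteq> {}" using assms by simp
  then obtain m where m: "m \<in> keys f" "\<forall>m'\<in>keys f. m' \<noteq> m \<longrightarrow> m' \<prec> m"
    using dict_max_exists[of "keys f"] by auto
  have "initial_monomial f = m" by (rule initial_monomialI) (use m in auto)
  then show "initial_monomial f \<in> keys f"
    and "\<And>m'. m' \<in> keys f \<Longrightarrow> m' \<noteq> initial_monomial f \<Longrightarrow> m' \<prec> initial_monomial f" using m by auto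
qed

text \<open>Equal weights and positive degrees rule out proper prefixes. Two sorted words then
  differ first at a letter i of which the smaller word has more copies.\<close>

lemma lexord_eq_count:
  fixes deg :: "nat \<Rightarrow> nat"
  assumes "sorted u" "sorted v" "\<And>x. x \<in> set u \<union> set v \<Longrightarrow> 1 \<le> deg x"
    and "sum_list (map deg u) = sum_list (map deg v)"
  shows "(u, v) \<in> lexord {(i, j). i < j} \<longleftrightarrow>
    (\<exists>i. (\<forall>l<i. count (mset u) l = count (mset v) l) \<and> count (mset v) i < count (mset u) i)"
  using assms
proof (induction u arbitrary: v)
  case Nil
  have "v = []"
  proof (rule ccontr)
    assume "v \<noteq> []"
    then obtain b v' where "v = b # v'" by (cases v) auto
    then show False using Nil.prems(3)[of b] Nil.prems(4) by simp
  qed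
  then show ?case by simp
next
  case (Cons a u)
  have "v \<noteq> []" using Cons.prems(3)[of a] Cons.prems(4) by auto
  then obtain b v' where v: "v = b # v'" by (cases v) auto
  have cu: "count (mset (a # u)) l = 0" if "l < a" for l
    using that Cons.prems(1) by (auto simp: count_eq_zero_iff)
  have cv: "count (mset v) l = 0" if "l < b" for l
    using that Cons.prems(2) unfolding v by (auto simp: count_eq_zero_iff)
  consider "a < b" | "a = b" | "b < a" by linarith
  then show ?case
  proof cases
    case 1
    have "(\<forall>l<a. count (mset (a # u)) l = count (mset v) l) \<and> count (mset v) a < count (mset (a # u)) a"
    proof
      show "\<forall>l<a. count (mset (a # u)) l = count (mset v) l" using cu cv 1 by (metis less_trans)
      show "count (mset v) a < count (mset (a # u)) a" unfolding cv[OF 1] by simp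
    qed
    then show ?thesis using 1 unfolding v by auto
  next
    case 2
    have "(u, v') \<in> lexord {(i, j). i < j} \<longleftrightarrow>
      (\<exists>i. (\<forall>l<i. count (mset u) l = count (mset v') l) \<and> count (mset v') i < count (mset u) i)"
      using Cons.prems 2 unfolding v by (intro Cons.IH) auto
    moreover have "count (mset (a # u)) l = count (mset v) l \<longleftrightarrow> count (mset u) l = count (mset v') l"
        "count (mset v) l < count (mset (a # u)) l \<longleftrightarrow> count (mset v') l < count (mset u) l" for l
      using 2 unfolding v by auto
    ultimately show ?thesis using 2 unfolding v by simp
  next
    case 3
    \<comment> \<open>Here v has a letter b that u lacks altogether: up to b no count of u can be
      the larger one, and beyond b the counts have already differed.\<close>
    have "\<not> ((\<forall>l<i. count (mset (a # u)) l = count (mset v) l) \<and> count (mset v) i < count (mset (a # u)) i)" for i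
    proof (cases "i \<le> b")
      case True
      then have "count (mset (a # u)) i = 0" using 3 by (intro cu) simp
      then show ?thesis by (simp only: not_less0 simp_thms)
    next
      case False
      have "count (mset (a # u)) b = 0" by (rule cu[OF 3])
      moreover have "0 < count (mset v) b" unfolding v by simp
      ultimately show ?thesis using False by (metis not_le less_irrefl)
    qed
    then show ?thesis using 3 unfolding v by auto
  qed
qed

definition mono_deg :: "(nat \<Rightarrow> nat) \<Rightarrow> (nat \<Rightarrow>\<^sub>0 nat) \<Rightarrow> nat" where
  "mono_deg deg m = sum_list (map deg (word_of m))"

lemma mono_deg_add: "mono_deg deg (m + m') = mono_deg deg m + mono_deg deg m'"
proof -
  have "sum_list (map deg w) = \<Sum>\<^sub># (image_mset deg (mset w))" for w
    by (simp add: sum_mset_sum_list flip: mset_map)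
  then show ?thesis by (simp add: mono_deg_def mset_word_of_add)
qed

text \<open>Compatibility with products needs equal degrees: 1 \<prec> x_1, but multiplication by
  x_2 reverses the order, as x_1 x_2 \<prec> x_2. For equal degrees the order compares exponents at
  the first difference.\<close>

lemma dict_less_add:
  assumes "\<And>i. i < N \<Longrightarrow> 1 \<le> deg i"
    and "keys m \<subseteq> {..<N}" "keys m' \<subseteq> {..<N}" "keys a \<subseteq> {..<N}"
    and d: "mono_deg deg m = mono_deg deg m'" and less: "m \<prec> m'"
  shows "m + a \<prec> m' + a"
proof -
  have eq: "x \<prec> y \<longleftrightarrow> (\<exists>i. (\<forall>l<i. lookup x l = lookup y l) \<and> lookup y i < lookup x i)"
    if "keys x \<subseteq> {..<N}" "keys y \<subseteq> {..<N}" "mono_deg deg x = mono_deg deg y" for x y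
    using lexord_eq_count[of "word_of x" "word_of y" deg] that assms(1) unfolding dict_less_def mono_deg_def
    by (auto simp: subset_iff)
  have "keys (m + a) \<subseteq> {..<N}" "keys (m' + a) \<subseteq> {..<N}"
    using assms keys_add[of m a] keys_add[of m' a] by blast+
  then show ?thesis
    using less d unfolding eq[OF assms(2,3) d] by (subst eq) (auto simp: mono_deg_add lookup_add)
qed

text \<open>Takes the place of a well-order, which \<prec> is not: x_2, x_1 x_2, x_1^2 x_2, ...
  descends forever.\<close>

lemma finite_bounded_degree:
  assumes pos: "\<And>i. i < N \<Longrightarrow> 1 \<le> deg i"
  shows "finite {m. keys m \<subseteq> {..<N} \<and> mono_deg deg m = d}"
proof -
  have len: "length w \<le> sum_list (map deg w)" if "set w \<subseteq> {..<N}" for w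
    using that by (induction w) (use pos in force)+
  have "word_of ` {m. keys m \<subseteq> {..<N} \<and> mono_deg deg m = d} \<subseteq> {w. set w \<subseteq> {..<N} \<and> length w \<le> d}"
    using len by (auto simp: mono_deg_def)
  then have "finite (word_of ` {m. keys m \<subseteq> {..<N} \<and> mono_deg deg m = d})"
    by (rule finite_subset) (simp add: finite_lists_length_le)
  then show ?thesis by (rule finite_imageD) (auto simp: inj_on_def word_of_inject)
qed

subsection \<open>Initial ideals of homogeneous ideals\<close>

lemma mpoly_eq_sum_single:
  fixes p :: "'k::field mpoly"
  shows "p = (\<Sum>m\<in>keys p. single m (lookup p m))"
proof (rule poly_mapping_eqI)
  fix x
  have "(\<Sum>m\<in>keys p. lookup (single m (lookup p m)) x) =
    (\<Sum>m\<in>keys p. if m = x then lookup p x else 0)"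
    by (rule sum.cong) (auto simp: lookup_single when_def)
  then show "lookup p x = lookup (\<Sum>m\<in>keys p. single m (lookup p m)) x"
    by (simp add: lookup_sum in_keys_iff)
qed

lemma mpolys_add: "p \<in> mpolys N \<Longrightarrow> q \<in> mpolys N \<Longrightarrow> p + q \<in> mpolys N"
  unfolding mpolys_def using keys_add[of p q] by blast

lemma mpolys_mult:
  assumes "p \<in> mpolys N" "q \<in> mpolys N"
  shows "p * q \<in> mpolys N"
  unfolding mpolys_def
proof safe
  fix m i assume m: "m \<in> keys (p * q)" and i: "i \<in> keys m"
  obtain a b where ab: "a \<in> keys p" "b \<in> keys q" "m = a + b"
    using m keys_mult[of p q] by blast
  then have "keys a \<subseteq> {..<N}" "keys b \<subseteq> {..<N}" using assms by (auto simp: mpolys_def)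
  then show "i < N" using i ab(3) keys_add[of a b] by blast
qed

lemma mpolys_single: "keys m \<subseteq> {..<N} \<Longrightarrow> single m c \<in> mpolys N"
  by (auto simp: mpolys_def)

lemma mpolys_0 [simp]: "0 \<in> mpolys N"
  by (simp add: mpolys_def)

lemma mpolys_1 [simp]: "1 \<in> mpolys N"
  using mpolys_single[of 0 N 1] by simp

definition mono_dvd :: "(nat \<Rightarrow>\<^sub>0 nat) \<Rightarrow> (nat \<Rightarrow>\<^sub>0 nat) \<Rightarrow> bool" where
  "mono_dvd m m' \<longleftrightarrow> (\<exists>a. m' = m + a)"

lemma mono_dvd_refl [simp]: "mono_dvd m m"
  unfolding mono_dvd_def by (rule exI[of _ 0]) simp

lemma mono_dvd_trans: "mono_dvd a b \<Longrightarrow> mono_dvd b c \<Longrightarrow> mono_dvd a c"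
  unfolding mono_dvd_def by (metis add.assoc)

lemma mono_dvd_keys:
  fixes m m' a :: "nat \<Rightarrow>\<^sub>0 nat"
  assumes "m' = m + a"
  shows "keys m \<subseteq> keys m'" "keys a \<subseteq> keys m'"
  using assms by (auto simp: in_keys_iff lookup_add)

definition minimal_monomials :: "(nat \<Rightarrow>\<^sub>0 nat) set \<Rightarrow> (nat \<Rightarrow>\<^sub>0 nat) set" where
  "minimal_monomials M = {m\<in>M. \<forall>m'\<in>M. mono_dvd m' m \<longrightarrow> m' = m}"

lemma minimal_monomial_exists:
  assumes "m \<in> M"
  shows "\<exists>m0\<in>minimal_monomials M. mono_dvd m0 m"
  using assms
proof (induction "mono_deg (\<lambda>_. 1) m" arbitrary: m rule: less_induct)
  case less
  show ?case
  proof (cases "m \<in> minimal_monomials M")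
    case True
    then show ?thesis by (intro bexI[of _ m]) auto
  next
    case False
    then obtain m' where m': "m' \<in> M" "mono_dvd m' m" "m' \<noteq> m"
      using less.prems by (auto simp: minimal_monomials_def)
    then obtain a where a: "m = m' + a" by (auto simp: mono_dvd_def)
    have "a \<noteq> 0" using a m' by auto
    then have "word_of a \<noteq> []" by (metis set_word_of keys_eq_empty list.set(1))
    then have "mono_deg (\<lambda>_. 1) a > 0" by (simp add: mono_deg_def sum_list_triv)
    then have "mono_deg (\<lambda>_. 1) m' < mono_deg (\<lambda>_. 1) m" unfolding a mono_deg_add by simp
    then show ?thesis using less.hyps[of m'] m' mono_dvd_trans by blast
  qed
qed

lemma ideal_generatedE:
  assumes "f \<in> ideal_generated R B"
  obtains C q where "finite C" "C \<subseteq> B" "q ` C \<subseteq> R" "f = (\<Sum>b\<in>C. q b * b)"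
  using assms unfolding ideal_generated_def by blast

lemma ideal_generated_mono: "B \<subseteq> B' \<Longrightarrow> ideal_generated R B \<subseteq> ideal_generated R B'"
  by (rule subsetI, erule ideal_generatedE) (unfold ideal_generated_def, metis (mono_tags, lifting) mem_Collect_eq order_trans)

lemma ideal_generated_least:
  assumes "f \<in> ideal_generated R B" and "0 \<in> J"
    and add: "\<And>x y. x \<in> J \<Longrightarrow> y \<in> J \<Longrightarrow> x + y \<in> J" and mult: "\<And>q b. q \<in> R \<Longrightarrow> b \<in> B \<Longrightarrow> q * b \<in> J"
  shows "f \<in> J"
proof -
  obtain C q where C: "finite C" "C \<subseteq> B" "q ` C \<subseteq> R" "f = (\<Sum>b\<in>C. q b * b)" using ideal_generatedE[OF assms(1)] .
  have "(\<Sum>b\<in>C. q b * b) \<in> J"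
    using C(1-3) by (induction C rule: finite_induct) (auto intro: \<open>0 \<in> J\<close> add mult)
  then show ?thesis using C by simp
qed

lemma ideal_generated_mult:
  assumes "p \<in> R" "b \<in> B"
  shows "p * b \<in> ideal_generated R B"
  unfolding ideal_generated_def using assms by (intro CollectI exI[of _ "{b}"] exI[of _ "\<lambda>_. p"]) auto

lemma ideal_generated_0: "0 \<in> ideal_generated R B"
  unfolding ideal_generated_def by (intro CollectI exI[of _ "{}"] exI[of _ "\<lambda>_. 0"]) auto

abbreviation (input) ideal :: "nat \<Rightarrow> 'k::field mpoly set \<Rightarrow> 'k mpoly set" where
  "ideal N \<equiv> ideal_generated (mpolys N)"

lemma ideal_generated_add:
  fixes B :: "'k::field mpoly set"
  assumes f: "f \<in> ideal N B" and g: "g \<in> ideal N B"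
  shows "f + g \<in> ideal N B"
proof -
  obtain C q where C: "finite C" "C \<subseteq> B" "q ` C \<subseteq> mpolys N" "f = (\<Sum>b\<in>C. q b * b)" using ideal_generatedE[OF f] .
  obtain D p where D: "finite D" "D \<subseteq> B" "p ` D \<subseteq> mpolys N" "g = (\<Sum>b\<in>D. p b * b)" using ideal_generatedE[OF g] .
  define q' where "q' b = (if b \<in> C then q b else 0)" for b
  define p' where "p' b = (if b \<in> D then p b else 0)" for b
  have "f = (\<Sum>b\<in>C \<union> D. q' b * b)"
    unfolding C(4) q'_def using C(1) D(1) by (intro sum.mono_neutral_cong_left) auto
  moreover have "g = (\<Sum>b\<in>C \<union> D. p' b * b)"
    unfolding D(4) p'_def using C(1) D(1) by (intro sum.mono_neutral_cong_left) auto
  ultimately have "f + g = (\<Sum>b\<in>C \<union> D. (q' b + p' b) * b)" by (simp add: sum.distrib distrib_right)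
  moreover have "(\<lambda>b. q' b + p' b) ` (C \<union> D) \<subseteq> mpolys N"
  proof -
    have "q' b \<in> mpolys N" for b using C(3) unfolding q'_def by auto
    moreover have "p' b \<in> mpolys N" for b using D(3) unfolding p'_def by auto
    ultimately show ?thesis using mpolys_add by blast
  qed
  ultimately show ?thesis unfolding ideal_generated_def using C(1,2) D(1,2)
    by (intro CollectI exI[of _ "C \<union> D"] exI[of _ "\<lambda>b. q' b + p' b"]) auto
qed

text \<open>The polynomials all of whose monomials are divisible by some initial monomial from B are
  closed under the operations that build the ideal.\<close>

lemma monomial_in_ideal_generated:
  fixes B :: "'k::field mpoly set"
  assumes "single m c \<in> ideal N (initial_term ` B)" "c \<noteq> 0"
  shows "\<exists>b\<in>B. mono_dvd (initial_monomial b) m"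
proof -
  let ?S = "{f. \<forall>x\<in>keys f. \<exists>b\<in>B. mono_dvd (initial_monomial b) x}"
  have "single m c \<in> ?S"
  proof (rule ideal_generated_least[OF assms(1)])
    fix q b :: "'k mpoly" assume "b \<in> initial_term ` B"
    then obtain g where g: "g \<in> B" "b = initial_term g" by blast
    show "q * b \<in> ?S"
    proof safe
      fix x assume "x \<in> keys (q * b)"
      then obtain a y where "x = a + y" "y \<in> keys b" using keys_mult[of q b] by blast
      then have "x = initial_monomial g + a" using g by (auto simp: initial_term_def add.commute split: if_splits)
      then show "\<exists>b\<in>B. mono_dvd (initial_monomial b) x" using g by (auto simp: mono_dvd_def)
    qed
  next
    fix x y :: "'k mpoly"
    assume "x \<in> ?S"
      "y \<in> ?S"
    then show "x + y \<in> ?S"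
      using keys_add[of x y] by blast
  qed simp
  then show ?thesis using assms(2) by simp
qed

lemma initial_term_multiple:
  fixes f g :: "'k::field mpoly"
  assumes "g \<in> B" "g \<noteq> 0" "mono_dvd (initial_monomial g) m" "keys m \<subseteq> {..<N}"
  shows "single m c \<in> ideal N (initial_term ` B)"
proof -
  obtain a where a: "m = initial_monomial g + a" using assms(3) by (auto simp: mono_dvd_def)
  define c' where "c' = lookup g (initial_monomial g)"
  have c': "c' \<noteq> 0" using initial_monomial(1)[OF assms(2)] by (simp add: c'_def in_keys_iff)
  have "single a (c / c') * initial_term g = single m c"
    using c' unfolding initial_term_def a c'_def[symmetric] by (simp add: mult_single add.commute)
  moreover have "single a (c / c') \<in> mpolys N"
    using mono_dvd_keys(2)[OF a] assms(4) by (intro mpolys_single) auto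
  moreover have "initial_term g \<in> initial_term ` B" using assms(1) by blast
  ultimately show ?thesis using ideal_generated_mult by metis
qed

section \<open>Homogeneous components and Groebner bases\<close>

definition component :: "(nat \<Rightarrow> nat) \<Rightarrow> nat \<Rightarrow> 'k::field mpoly \<Rightarrow> 'k mpoly" where
  "component deg d f = (\<Sum>m\<in>{m\<in>keys f. mono_deg deg m = d}. single m (lookup f m))"

lemma lookup_component:
  "lookup (component deg d f) x = (if mono_deg deg x = d then lookup f x else 0)"
proof -
  have "lookup (component deg d f) x =
    (\<Sum>m\<in>{m\<in>keys f. mono_deg deg m = d}. if m = x then lookup f x else 0)"
    unfolding component_def lookup_sum by (rule sum.cong) (auto simp: lookup_single when_def)
  then show ?thesis by (auto simp: in_keys_iff)
qed

lemma keys_component: "keys (component deg d f) = {m\<in>keys f. mono_deg deg m = d}"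
  by (auto simp: in_keys_iff lookup_component split: if_splits)

lemma sum_components: "f = (\<Sum>d\<in>mono_deg deg ` keys f. component deg d f)"
proof (rule poly_mapping_eqI)
  fix x
  have "(\<Sum>d\<in>mono_deg deg ` keys f. lookup (component deg d f) x) =
    (\<Sum>d\<in>mono_deg deg ` keys f. if d = mono_deg deg x then lookup f x else 0)"
    by (rule sum.cong) (auto simp: lookup_component)
  also have "\<dots> = lookup f x" by (auto simp: in_keys_iff image_iff)
  finally show "lookup f x = lookup (\<Sum>d\<in>mono_deg deg ` keys f. component deg d f) x"
    by (simp add: lookup_sum)
qed

locale homogeneous_ideal =
  fixes N :: nat and deg :: "nat \<Rightarrow> nat" and I :: "'k::field mpoly set"
  assumes deg_pos: "\<And>i. i < N \<Longrightarrow> 1 \<le> deg i"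
    and subset: "I \<subseteq> mpolys N" and zero: "0 \<in> I"
    and add: "\<And>f g. f \<in> I \<Longrightarrow> g \<in> I \<Longrightarrow> f + g \<in> I"
    and mult: "\<And>q f. q \<in> mpolys N \<Longrightarrow> f \<in> I \<Longrightarrow> q * f \<in> I"
    and component: "\<And>d f. f \<in> I \<Longrightarrow> component deg d f \<in> I"
begin

definition initials :: "(nat \<Rightarrow>\<^sub>0 nat) set" where
  "initials = initial_monomial ` (I - {0})"

lemma initials_keys: "m \<in> initials \<Longrightarrow> keys m \<subseteq> {..<N}"
  using subset initial_monomial(1) unfolding initials_def mpolys_def by blast

text \<open>The component of f in the degree of its initial monomial has the same initial monomial
  and is again in I.\<close>

lemma homogeneous_initial:
  assumes "m \<in> initials"
  shows "\<exists>f\<in>I - {0}. initial_monomial f = m \<and> (\<forall>x\<in>keys f. mono_deg deg x = mono_deg deg m)"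
proof -
  obtain f where f: "f \<in> I" "f \<noteq> 0" "m = initial_monomial f" using assms unfolding initials_def by blast
  let ?g = "component deg (mono_deg deg m) f"
  have m: "m \<in> keys ?g" using initial_monomial(1)[OF f(2)] f(3) by (simp add: keys_component)
  have "initial_monomial ?g = m"
    by (rule initial_monomialI[OF m]) (use initial_monomial(2)[OF f(2)] f(3) in \<open>auto simp: keys_component\<close>)
  moreover have "?g \<noteq> 0" using m by auto
  ultimately show ?thesis using component[OF f(1)] by (intro bexI[of _ ?g]) (auto simp: keys_component)
qed

definition leader :: "(nat \<Rightarrow>\<^sub>0 nat) \<Rightarrow> 'k mpoly" where
  "leader m = (SOME f. f \<in> I - {0} \<and> initial_monomial f = m \<and> (\<forall>x\<in>keys f. mono_deg deg x = mono_deg deg m))"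

lemma leader:
  assumes "m \<in> initials"
  shows "leader m \<in> I" "leader m \<noteq> 0" "initial_monomial (leader m) = m"
    "\<And>x. x \<in> keys (leader m) \<Longrightarrow> mono_deg deg x = mono_deg deg m"
  using someI_ex[of "\<lambda>f. f \<in> I - {0} \<and> initial_monomial f = m \<and> (\<forall>x\<in>keys f. mono_deg deg x = mono_deg deg m)"]
    homogeneous_initial[OF assms] unfolding leader_def[symmetric] by blast+

text \<open>One homogeneous element per minimal initial monomial, so that no two members have
  comparable initial monomials and none can be omitted.\<close>

definition basis :: "'k mpoly set" where
  "basis = leader ` minimal_monomials initials"

lemma basis_subset: "basis \<subseteq> I - {0}"
  unfolding basis_def minimal_monomials_def using leader(1,2) by auto

text \<open>The division algorithm within one degree. Its measure is the number of monomials of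
  degree d that are at most some monomial of f; cancelling the initial term removes at least that
  monomial.\<close>

lemma basis_generates_homogeneous:
  assumes "f \<in> I" "\<And>x. x \<in> keys f \<Longrightarrow> mono_deg deg x = d"
  defines "S \<equiv> \<lambda>f :: 'k mpoly. {m. keys m \<subseteq> {..<N} \<and> mono_deg deg m = d \<and> (\<exists>x\<in>keys f. m = x \<or> m \<prec> x)}"
  shows "f \<in> ideal N basis"
  using assms(1,2)
proof (induction "card (S f)" arbitrary: f rule: less_induct)
  case less
  show ?case
  proof (cases "f = 0")
    case True
    then show ?thesis by (simp add: ideal_generated_0)
  next
    case False
    define m where "m = initial_monomial f"
    note im = initial_monomial[OF False, folded m_def]
    have mi: "m \<in> initials" unfolding initials_def m_def using less.prems(1) False by blast
    obtain m0 where m0: "m0 \<in> minimal_monomials initials" "mono_dvd m0 m" using minimal_monomial_exists[OF mi] by blast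
    then obtain a where a: "m = m0 + a" by (auto simp: mono_dvd_def)
    have m0i: "m0 \<in> initials" using m0 by (simp add: minimal_monomials_def)
    define g where "g = leader m0"
    note g = leader[OF m0i, folded g_def]
    note ig = initial_monomial[OF g(2), unfolded g(3)]
    have ka: "keys a \<subseteq> {..<N}" using mono_dvd_keys(2)[OF a] initials_keys[OF mi] by blast
    have dm: "mono_deg deg m = d" using im(1) less.prems(2) by blast
    \<comment> \<open>Scales the multiple of the leader so that its initial term cancels that of
      f.\<close>
    define c where "c = lookup f m / lookup g m0"
    define h where "h = single a c * g"
    have hk: "\<exists>y\<in>keys g. x = y + a" if "x \<in> keys h" for x
      using that keys_mult[of "single a c" g] unfolding h_def by (auto simp: add.commute split: if_splits)
    have kg: "keys y \<subseteq> {..<N}" if "y \<in> keys g" for y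
      using that g(1) subset unfolding mpolys_def by blast
    have hless: "x \<prec> m \<or> x = m" "mono_deg deg x = d" if x: "x \<in> keys h" for x
    proof -
      obtain y where y: "y \<in> keys g" "x = y + a" using hk[OF x] by blast
      show "mono_deg deg x = d" using y g(4)[OF y(1)] dm unfolding a by (simp add: mono_deg_add)
      have "y = m0 \<or> y \<prec> m0" using ig(2)[OF y(1)] by blast
      moreover have "y + a \<prec> m0 + a" if "y \<prec> m0"
        by (rule dict_less_add[OF deg_pos kg[OF y(1)] initials_keys[OF m0i] ka g(4)[OF y(1)] that])
      ultimately show "x \<prec> m \<or> x = m" unfolding y(2) a by blast
    qed
    have lh: "lookup h m = lookup f m"
    proof -
      have "h = (\<Sum>y\<in>keys g. single (a + y) (c * lookup g y))"
        unfolding h_def by (subst mpoly_eq_sum_single[of g]) (simp add: sum_distrib_left mult_single)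
      then have "lookup h m =
        (\<Sum>y\<in>keys g. if a + y = m then c * lookup g y else 0)"
        by (simp add: lookup_sum lookup_single when_def)
      also have "\<dots> = (\<Sum>y\<in>keys g. if y = m0 then c * lookup g m0 else 0)"
        by (rule sum.cong) (auto simp: a add.commute[of a])
      also have "\<dots> = c * lookup g m0" using ig(1) by simp
      finally show ?thesis using ig(1) by (simp add: c_def in_keys_iff)
    qed
    \<comment> \<open>The difference f - h in a form to which closure of I under sums and multiples
      applies.\<close>
    define f' where "f' = f + single 0 (-1) * h"
    have "single 0 (-1) = (-1 :: 'k mpoly)" by (simp add: single_uminus)
    then have f': "f' = f - h" unfolding f'_def by simp
    have hI: "h \<in> I" unfolding h_def using mult[OF mpolys_single[OF ka] g(1)] .
    have f'I: "f' \<in> I" unfolding f'_def by (intro add mult less.prems(1) hI mpolys_single) simp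
    have kf': "x \<prec> m \<and> mono_deg deg x = d" if x: "x \<in> keys f'" for x
    proof -
      have "x \<noteq> m" using x lh unfolding f' by (auto simp: in_keys_iff lookup_minus)
      moreover have "x \<in> keys f \<or> x \<in> keys h"
        using x unfolding f' by (auto simp: in_keys_iff lookup_minus)
      ultimately show ?thesis using im(2) less.prems(2) hless by blast
    qed
    have "S f' \<subset> S f"
    proof
      show "S f' \<subseteq> S f" unfolding S_def using kf' im(1) dict_less_trans by blast
      have "m \<in> S f" unfolding S_def using im(1) dm initials_keys[OF mi] by blast
      moreover have "m \<notin> S f'" unfolding S_def using kf' dict_less_trans dict_less_irrefl by blast
      ultimately show "S f' \<noteq> S f" by blast
    qed
    moreover have "finite (S f)" unfolding S_def
      by (rule finite_subset[OF _ finite_bounded_degree[of N deg d, OF deg_pos]]) auto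
    ultimately have "card (S f') < card (S f)" by (rule psubset_card_mono[rotated])
    then have "f' \<in> ideal N basis" using less.hyps f'I kf' by blast
    moreover have "h \<in> ideal N basis"
      unfolding h_def g_def using m0 by (intro ideal_generated_mult mpolys_single[OF ka]) (simp add: basis_def)
    ultimately have "f' + h \<in> ideal N basis" by (rule ideal_generated_add)
    then show ?thesis by (simp add: f')
  qed
qed

lemma ideal_generated_basis: "ideal N basis = I"
proof
  show "ideal N basis \<subseteq> I"
  proof
    fix f assume "f \<in> ideal N basis"
    then show "f \<in> I" by (rule ideal_generated_least) (use zero add mult basis_subset in auto)
  qed
  show "I \<subseteq> ideal N basis"
  proof
    fix f assume f: "f \<in> I"
    have part: "component deg d f \<in> ideal N basis" for d
      by (rule basis_generates_homogeneous[OF component[OF f], of d d]) (simp add: keys_component)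
    have "(\<Sum>d\<in>D. component deg d f) \<in> ideal N basis" if "finite D" for D
      using that by (induction D rule: finite_induct) (auto intro: ideal_generated_0 ideal_generated_add part)
    then show "f \<in> ideal N basis" by (subst sum_components[of f deg]) simp
  qed
qed

lemma initial_ideal_eqI:
  assumes B: "B \<subseteq> I - {0}" and dvd: "\<And>m. m \<in> initials \<Longrightarrow> \<exists>b\<in>B. mono_dvd (initial_monomial b) m"
  shows "ideal N (initial_term ` B) = initial_ideal N I"
proof
  show "ideal N (initial_term ` B) \<subseteq> initial_ideal N I"
    unfolding initial_ideal_def using B by (intro ideal_generated_mono image_mono)
  show "initial_ideal N I \<subseteq> ideal N (initial_term ` B)"
  proof
    fix f assume "f \<in> initial_ideal N I"
    then show "f \<in> ideal N (initial_term ` B)"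
      unfolding initial_ideal_def
    proof (rule ideal_generated_least)
      fix q b :: "'k mpoly" assume q: "q \<in> mpolys N" and "b \<in> initial_term ` (I - {0})"
      then obtain g where g: "g \<in> I - {0}" "b = initial_term g" by blast
      define m where "m = initial_monomial g"
      have mi: "m \<in> initials" unfolding m_def initials_def using g by blast
      obtain b' where b': "b' \<in> B" "mono_dvd (initial_monomial b') m" using dvd[OF mi] by blast
      have b0: "b' \<noteq> 0" using B b' by blast
      have "initial_term g = single m (lookup g m)"
        by (simp add: initial_term_def m_def)
      then have "initial_term g \<in> ideal N (initial_term ` B)"
        using initial_term_multiple[OF b'(1) b0 b'(2) initials_keys[OF mi]] by simp
      then obtain C p where C: "finite C" "C \<subseteq> initial_term ` B" "p ` C \<subseteq> mpolys N" "initial_term g = (\<Sum>b\<in>C. p b * b)"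
        by (rule ideal_generatedE)
      have "q * b = (\<Sum>b\<in>C. (q * p b) * b)" unfolding g(2) C(4) by (simp add: sum_distrib_left mult.assoc)
      moreover have "(\<lambda>b. q * p b) ` C \<subseteq> mpolys N" using C(3) q by (auto intro!: mpolys_mult)
      ultimately show "q * b \<in> ideal N (initial_term ` B)"
        unfolding ideal_generated_def using C(1,2) by (intro CollectI exI[of _ C] exI[of _ "\<lambda>b. q * p b"]) auto
    qed (auto intro: ideal_generated_0 ideal_generated_add)
  qed
qed

lemma initial_ideal_dvd:
  assumes "ideal N (initial_term ` B) = initial_ideal N I" and m: "m \<in> initials"
  shows "\<exists>b\<in>B. mono_dvd (initial_monomial b) m"
proof -
  obtain f where f: "f \<in> I - {0}" "m = initial_monomial f" using m unfolding initials_def by blast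
  have "1 * initial_term f \<in> initial_ideal N I"
    unfolding initial_ideal_def using f by (intro ideal_generated_mult) auto
  then have "single m (lookup f m) \<in> ideal N (initial_term ` B)"
    unfolding assms(1) by (simp add: initial_term_def f(2))
  moreover have "lookup f m \<noteq> 0" using initial_monomial(1)[of f] f by (simp add: in_keys_iff)
  ultimately show ?thesis by (rule monomial_in_ideal_generated)
qed

lemma groebner_basis_exists: "groebner_basis N I basis"
  unfolding groebner_basis_def
proof (intro conjI allI impI)
  show "basis \<subseteq> I - {0}" by (rule basis_subset)
  show "ideal N basis = I" by (rule ideal_generated_basis)
  show "ideal N (initial_term ` basis) = initial_ideal N I"
  proof (rule initial_ideal_eqI[OF basis_subset])
    fix m assume "m \<in> initials"
    then obtain m0 where m0: "m0 \<in> minimal_monomials initials" "mono_dvd m0 m" using minimal_monomial_exists by blast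
    then have "leader m0 \<in> basis" "initial_monomial (leader m0) = m0"
      using leader(3) by (auto simp: basis_def minimal_monomials_def)
    then show "\<exists>b\<in>basis. mono_dvd (initial_monomial b) m" using m0 by metis
  qed
  fix G' assume G': "G' \<subset> basis"
  show "ideal N (initial_term ` G') \<noteq> initial_ideal N I"
  proof
    assume eq: "ideal N (initial_term ` G') = initial_ideal N I"
    obtain f where f: "f \<in> basis" "f \<notin> G'" using G' by blast
    then obtain m where m: "m \<in> minimal_monomials initials" "f = leader m" by (auto simp: basis_def)
    then have mi: "m \<in> initials" by (simp add: minimal_monomials_def)
    obtain b where b: "b \<in> G'" "mono_dvd (initial_monomial b) m" using initial_ideal_dvd[OF eq mi] by blast
    then obtain m' where m': "m' \<in> minimal_monomials initials" "b = leader m'" using G' by (auto simp: basis_def)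
    then have "m' \<in> initials" by (simp add: minimal_monomials_def)
    then have "mono_dvd m' m" using b m' leader(3) by simp
    then have "m' = m" using m \<open>m' \<in> initials\<close> by (auto simp: minimal_monomials_def)
    then show False using f b m m' by simp
  qed
qed

text \<open>Minimality makes the initial monomials of G an antichain, and each initial monomial of I
  is a multiple of one of them. Such an antichain consists of exactly the minimal elements, which
  depend on I only.\<close>

lemma groebner_basis_initial_monomials:
  assumes "groebner_basis N I G"
  shows "initial_monomial ` G = minimal_monomials initials"
proof -
  have G: "G \<subseteq> I - {0}" and eq: "ideal N (initial_term ` G) = initial_ideal N I"
    and min: "\<And>G'. G' \<subset> G \<Longrightarrow> ideal N (initial_term ` G') \<noteq> initial_ideal N I"
    using assms by (auto simp: groebner_basis_def)
  have inG: "initial_monomial g \<in> initials" if "g \<in> G" for g using that G unfolding initials_def by blast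
  have antichain: "g = g'" if g: "g \<in> G" "g' \<in> G" "mono_dvd (initial_monomial g) (initial_monomial g')" for g g'
  proof (rule ccontr)
    assume ne: "g \<noteq> g'"
    have "ideal N (initial_term ` (G - {g'})) = initial_ideal N I"
    proof (rule initial_ideal_eqI)
      show "G - {g'} \<subseteq> I - {0}" using G by blast
      fix m assume "m \<in> initials"
      then obtain b where b: "b \<in> G" "mono_dvd (initial_monomial b) m" using initial_ideal_dvd[OF eq] by blast
      show "\<exists>b\<in>G - {g'}. mono_dvd (initial_monomial b) m"
      proof (cases "b = g'")
        case True
        then show ?thesis using g ne b mono_dvd_trans by blast
      qed (use b in blast)
    qed
    moreover have "G - {g'} \<subset> G" using g by blast
    ultimately show False using min by blast
  qed
  show ?thesis
  proof
    show "initial_monomial ` G \<subseteq> minimal_monomials initials"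
    proof
      fix m assume "m \<in> initial_monomial ` G"
      then obtain g where g: "g \<in> G" "m = initial_monomial g" by blast
      have "m' = m" if m': "m' \<in> initials" "mono_dvd m' m" for m'
      proof -
        obtain b where b: "b \<in> G" "mono_dvd (initial_monomial b) m'" using initial_ideal_dvd[OF eq m'(1)] by blast
        have "mono_dvd (initial_monomial b) m" using b(2) m'(2) by (rule mono_dvd_trans)
        then have "b = g" using antichain b g by blast
        then have "mono_dvd m m'" using b g by simp
        then obtain a a' where "m' = m + a" "m = m' + a'" using m'(2) unfolding mono_dvd_def by blast
        then have "lookup m' i = lookup m i" for i
          by (metis lookup_add le_add1 le_antisym)
        then show ?thesis by (rule poly_mapping_eqI)
      qed
      then show "m \<in> minimal_monomials initials" using inG g by (simp add: minimal_monomials_def)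
    qed
    show "minimal_monomials initials \<subseteq> initial_monomial ` G"
    proof
      fix m assume m: "m \<in> minimal_monomials initials"
      then have "m \<in> initials" by (simp add: minimal_monomials_def)
      then obtain b where b: "b \<in> G" "mono_dvd (initial_monomial b) m" using initial_ideal_dvd[OF eq] by blast
      then have "initial_monomial b = m" using m inG by (auto simp: minimal_monomials_def)
      then show "m \<in> initial_monomial ` G" using b by blast
    qed
  qed
qed

end

subsection \<open>Relations between the generators\<close>

definition scalar :: "'k::field \<Rightarrow> 'k poly fract poly" where
  "scalar c = [:to_fract [:c:]:]"

definition monomial_value :: "'k::field poly fract poly list \<Rightarrow> (nat \<Rightarrow>\<^sub>0 nat) \<Rightarrow> 'k poly fract poly" where
  "monomial_value gs m = (\<Prod>i\<in>keys m. (gs ! i) ^ lookup m i)"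

lemma scalar_simps [simp]: "scalar 0 = 0" "scalar (c + d) = scalar c + scalar d" "scalar (c * d) = scalar c * scalar d"
  by (simp_all add: scalar_def flip: to_fract_add to_fract_mult)

lemma prod_list_concat_replicate:
  fixes f :: "nat \<Rightarrow> 'b::comm_monoid_mult"
  assumes "distinct xs"
  shows "prod_list (map f (concat (map (\<lambda>i. replicate (c i) i) xs))) = (\<Prod>i\<in>set xs. f i ^ c i)"
  using assms by (induction xs) (simp_all add: prod_list_replicate)

lemma monomial_value_word: "monomial_value gs m = prod_list (map ((!) gs) (word_of m))"
  unfolding monomial_value_def word_of_def by (subst prod_list_concat_replicate) simp_all

lemma monomial_value_add: "monomial_value gs (m + m') = monomial_value gs m * monomial_value gs m'"
proof -
  have *: "prod_list (map f w) = prod_mset (image_mset f (mset w))" for w and f :: "nat \<Rightarrow> 'k::field poly fract poly"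
    by (simp add: prod_mset_prod_list flip: mset_map)
  show ?thesis unfolding monomial_value_word * mset_word_of_add by simp
qed

lemma evaluate_altdef:
  "evaluate gs p = (\<Sum>m\<in>keys p. scalar (lookup p m) * monomial_value gs m)"
  by (simp add: evaluate_def scalar_def monomial_value_def)

lemma evaluate_superset:
  assumes "finite S" "keys p \<subseteq> S"
  shows "evaluate gs p = (\<Sum>m\<in>S. scalar (lookup p m) * monomial_value gs m)"
  unfolding evaluate_altdef using assms by (intro sum.mono_neutral_left) (auto simp: in_keys_iff)

lemma evaluate_add: "evaluate gs (p + q) = evaluate gs p + evaluate gs q"
proof -
  let ?S = "keys p \<union> keys q"
  have "evaluate gs (p + q) = (\<Sum>m\<in>?S. scalar (lookup (p + q) m) * monomial_value gs m)"
    using keys_add[of p q] by (intro evaluate_superset) auto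
  also have "\<dots> = (\<Sum>m\<in>?S. scalar (lookup p m) * monomial_value gs m) +
      (\<Sum>m\<in>?S. scalar (lookup q m) * monomial_value gs m)"
    by (simp add: lookup_add distrib_right sum.distrib)
  also have "\<dots> = evaluate gs p + evaluate gs q"
    using evaluate_superset[of ?S p gs] evaluate_superset[of ?S q gs] by simp
  finally show ?thesis .
qed

lemma evaluate_0 [simp]: "evaluate gs 0 = 0"
  by (simp add: evaluate_altdef)

lemma evaluate_sum: "evaluate gs (sum f A) = (\<Sum>x\<in>A. evaluate gs (f x))"
  by (induction A rule: infinite_finite_induct) (simp_all add: evaluate_add)

lemma evaluate_single [simp]: "evaluate gs (single m c) = scalar c * monomial_value gs m"
  using evaluate_superset[of "{m}" "single m c" gs] by simp

lemma evaluate_mult: "evaluate gs (p * q) = evaluate gs p * evaluate gs q"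
proof -
  have pq: "p * q = (\<Sum>a\<in>keys p. \<Sum>b\<in>keys q.
    single (a + b) (lookup p a * lookup q b))"
    by (subst (1) mpoly_eq_sum_single[of p], subst (1) mpoly_eq_sum_single[of q])
       (simp add: sum_product mult_single)
  show ?thesis
    unfolding pq evaluate_sum evaluate_single
    by (simp add: evaluate_altdef sum_product monomial_value_add mult_ac)
qed

section \<open>Evaluation in the trivialised ring\<close>

context stable_ring
begin

text \<open>Multiplication by this and by u^d is the identification of H^0(O(\<open>rk d\<close>))
  with S_d.\<close>

definition triv :: "nat \<Rightarrow> 'k poly fract" where
  "triv d = (\<Prod>i=1..n. to_fract (t i) powi (- \<lfloor>of_nat d * \<alpha> i\<rfloor>))"

abbreviation gs :: "'k poly fract poly list" where
  "gs \<equiv> generators n \<alpha> t ms"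

lemma to_fract_prod: "to_fract (prod f A) = (\<Prod>i\<in>A. to_fract (f i))"
  by (induction A rule: infinite_finite_induct) simp_all

lemma to_fract_power: "to_fract (x ^ k) = to_fract x ^ k"
  by (induction k) simp_all

lemma to_fract_t_nonzero: "i \<in> {1..n} \<Longrightarrow> to_fract (t i) \<noteq> 0"
  using t_nonzero by simp

lemma triv_0 [simp]: "triv 0 = 1"
  by (simp add: triv_def)

lemma triv_nonzero: "triv d \<noteq> 0"
  unfolding triv_def using to_fract_t_nonzero by (auto simp: power_int_eq_0_iff)

lemma triv_mult:
  "triv c * triv d = to_fract (twist c d) * triv (c + d)"
proof -
  have "to_fract (t i) powi (- \<lfloor>of_nat c * \<alpha> i\<rfloor>) * to_fract (t i) powi (- \<lfloor>of_nat d * \<alpha> i\<rfloor>) =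
    to_fract (t i) ^ of_bool (i \<in> carry c d) * to_fract (t i) powi (- \<lfloor>of_nat (c + d) * \<alpha> i\<rfloor>)"
    if i: "i \<in> {1..n}" for i
  proof -
    note nz = to_fract_t_nonzero[OF i]
    have "to_fract (t i) powi (- \<lfloor>of_nat c * \<alpha> i\<rfloor>) * to_fract (t i) powi (- \<lfloor>of_nat d * \<alpha> i\<rfloor>) =
      to_fract (t i) powi (- \<lfloor>of_nat c * \<alpha> i\<rfloor> + - \<lfloor>of_nat d * \<alpha> i\<rfloor>)"
      using nz by (intro power_int_add[symmetric]) simp
    also have "- \<lfloor>of_nat c * \<alpha> i\<rfloor> + - \<lfloor>of_nat d * \<alpha> i\<rfloor> = int (of_bool (i \<in> carry c d)) + - \<lfloor>of_nat (c + d) * \<alpha> i\<rfloor>"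
      using floor_carry[OF i, of c d] by simp
    also have "to_fract (t i) powi \<dots> =
      to_fract (t i) powi int (of_bool (i \<in> carry c d)) * to_fract (t i) powi (- \<lfloor>of_nat (c + d) * \<alpha> i\<rfloor>)"
      using nz by (intro power_int_add) simp
    finally show ?thesis by (simp only: power_int_of_nat)
  qed
  then show ?thesis
    unfolding triv_def twist_def tset_eq_prod[OF carry_subset] to_fract_prod to_fract_power prod.distrib[symmetric]
    by (intro prod.cong) auto
qed

lemma generators_eq: "gs = map (\<lambda>(e, m). generator n \<alpha> t e m) letters"
  by (simp add: generators_def letters_def map_concat comp_def)

lemma length_generators: "length gs = N"
  by (simp add: generators_eq)

lemma generators_nth:
  assumes "k < N"
  shows "gs ! k = monom (to_fract (gen k) * triv (deg k)) (deg k)"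
proof -
  have "gs ! k = generator n \<alpha> t (deg k) (letter_exp k)"
    using assms by (simp add: generators_eq deg_def letter_exp_def split_beta)
  moreover have "(\<Prod>i=1..n. to_fract (t i) powi (int (letter_exp k i) - \<lfloor>of_nat (deg k) * \<alpha> i\<rfloor>)) =
    to_fract (gen k) * triv (deg k)"
    unfolding gen_def tmono_def triv_def to_fract_prod to_fract_power prod.distrib[symmetric]
  proof (rule prod.cong)
    fix i assume "i \<in> {1..n}"
    then have "to_fract (t i) \<noteq> 0" using to_fract_t_nonzero by blast
    then have "to_fract (t i) powi (int (letter_exp k i) + - \<lfloor>of_nat (deg k) * \<alpha> i\<rfloor>) =
      to_fract (t i) powi int (letter_exp k i) * to_fract (t i) powi (- \<lfloor>of_nat (deg k) * \<alpha> i\<rfloor>)"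
      by (intro power_int_add) simp
    then show "to_fract (t i) powi (int (letter_exp k i) - \<lfloor>of_nat (deg k) * \<alpha> i\<rfloor>) =
      to_fract (t i) ^ letter_exp k i * to_fract (t i) powi (- \<lfloor>of_nat (deg k) * \<alpha> i\<rfloor>)"
      by (simp only: diff_conv_add_uminus power_int_of_nat)
  qed simp
  ultimately show ?thesis by (simp add: generator_def)
qed

lemma word_evaluation:
  "set w \<subseteq> {..<N} \<Longrightarrow>
    prod_list (map ((!) gs) w) = monom (to_fract (word_value w) * triv (weight w)) (weight w)"
proof (induction w)
  case Nil
  then show ?case by (simp add: monom_0 flip: one_pCons)
next
  case (Cons k w)
  have "prod_list (map ((!) gs) (k # w)) =
    monom (to_fract (gen k) * triv (deg k)) (deg k) *
    monom (to_fract (word_value w) * triv (weight w)) (weight w)"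
    using Cons generators_nth[of k] by simp
  also have "\<dots> = monom (to_fract (gen k) * to_fract (word_value w) *
    (triv (deg k) * triv (weight w))) (deg k + weight w)"
    by (simp add: mult_monom mult_ac)
  also have "\<dots> = monom (to_fract (word_value (k # w)) * triv (weight (k # w))) (weight (k # w))"
    unfolding triv_mult by (simp add: mult_ac)
  finally show ?case .
qed

lemma mono_deg_eq_weight: "mono_deg deg m = weight (word_of m)"
  by (simp add: mono_deg_def weight_def)

definition graded_value :: "'k \<Rightarrow> (nat \<Rightarrow>\<^sub>0 nat) \<Rightarrow> 'k poly fract" where
  "graded_value c m = to_fract (smult c (word_value (word_of m))) * triv (weight (word_of m))"

lemma scalar_monomial_value:
  assumes "keys m \<subseteq> {..<N}"
  shows "scalar c * monomial_value gs m = monom (graded_value c m) (weight (word_of m))"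
proof -
  have "scalar c * monomial_value gs m =
    smult (to_fract [:c:]) (monom (to_fract (word_value (word_of m)) * triv (weight (word_of m))) (weight (word_of m)))"
    using word_evaluation[of "word_of m"] assms by (simp add: monomial_value_word scalar_def)
  also have "\<dots> = monom (to_fract ([:c:] * word_value (word_of m)) * triv (weight (word_of m))) (weight (word_of m))"
    unfolding to_fract_mult smult_monom by (simp add: mult_ac)
  finally show ?thesis by (simp add: graded_value_def)
qed

lemma evaluate_eq_sum:
  assumes "p \<in> mpolys (N)"
  shows "evaluate gs p = (\<Sum>m\<in>keys p. monom (graded_value (lookup p m) m) (weight (word_of m)))"
  unfolding evaluate_altdef
  by (intro sum.cong refl scalar_monomial_value) (use assms in \<open>auto simp: mpolys_def\<close>)

text \<open>The powers of u separate the degrees, and therefore the kernel is homogeneous.\<close>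

lemma evaluate_component:
  assumes p: "p \<in> mpolys (N)"
  shows "evaluate gs (component deg d p) = monom (coeff (evaluate gs p) d) d"
proof -
  let ?S = "{m\<in>keys p. weight (word_of m) = d}"
  let ?c = "\<lambda>m. graded_value (lookup p m) m"
  have "component deg d p \<in> mpolys (N)"
    using p by (auto simp: mpolys_def keys_component)
  then have "evaluate gs (component deg d p) =
    (\<Sum>m\<in>?S. monom (graded_value (lookup (component deg d p) m) m) (weight (word_of m)))"
    by (simp add: evaluate_eq_sum keys_component mono_deg_eq_weight)
  also have "\<dots> = (\<Sum>m\<in>?S. monom (?c m) d)"
    by (rule sum.cong) (auto simp: lookup_component mono_deg_eq_weight)
  also have "\<dots> = monom (\<Sum>m\<in>?S. ?c m) d"
    by (rule poly_eqI) (simp add: coeff_sum)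
  also have "(\<Sum>m\<in>?S. ?c m) = (\<Sum>m\<in>keys p. if weight (word_of m) = d then ?c m else 0)"
    by (simp add: sum.inter_filter)
  also have "\<dots> = coeff (evaluate gs p) d"
    unfolding evaluate_eq_sum[OF p] coeff_sum by (rule sum.cong) auto
  finally show ?thesis .
qed

sublocale relations: homogeneous_ideal "N" deg "relation_ideal gs"
proof
  show "1 \<le> deg i" if "i < N" for i using letter_facts(1)[OF that] .
  show "relation_ideal gs \<subseteq> mpolys (N)" by (auto simp: relation_ideal_def length_generators)
  show "0 \<in> relation_ideal gs" by (simp add: relation_ideal_def)
  show "f + g \<in> relation_ideal gs" if "f \<in> relation_ideal gs" "g \<in> relation_ideal gs" for f g
    using that by (simp add: relation_ideal_def evaluate_add mpolys_add)
  show "q * f \<in> relation_ideal gs" if "q \<in> mpolys (N)" "f \<in> relation_ideal gs" for q f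
    using that by (simp add: relation_ideal_def evaluate_mult mpolys_mult length_generators)
  show "component deg d f \<in> relation_ideal gs" if "f \<in> relation_ideal gs" for d f
  proof -
    have "f \<in> mpolys (N)" "evaluate gs f = 0" using that by (auto simp: relation_ideal_def length_generators)
    then show ?thesis
      using evaluate_component[of f d] by (auto simp: relation_ideal_def length_generators mpolys_def keys_component)
  qed
qed

lemma word_of_smaller:
  "word_of m' \<in> smaller_words (word_of m) \<longleftrightarrow>
    keys m' \<subseteq> {..<N} \<and> weight (word_of m') = weight (word_of m) \<and> m' \<prec> m"
  by (simp add: smaller_words_def dict_less_def)

text \<open>A homogeneous relation, read as the coefficient of u^d and divided by
  \<open>triv d\<close>, is a linear relation among word values; solve it for the initial
  word.\<close>

lemma initial_imp_reducible:
  assumes "m \<in> relations.initials"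
  shows "word_value (word_of m) \<in> lin.span (word_value ` smaller_words (word_of m))"
proof -
  let ?X = "lin.span (word_value ` smaller_words (word_of m))"
  obtain f where f: "f \<in> relation_ideal gs - {0}" "initial_monomial f = m"
    "\<And>x. x \<in> keys f \<Longrightarrow> weight (word_of x) = weight (word_of m)"
    using relations.homogeneous_initial[OF assms] unfolding mono_deg_eq_weight by blast
  have fp: "f \<in> mpolys (N)" "evaluate gs f = 0" using f by (auto simp: relation_ideal_def length_generators)
  let ?d = "weight (word_of m)"
  let ?v = "\<lambda>x. smult (lookup f x) (word_value (word_of x))"
  note im = initial_monomial[of f, unfolded f(2)]
  have mk: "m \<in> keys f" using im(1) f(1) by simp
  have "0 = coeff (evaluate gs f) ?d" using fp by simp
  also have "\<dots> = (\<Sum>x\<in>keys f. to_fract (?v x) * triv ?d)"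
    unfolding evaluate_eq_sum[OF fp(1)] coeff_sum graded_value_def using f(3) by (intro sum.cong) auto
  also have "\<dots> = (\<Sum>x\<in>keys f. to_fract (?v x)) * triv ?d" by (simp add: sum_distrib_right)
  finally have "(\<Sum>x\<in>keys f. to_fract (?v x)) = 0" using triv_nonzero by simp
  then have "(\<Sum>x\<in>keys f. ?v x) = 0" by (simp only: to_fract_sum[symmetric] to_fract_eq_0_iff)
  then have "?v m = - (\<Sum>x\<in>keys f - {m}. ?v x)"
    using mk by (simp add: sum.remove eq_neg_iff_add_eq_0)
  moreover have "(\<Sum>x\<in>keys f - {m}. ?v x) \<in> ?X"
  proof (rule lin.span_sum)
    fix x assume x: "x \<in> keys f - {m}"
    then have "x \<prec> m" using im(2) f(1) by simp
    then have "word_of x \<in> smaller_words (word_of m)"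
      unfolding word_of_smaller using x f(3) fp(1) by (auto simp: mpolys_def)
    then show "?v x \<in> ?X" by (intro lin.span_scale lin.span_base imageI)
  qed
  ultimately have "?v m \<in> ?X" by (simp only: lin.span_neg)
  then have "smult (inverse (lookup f m)) (?v m) \<in> ?X" by (rule lin.span_scale)
  then show ?thesis using mk by (simp add: in_keys_iff)
qed

lemma reducible_imp_initial:
  assumes m: "keys m \<subseteq> {..<N}"
    and red: "word_value (word_of m) \<in> lin.span (word_value ` smaller_words (word_of m))"
  shows "m \<in> relations.initials"
proof -
  let ?d = "weight (word_of m)"
  let ?small = "{m'. word_of m' \<in> smaller_words (word_of m)}"
  \<comment> \<open>The elements of the trivialised piece attained by polynomials in smaller
    monomials. They form a subspace containing the smaller word values, so the given reduction
    yields one polynomial.\<close>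
  define T where "T = {x. \<exists>p. keys p \<subseteq> ?small \<and> evaluate gs p = monom (to_fract x * triv ?d) ?d}"
  have "lin.subspace T"
  proof (rule lin.subspaceI)
    show "0 \<in> T" unfolding T_def by (intro CollectI exI[of _ 0]) simp
    show "x + y \<in> T" if xy: "x \<in> T" "y \<in> T" for x y
    proof -
      obtain p q where "keys p \<subseteq> ?small" "evaluate gs p = monom (to_fract x * triv ?d) ?d"
        "keys q \<subseteq> ?small" "evaluate gs q = monom (to_fract y * triv ?d) ?d"
        using xy unfolding T_def by blast
      then have "keys (p + q) \<subseteq> ?small"
        "evaluate gs (p + q) = monom (to_fract (x + y) * triv ?d) ?d"
        using keys_add[of p q] by (auto simp: evaluate_add distrib_right add_monom)
      then show ?thesis unfolding T_def by blast
    qed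
    show "smult c x \<in> T" if x: "x \<in> T" for c x
    proof -
      obtain p where p: "keys p \<subseteq> ?small" "evaluate gs p = monom (to_fract x * triv ?d) ?d"
        using x unfolding T_def by blast
      have "keys (single 0 c * p) \<subseteq> ?small"
        using keys_mult[of "single 0 c" p] p(1) by (auto split: if_splits)
      moreover have "evaluate gs (single 0 c * p) = monom (to_fract (smult c x) * triv ?d) ?d"
      proof -
        have "evaluate gs (single 0 c * p) = smult (to_fract [:c:]) (monom (to_fract x * triv ?d) ?d)"
          unfolding evaluate_mult p(2) by (simp add: monomial_value_def scalar_def)
        also have "\<dots> = monom (to_fract ([:c:] * x) * triv ?d) ?d"
          unfolding to_fract_mult smult_monom by (simp add: mult_ac)
        finally show ?thesis by simp
      qed
      ultimately show ?thesis unfolding T_def by blast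
    qed
  qed
  moreover have "word_value ` smaller_words (word_of m) \<subseteq> T"
  proof
    fix x assume "x \<in> word_value ` smaller_words (word_of m)"
    then obtain v where v: "v \<in> smaller_words (word_of m)" "x = word_value v" by blast
    then have "sorted v" by (simp add: smaller_words_def)
    then obtain m' where m': "word_of m' = v" using word_of_surj by blast
    then have "keys m' \<subseteq> {..<N}" "weight v = ?d"
      using v(1) word_of_smaller[of m' m] by simp_all
    then have "evaluate gs (single m' 1) = monom (to_fract x * triv ?d) ?d"
      using scalar_monomial_value[of m' 1] m' v(2) by (simp add: graded_value_def)
    moreover have "keys (single m' (1::'k)) \<subseteq> ?small" using m' v(1) by simp
    ultimately show "x \<in> T" unfolding T_def by blast
  qed
  ultimately have "word_value (word_of m) \<in> T" using lin.span_minimal red by blast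
  then obtain p where p: "keys p \<subseteq> ?small"
    "evaluate gs p = monom (to_fract (word_value (word_of m)) * triv ?d) ?d" unfolding T_def by blast
  \<comment> \<open>The monomial m does not occur in p, so it survives as the initial monomial of
    this relation.\<close>
  define f where "f = single m (-1) + p"
  have mp: "m \<notin> keys p" using p(1) word_of_smaller[of m m] by auto
  have mf: "m \<in> keys f" using mp by (simp add: f_def in_keys_iff lookup_add)
  have kf: "x = m \<or> x \<in> ?small" if "x \<in> keys f" for x
    using that keys_add[of "single m (-1)" p] p(1) unfolding f_def by auto
  have "f \<in> mpolys (N)"
    unfolding mpolys_def using kf m word_of_smaller by blast
  moreover have "evaluate gs f = 0"
    unfolding f_def evaluate_add p(2) evaluate_single scalar_monomial_value[OF m] graded_value_def
    by (simp add: add_monom flip: distrib_right)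
  moreover have "f \<noteq> 0" using mf by auto
  ultimately have "f \<in> relation_ideal gs - {0}" by (simp add: relation_ideal_def length_generators)
  moreover have "initial_monomial f = m"
    by (rule initial_monomialI[OF mf]) (use kf word_of_smaller in blast)
  ultimately show ?thesis unfolding relations.initials_def by blast
qed

text \<open>The right-hand side lives in \<open>stable_choices\<close> and mentions no field, point
  or section; this is where stability comes from.\<close>

lemma initials_eq:
  "relations.initials = {m. keys m \<subseteq> {..<N} \<and> nonstandard (word_of m)}"
proof (rule set_eqI)
  fix m
  have "word_value (word_of m) \<in> lin.span (word_value ` smaller_words (word_of m)) \<longleftrightarrow> nonstandard (word_of m)"
    if "keys m \<subseteq> {..<N}"
    using that by (intro reducible_iff_nonstandard) simp_all
  then show "m \<in> relations.initials \<longleftrightarrow>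
      m \<in> {m. keys m \<subseteq> {..<N} \<and> nonstandard (word_of m)}"
    using relations.initials_keys[of m] initial_imp_reducible[of m] reducible_imp_initial[of m] by blast
qed

end

section \<open>Comparison of two fields and point configurations\<close>

lemma stable_ringI:
  fixes P :: "nat \<Rightarrow> ('k::field) closed_point"
  assumes n: "2 \<le> n" "n \<le> 4" and P: "P ` {1..n} \<subseteq> rational_points" "inj_on P {1..n}"
    and t: "\<And>i. i \<in> {1..n} \<Longrightarrow> vanishes_only_at (t i) (P i)"
    and ms: "\<And>e. e \<ge> 1 \<Longrightarrow> stable_choice n \<alpha> P e (ms e)"
  shows "stable_ring n \<alpha> ms P t"
proof -
  interpret stable_data n \<alpha> ms .
  \<comment> \<open>Here the field leaves the family: nonvanishing of a piece is a condition on the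
    degree of its divisor.\<close>
  have family: "drop_family n \<alpha> P e = below e e" for e
    unfolding drop_family_eq_below[symmetric] drop_family_def effective_def
    using canonical_piece_nonzero_iff[OF P(1)] n by simp
  show ?thesis
  proof
    show "finite (generator_degrees ms)" by (rule finite_generator_degrees[OF P(1) _ ms]) (use n in simp_all)
    show "\<exists>F. reduces_to (rk e) (below e e) F \<and> stable_monomials n (rk e) F (ms e)" if "e \<ge> 1" "effective e" for e
      using ms[OF that(1)] that(2) by (simp add: stable_choice_def effective_def rk_def family not_less[symmetric])
    show "ms e = []" if "e \<ge> 1" "\<not> effective e" for e
      using ms[OF that(1)] that(2) by (simp add: stable_choice_def effective_def)
  qed (use n P t in auto)
qed

theorem theorem17:
  fixes n :: nat and \<alpha> :: "nat \<Rightarrow> rat"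
    and P :: "nat \<Rightarrow> ('k::field) closed_point" and Q :: "nat \<Rightarrow> ('l::field) closed_point"
    and s :: "nat \<Rightarrow> 'k poly" and t :: "nat \<Rightarrow> 'l poly"
    and ms :: "nat \<Rightarrow> (nat \<Rightarrow> nat) list"
  assumes "2 \<le> n" and "n \<le> 4"
    and "P ` {1..n} \<subseteq> rational_points" and "inj_on P {1..n}"
    and "Q ` {1..n} \<subseteq> rational_points" and "inj_on Q {1..n}"
    and "\<And>i. i \<in> {1..n} \<Longrightarrow> vanishes_only_at (s i) (P i)"
    and "\<And>i. i \<in> {1..n} \<Longrightarrow> vanishes_only_at (t i) (Q i)"
    and "\<And>e. e \<ge> 1 \<Longrightarrow> stable_choice n \<alpha> P e (ms e)"
    and "\<And>e. e \<ge> 1 \<Longrightarrow> stable_choice n \<alpha> Q e (ms e)"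
  defines "gs \<equiv> generators n \<alpha> s ms" and "hs \<equiv> generators n \<alpha> t ms"
  shows "(\<exists>G. groebner_basis (length gs) (relation_ideal gs) G) \<and>
    (\<exists>H. groebner_basis (length hs) (relation_ideal hs) H) \<and>
    (\<forall>G H. groebner_basis (length gs) (relation_ideal gs) G \<longrightarrow>
       groebner_basis (length hs) (relation_ideal hs) H \<longrightarrow>
       initial_monomial ` G = initial_monomial ` H)"
proof -
  interpret s: stable_ring n \<alpha> ms P s by (rule stable_ringI) (use assms in auto)
  interpret t: stable_ring n \<alpha> ms Q t by (rule stable_ringI) (use assms in auto)
  \<comment> \<open>Both sets are described by the same term, since the two interpretations share n,
    \<alpha> and \<open>ms\<close>.\<close>
  have "s.relations.initials = t.relations.initials"
    unfolding s.initials_eq t.initials_eq ..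
  then show ?thesis
    unfolding gs_def hs_def s.length_generators t.length_generators
    using s.relations.groebner_basis_exists t.relations.groebner_basis_exists
      s.relations.groebner_basis_initial_monomials t.relations.groebner_basis_initial_monomials by metis
qed

end
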